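(* Let $f\in\mathbb{Q}[x]$ be a square-free polynomial of degree at least $3$, let $m\ge 3$ be an odd integer, and let $a\in\mathbb{Q}\setminus\{0\}$. Consider the hyperelliptic curves $E:y^2=f(x)$ and $E':y^2=x^m+a^2$. Then there exists a rational function $D\in\mathbb{Q}(u,v_1,v_2,v_3)$ such that the Jacobian of the curve $Dy^2=f(x)$ has positive Mordell–Weil rank over $\mathbb{Q}(u,v_1,v_2,v_3)$, and the Jacobian of the curve $y^2=Dx^m+a^2$ has Mordell–Weil rank at least $3$ over $\mathbb{Q}(u,v_1,v_2,v_3)$.
   Context: $\mathbb{Q}(u,v_1,v_2,v_3)$ is the rational function field in four independent variables. For a rational function $D$, the quadratic twist of $y^2=f(x)$ by $D$ is $Dy^2=f(x)$, and the $m$-twist of $y^2=x^m+a^2$ by $D$ is $y^2=Dx^m+a^2$. *)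

theory Defs
  imports
    "HOL-Algebra.Algebraic_Closure_Type"
    "HOL-Algebra.Free_Abelian_Groups"
    "HOL-Computational_Algebra.Squarefree"
    "HOL-Library.Extended_Nat"
begin

section \<open>Rank of an abelian group\<close>

definition int_independent :: "('a, 'b) monoid_scheme \<Rightarrow> 'a set \<Rightarrow> bool" where
  "int_independent G S \<longleftrightarrow>
     finite S \<and> S \<subseteq> carrier G \<and>
     (\<forall>n :: 'a \<Rightarrow> int. finprod G (\<lambda>s. s [^]\<^bsub>G\<^esub> n s) S = \<one>\<^bsub>G\<^esub> \<longrightarrow> (\<forall>s\<in>S. n s = 0))"

definition abelian_group_rank :: "('a, 'b) monoid_scheme \<Rightarrow> enat" where
  "abelian_group_rank G = (SUP S \<in> {S. int_independent G S}. enat (card S))"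


section \<open>Places, divisors and divisor classes of a function field\<close>

text \<open>
  Here \<open>F\<close> is a function field of one variable and \<open>C\<close> its field of constants, which is assumed
  to be algebraically closed. The points of the smooth projective curve with function field \<open>F\<close>
  are the normalised discrete valuations of \<open>F\<close> that are trivial on \<open>C\<close>; in particular the points
  at infinity of an affine model need no separate treatment. All of them have degree one.
\<close>

definition places :: "('a, 'b) ring_scheme \<Rightarrow> 'a set \<Rightarrow> ('a \<Rightarrow> int) set" where
  "places F C = {v.
     v \<in> extensional (carrier F - {\<zero>\<^bsub>F\<^esub>}) \<and>
     v ` (carrier F - {\<zero>\<^bsub>F\<^esub>}) = UNIV \<and>
     (\<forall>a\<in>carrier F - {\<zero>\<^bsub>F\<^esub>}. \<forall>b\<in>carrier F - {\<zero>\<^bsub>F\<^esub>}. v (a \<otimes>\<^bsub>F\<^esub> b) = v a + v b) \<and>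
     (\<forall>a\<in>carrier F - {\<zero>\<^bsub>F\<^esub>}. \<forall>b\<in>carrier F - {\<zero>\<^bsub>F\<^esub>}.
        a \<oplus>\<^bsub>F\<^esub> b \<noteq> \<zero>\<^bsub>F\<^esub> \<longrightarrow> min (v a) (v b) \<le> v (a \<oplus>\<^bsub>F\<^esub> b)) \<and>
     (\<forall>c\<in>C - {\<zero>\<^bsub>F\<^esub>}. v c = 0)}"

definition divisor_group :: "('a, 'b) ring_scheme \<Rightarrow> 'a set \<Rightarrow> (('a \<Rightarrow> int) \<Rightarrow>\<^sub>0 int) monoid" where
  "divisor_group F C = free_Abelian_group (places F C)"

definition divisor_degree :: "('p \<Rightarrow>\<^sub>0 int) \<Rightarrow> int" where
  "divisor_degree c = (\<Sum>p\<in>Poly_Mapping.keys c. Poly_Mapping.lookup c p)"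

definition principal_divisors :: "('a, 'b) ring_scheme \<Rightarrow> 'a set \<Rightarrow> (('a \<Rightarrow> int) \<Rightarrow>\<^sub>0 int) set" where
  "principal_divisors F C = {c \<in> carrier (divisor_group F C).
     \<exists>\<phi>\<in>carrier F - {\<zero>\<^bsub>F\<^esub>}. \<forall>v\<in>places F C. Poly_Mapping.lookup c v = v \<phi>}"

definition Pic :: "('a, 'b) ring_scheme \<Rightarrow> 'a set \<Rightarrow> (('a \<Rightarrow> int) \<Rightarrow>\<^sub>0 int) set monoid" where
  "Pic F C = divisor_group F C Mod principal_divisors F C"

definition Pic0 :: "('a, 'b) ring_scheme \<Rightarrow> 'a set \<Rightarrow> (('a \<Rightarrow> int) \<Rightarrow>\<^sub>0 int) set monoid" where
  "Pic0 F C = (Pic F C)\<lparr>carrier :=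
     {principal_divisors F C #>\<^bsub>divisor_group F C\<^esub> c |c.
        c \<in> carrier (divisor_group F C) \<and> divisor_degree c = 0}\<rparr>"


section \<open>The function field of \<open>d y\<^sup>2 = g(x)\<close>\<close>

text \<open>The pair \<open>(A, B)\<close> of rational functions in \<open>x\<close> stands for \<open>A + B y\<close>, where \<open>y\<^sup>2 = g / d\<close>.\<close>

definition curve_field ::
    "'k::field \<Rightarrow> 'k poly \<Rightarrow> ('k poly fract \<times> 'k poly fract) ring" where
  "curve_field d g = \<lparr>
     carrier = UNIV,
     monoid.mult = (\<lambda>(A, B) (A', B'). (A * A' + B * B' * Fract g [:d:], A * B' + B * A')),
     one = (1, 0),
     ring.zero = (0, 0),
     add = (\<lambda>(A, B) (A', B'). (A + A', B + B'))\<rparr>"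

definition curve_constants :: "('k::field poly fract \<times> 'k poly fract) set" where
  "curve_constants = range (\<lambda>c. (to_fract [:c:], 0))"


section \<open>Galois action\<close>

definition absolute_galois :: "('k::field alg_closure \<Rightarrow> 'k alg_closure) set" where
  "absolute_galois = {\<sigma>. bij \<sigma> \<and>
     (\<forall>x y. \<sigma> (x + y) = \<sigma> x + \<sigma> y) \<and> (\<forall>x y. \<sigma> (x * y) = \<sigma> x * \<sigma> y) \<and>
     (\<forall>c. \<sigma> (to_ac c) = to_ac c)}"

definition map_fract :: "('a::idom \<Rightarrow> 'b::idom) \<Rightarrow> 'a fract \<Rightarrow> 'b fract" where
  "map_fract h q = (THE r. \<exists>a b. b \<noteq> 0 \<and> q = Fract a b \<and> r = Fract (h a) (h b))"

lemma map_fract_Fract: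
  assumes mult: "\<And>x y. h (x * y) = h x * h y"
    and zero: "\<And>x. h x = 0 \<longleftrightarrow> x = 0"
    and "b \<noteq> 0"
  shows "map_fract h (Fract a b) = Fract (h a) (h b)"
  unfolding map_fract_def
proof (rule the_equality)
  show "\<exists>a' b'. b' \<noteq> 0 \<and> Fract a b = Fract a' b' \<and> Fract (h a) (h b) = Fract (h a') (h b')"
    using \<open>b \<noteq> 0\<close> by blast
next
  fix r
  assume "\<exists>a' b'. b' \<noteq> 0 \<and> Fract a b = Fract a' b' \<and> r = Fract (h a') (h b')"
  then obtain a' b' where b': "b' \<noteq> 0" and eq: "Fract a b = Fract a' b'"
    and r: "r = Fract (h a') (h b')"
    by blast
  from eq b' \<open>b \<noteq> 0\<close> have "a * b' = a' * b"
    by (simp add: eq_fract)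
  then have "h a * h b' = h a' * h b"
    by (metis mult)
  with b' \<open>b \<noteq> 0\<close> show "r = Fract (h a) (h b)"
    by (simp add: r eq_fract zero)
qed

text \<open>
  An automorphism of the constants acts on the function field of a curve defined over the base
  field through the coefficients, fixing \<open>x\<close> and \<open>y\<close>; on places it acts by \<open>v \<mapsto> v \<circ> \<sigma>\<inverse>\<close>.
\<close>

definition galois_function ::
    "('k::field \<Rightarrow> 'k) \<Rightarrow> 'k poly fract \<times> 'k poly fract \<Rightarrow> 'k poly fract \<times> 'k poly fract" where
  "galois_function \<sigma> = map_prod (map_fract (map_poly \<sigma>)) (map_fract (map_poly \<sigma>))"

definition galois_place ::
    "('k::field \<Rightarrow> 'k) \<Rightarrow> ('k poly fract \<times> 'k poly fract \<Rightarrow> int) \<Rightarrow>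
      ('k poly fract \<times> 'k poly fract \<Rightarrow> int)" where
  "galois_place \<sigma> v = restrict (v \<circ> galois_function (inv_into UNIV \<sigma>)) (UNIV - {(0, 0)})"

definition galois_divisor ::
    "('k::field \<Rightarrow> 'k) \<Rightarrow> (('k poly fract \<times> 'k poly fract \<Rightarrow> int) \<Rightarrow>\<^sub>0 int) \<Rightarrow>
      (('k poly fract \<times> 'k poly fract \<Rightarrow> int) \<Rightarrow>\<^sub>0 int)" where
  "galois_divisor \<sigma> = frag_extend (\<lambda>v. frag_of (galois_place \<sigma> v))"


section \<open>The Mordell--Weil group of the Jacobian\<close>

text \<open>
  For a perfect field \<open>k\<close>, the \<open>k\<close>-rational points of the Jacobian of the smooth projective model of
  \<open>d y\<^sup>2 = g(x)\<close> (where \<open>d \<noteq> 0\<close> and \<open>g\<close> is squarefree of positive degree) are the Galois-invariant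
  classes of degree-zero divisors over the algebraic closure. An invariant class need not contain
  an invariant divisor, as the curve may have no \<open>k\<close>-rational point when \<open>g\<close> has even degree.
\<close>

definition mordell_weil_group ::
    "'k::field \<Rightarrow> 'k poly \<Rightarrow>
      (('k alg_closure poly fract \<times> 'k alg_closure poly fract \<Rightarrow> int) \<Rightarrow>\<^sub>0 int) set monoid" where
  "mordell_weil_group d g =
     (let J = Pic0 (curve_field (to_ac d) (map_poly to_ac g)) curve_constants
      in J\<lparr>carrier := {\<xi> \<in> carrier J. \<forall>\<sigma>\<in>absolute_galois. galois_divisor \<sigma> ` \<xi> = \<xi>}\<rparr>)"

definition mordell_weil_rank :: "'k::field \<Rightarrow> 'k poly \<Rightarrow> enat" where
  "mordell_weil_rank d g = abelian_group_rank (mordell_weil_group d g)"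


section \<open>The field \<open>\<rat>(u, v\<^sub>1, v\<^sub>2, v\<^sub>3)\<close>\<close>

type_synonym ratfun4 = "rat poly poly poly poly fract"

definition ratfun4_const :: "rat \<Rightarrow> ratfun4" where
  "ratfun4_const c = to_fract [:[:[:[:c:]:]:]:]"

end

theory Submission
  imports Defs "HOL-Computational_Algebra.Formal_Laurent_Series"
begin

text \<open>
  Put \<open>A\<^sub>i = v\<^sub>i\<^sup>2\<^sup>m\<close>, with elementary symmetric functions \<open>s\<^sub>1, s\<^sub>2, s\<^sub>3\<close>. Doubling the point \<open>(0, a\<^sup>3)\<close> on the
  elliptic curve \<open>Y\<^sup>2 = \<Prod>\<^sub>i (a\<^sup>2 + A\<^sub>i X)\<close> gives \<open>D\<^sub>0 = a\<^sup>2 (s\<^sub>1\<^sup>2 - 4 s\<^sub>2) / (4 s\<^sub>3)\<close>, for which all three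
  \<open>D\<^sub>0 A\<^sub>i + a\<^sup>2\<close> are squares. With \<open>F = f(t)\<close> and \<open>D = 1 / (D\<^sub>0\<^sup>m\<^sup>-\<^sup>1 F\<^sup>m)\<close>, which is \<open>F\<close> times a square, the curve
  \<open>D y\<^sup>2 = f(x)\<close> has a point over \<open>x = t\<close> and \<open>y\<^sup>2 = D x\<^sup>m + a\<^sup>2\<close> has the points over \<open>x = F D\<^sub>0 v\<^sub>i\<^sup>2\<close>. One
  variable \<open>t\<close> suffices: we take \<open>v = (t, 1, 2)\<close>.

  Independence of the classes \<open>[P\<^sub>i] - [\<iota>P\<^sub>i]\<close> is detected by the invariant differential \<open>dx/y\<close>. Both curves
  are isotrivial, so the derivation \<open>d/dt\<close> of the base field extends to the function field with
  \<open>x \<mapsto> \<mu>x\<close> and \<open>y \<mapsto> \<kappa>y\<close>. If \<open>\<Sum> n\<^sub>i ([P\<^sub>i] - [\<iota>P\<^sub>i]) = div \<phi>\<close>, then the part of \<open>\<phi>'/\<phi>\<close> that is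
  anti-invariant under \<open>\<iota>\<close> is \<open>y\<close> times a rational function in \<open>x\<close> with simple poles at the \<open>x\<^sub>i\<close>, whose
  residues are multiples of \<open>n\<^sub>i (\<mu>x\<^sub>i - x\<^sub>i') / y\<^sub>i\<close>; since the genus is positive it decays at infinity
  fast enough that these residues sum to zero. As the \<open>P\<^sub>i\<close> are rational, the function \<open>\<phi>\<close>, which a
  priori has coefficients in the algebraic closure, may be replaced by one over the base field, by
  applying a linear functional to its coefficients.
\<close>

section \<open>Logarithmic derivatives and residues\<close>

text \<open>The places in the definition of the Jacobian are abstract valuations, and the proof
  never classifies them. It constructs just enough of them: a solution of the curve equation in
  Laurent series embeds the function field, and the order there, divided by its least positive
  value, is a place. Substituting x0 + t^2 or t^(-2) for x gives solutions over every x0 and over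
  infinity, branch points included; this turns a relation div phi into two polynomials A, B of
  bounded degree with prescribed vanishing. The rest is polynomial algebra: near each point y is
  replaced by a polynomial T with T^2 = g/d to high order. As T can be taken over the base field, it
  also carries the Galois invariance of the places and the descent of A and B. The shape of D
  balances two demands: F times a square for the first curve, and D x_i^m = D_0 A_i for the second.
  With x_i = F D_0 v_i^2 the second leaves no choice, and m odd yields the first.\<close>

locale poly_derivation =
  fixes \<Delta> :: "'a::field_char_0 poly \<Rightarrow> 'a poly"
  assumes add: "\<Delta> (p + q) = \<Delta> p + \<Delta> q"
    and mult: "\<Delta> (p * q) = \<Delta> p * q + p * \<Delta> q"
    and degree_le: "Polynomial.degree (\<Delta> p) \<le> Polynomial.degree p"
begin

lemma zero: "\<Delta> 0 = 0"
  using add[of 0 0] by simp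

lemma uminus: "\<Delta> (- p) = - \<Delta> p"
  using add[of p "- p"] zero by (simp add: add_eq_0_iff)

lemma diff: "\<Delta> (p - q) = \<Delta> p - \<Delta> q"
  using add[of p "- q"] uminus by simp

lemma one: "\<Delta> 1 = 0"
  using mult[of 1 1] by simp

lemma power_Suc: "\<Delta> (q ^ Suc n) = of_nat (Suc n) * q ^ n * \<Delta> q"
proof (induction n)
  case (Suc n)
  have "\<Delta> (q ^ Suc (Suc n)) = \<Delta> q * q ^ Suc n + q * \<Delta> (q ^ Suc n)"
    by (metis mult power_Suc)
  then show ?case unfolding Suc by (simp add: algebra_simps)
qed simp

end

section \<open>Divisibility by powers of linear factors\<close>

lemma linear_power_dvd_mult_cancel:
  fixes p q :: "'a::idom poly"
  assumes "[:-x, 1:] ^ n dvd p * q" "poly p x \<noteq> 0"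
  shows "[:-x, 1:] ^ n dvd q"
proof (cases "q = 0")
  case False
  with assms(2) have pq: "p * q \<noteq> 0" by auto
  have "order x (p * q) = order x q"
    using order_mult[OF pq] order_0I[OF assms(2)] by simp
  with assms(1) pq False show ?thesis
    by (metis order_divides)
qed simp

lemma prod_linear_power_dvd:
  fixes p :: "'a::idom poly"
  assumes "finite J" "inj_on x J" "\<And>j. j \<in> J \<Longrightarrow> [:- x j, 1:] ^ k j dvd p"
  shows "(\<Prod>j\<in>J. [:- x j, 1:] ^ k j) dvd p"
  using assms
proof (induction J rule: finite_induct)
  case (insert i J)
  then obtain r where r: "p = (\<Prod>j\<in>J. [:- x j, 1:] ^ k j) * r"
    by (auto simp: dvd_def)
  have "poly (\<Prod>j\<in>J. [:- x j, 1:] ^ k j) (x i) \<noteq> 0"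
    using insert.hyps insert.prems(1) by (auto simp: poly_prod inj_on_def)
  then have "[:- x i, 1:] ^ k i dvd r"
    using insert.prems(2)[of i] linear_power_dvd_mult_cancel unfolding r by blast
  then show ?case
    using insert.hyps by (simp add: r mult.commute mult_dvd_mono)
qed simp

lemma degree_prod_linear_power:
  "Polynomial.degree (\<Prod>j\<in>J. [:- x j, 1::'a::idom:] ^ k j) = (\<Sum>j\<in>J. k j)"
  by (subst degree_prod_eq_sum_degree) (auto simp: degree_power_eq)

lemma coeff_prod_linear:
  assumes "finite J"
  shows "Polynomial.coeff (\<Prod>j\<in>J. [:- x j, 1::'a::idom:]) (card J) = 1"
proof -
  have "Polynomial.degree (\<Prod>j\<in>J. [:- x j, 1::'a:]) = card J"
    using degree_prod_linear_power[of x "\<lambda>_. 1" J] by simp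
  moreover have "lead_coeff (\<Prod>j\<in>J. [:- x j, 1::'a:]) = 1"
    by (simp add: lead_coeff_prod)
  ultimately show ?thesis by simp
qed

text \<open>Let s be a square root of \<open>G\<close>, so that s' = \<kappa> s. The part of the
  logarithmic derivative of A + B s that changes sign with s is s (A \<Delta>B - B \<Delta>A +
  \<kappa> A B) / \<open>(A\<^sup>2 - G * B\<^sup>2)\<close>. If A + B s vanishes to order 2e at (x,
  y) and not at the conjugate point, its logarithmic derivative has principal part 2e \<Delta>q / q
  there, q = X - x, and the odd part receives half of it. The last equation is this residue with
  denominators cleared, which makes sense in the remaining cases too.\<close>

lemma (in poly_derivation) local_residue:
  fixes A B G T :: "'a poly"
  assumes G: "\<Delta> G = Polynomial.smult (2 * \<kappa>) G"
    and e: "e > 0" and y: "poly T x = y" "y \<noteq> 0"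
    and T: "[:-x, 1:] ^ (2 * e + 1) dvd T\<^sup>2 - G"
    and AB: "[:-x, 1:] ^ (2 * e) dvd A + B * T"
    and N: "A\<^sup>2 - G * B\<^sup>2 = [:-x, 1:] ^ (2 * e) * N"
  obtains W where "A * \<Delta> B - B * \<Delta> A + Polynomial.smult \<kappa> (A * B) = [:-x, 1:] ^ (2 * e - 1) * W"
    and "poly W x * y = of_nat e * poly (\<Delta> [:-x, 1:]) x * poly N x"
proof -
  define q where "q = [:-x, 1:]"
  have q0: "q \<noteq> 0" and qx: "poly q x = 0" by (simp_all add: q_def)
  obtain n where n: "2 * e = Suc n" using e by (cases "2 * e") auto
  have n1: "2 * e - 1 = n" "2 * e + 1 = Suc (Suc n)" using n by auto
  have ofn: "of_nat (Suc n) = (2 * of_nat e :: 'a poly)"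
    using arg_cong[OF n, of "of_nat :: nat \<Rightarrow> 'a poly"] by simp
  obtain C where C: "A + B * T = q ^ Suc n * C"
    using AB unfolding n q_def by (auto simp: dvd_def)
  obtain E where E: "T\<^sup>2 - G = q ^ Suc (Suc n) * E"
    using T unfolding n1 q_def by (auto simp: dvd_def)
  have A: "A = q ^ Suc n * C - B * T" using C by (simp add: algebra_simps)
  have G': "G = T\<^sup>2 - q ^ Suc (Suc n) * E" using E by (simp add: algebra_simps)
  have "q ^ Suc n * N = q ^ Suc n * (C * (A - B * T) + q * B\<^sup>2 * E)"
  proof -
    have "q ^ Suc n * N = A\<^sup>2 - G * B\<^sup>2" using N by (simp add: n q_def)
    also have "\<dots> = (A + B * T) * (A - B * T) + B\<^sup>2 * (T\<^sup>2 - G)"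
      by (simp add: algebra_simps power2_eq_square)
    also have "\<dots> = q ^ Suc n * (C * (A - B * T) + q * B\<^sup>2 * E)"
      unfolding C E by (simp add: algebra_simps)
    finally show ?thesis .
  qed
  then have N': "N = C * (A - B * T) + q * B\<^sup>2 * E" using q0 by simp
  have "poly A x = - poly B x * y"
    using arg_cong[OF A, of "\<lambda>p. poly p x"] y(1) qx by simp
  then have Nx: "poly N x = - 2 * poly C x * poly B x * y"
    by (simp add: N' qx y)
  \<comment> \<open>\<open>U\<close> measures how far \<open>T\<close> is from satisfying s' =
    \<kappa> s. Since \<Delta> costs one power of q, the order 2e + 1 demanded of \<open>T\<close>
    leaves order 2e for \<open>U\<close>, which is what \<open>W\<close> can absorb.\<close>
  define U where "U = \<Delta> T - Polynomial.smult \<kappa> T"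
  define Z where "Z = of_nat (Suc (Suc n)) * \<Delta> q * E + q * \<Delta> E + Polynomial.smult (2 * \<kappa>) (- (q * E))"
  have "2 * T * U = q ^ Suc n * Z"
  proof -
    have "2 * T * \<Delta> T = \<Delta> (T\<^sup>2)"
      by (simp add: power2_eq_square mult)
    also have "\<dots> = \<Delta> (G + q ^ Suc (Suc n) * E)"
      unfolding E[symmetric] by simp
    also have "\<dots> = Polynomial.smult (2 * \<kappa>) G
        + (of_nat (Suc (Suc n)) * q ^ Suc n * \<Delta> q * E + q ^ Suc (Suc n) * \<Delta> E)"
      by (simp only: add mult G power_Suc)
    finally have *: "2 * T * \<Delta> T = Polynomial.smult (2 * \<kappa>) G
        + (of_nat (Suc (Suc n)) * q ^ Suc n * \<Delta> q * E + q ^ Suc (Suc n) * \<Delta> E)" .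
    have "2 * T * U = 2 * T * \<Delta> T - Polynomial.smult (2 * \<kappa>) (T\<^sup>2)"
      unfolding U_def mult_2 smult_add_left by (simp add: algebra_simps power2_eq_square)
    also have "\<dots> = of_nat (Suc (Suc n)) * q ^ Suc n * \<Delta> q * E + q ^ Suc (Suc n) * \<Delta> E
        - Polynomial.smult (2 * \<kappa>) (T\<^sup>2 - G)"
      unfolding * smult_diff_right by (simp only: algebra_simps)
    also have "\<dots> = q ^ Suc n * Z"
      unfolding E Z_def by (simp add: algebra_simps)
    finally show ?thesis .
  qed
  then have "[:-x, 1:] ^ Suc n dvd (2 * T) * U" unfolding q_def by (metis dvd_triv_left)
  moreover have "poly (2 * T) x \<noteq> 0" using y by simp
  ultimately obtain U' where U': "U = q ^ Suc n * U'"
    unfolding q_def using linear_power_dvd_mult_cancel by (blast elim: dvdE)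
  define W where "W = q * (C * \<Delta> B - B * \<Delta> C + Polynomial.smult \<kappa> (C * B) + B\<^sup>2 * U') - 2 * of_nat e * \<Delta> q * B * C"
  show ?thesis
  proof
    have dA: "\<Delta> A = 2 * of_nat e * q ^ n * \<Delta> q * C + q ^ Suc n * \<Delta> C - (\<Delta> B * T + B * \<Delta> T)"
      by (simp only: A diff mult power_Suc ofn)
    have "A * \<Delta> B - B * \<Delta> A + Polynomial.smult \<kappa> (A * B) =
       q ^ Suc n * (C * \<Delta> B - B * \<Delta> C + Polynomial.smult \<kappa> (C * B)) + B\<^sup>2 * U - 2 * of_nat e * q ^ n * \<Delta> q * B * C"
      unfolding U_def dA
      by (subst (1 2) A) (simp add: algebra_simps power2_eq_square smult_diff_right)
    also have "\<dots> = q ^ n * W"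
      unfolding U' W_def by (simp add: algebra_simps)
    finally show "A * \<Delta> B - B * \<Delta> A + Polynomial.smult \<kappa> (A * B) = [:-x, 1:] ^ (2 * e - 1) * W"
      by (simp only: n1 q_def)
    have "poly W x = - 2 * of_nat e * poly (\<Delta> q) x * poly B x * poly C x"
      by (simp add: W_def qx)
    then show "poly W x * y = of_nat e * poly (\<Delta> [:-x, 1:]) x * poly N x"
      by (simp add: Nx q_def)
  qed
qed

text \<open>The norm of A + B s has degree at most twice the sum of the \<open>e j\<close> and is
  divisible by all (X - x_j)^(2 e_j), so it is a constant times their product. The odd part of the
  logarithmic derivative is then s times a proper fraction with simple poles, and the sum of its
  residues is its coefficient of 1/X at infinity.\<close>

lemma (in poly_derivation) sum_residues_eq_0:
  fixes A B G :: "'a poly" and x y :: "'i \<Rightarrow> 'a"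
  assumes G: "\<Delta> G = Polynomial.smult (2 * \<kappa>) G" and degG: "Polynomial.degree G \<ge> 3"
    and nonsq: "\<And>A B. A\<^sup>2 = G * B\<^sup>2 \<Longrightarrow> B = 0"
    and J: "finite J" "inj_on x J" and e: "\<And>j. j \<in> J \<Longrightarrow> e j > 0"
    and y: "\<And>j. j \<in> J \<Longrightarrow> y j \<noteq> 0"
    and AB0: "A \<noteq> 0 \<or> B \<noteq> 0"
    and degA: "Polynomial.degree A \<le> (\<Sum>j\<in>J. e j)"
    and degB: "B \<noteq> 0 \<Longrightarrow> 2 * Polynomial.degree B + Polynomial.degree G \<le> 2 * (\<Sum>j\<in>J. e j)"
    and T: "\<And>j. j \<in> J \<Longrightarrow> poly (T j) (x j) = y j"
      "\<And>j. j \<in> J \<Longrightarrow> [:- x j, 1:] ^ (2 * e j + 1) dvd (T j)\<^sup>2 - G"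
      "\<And>j. j \<in> J \<Longrightarrow> [:- x j, 1:] ^ (2 * e j) dvd A + B * T j"
  shows "(\<Sum>j\<in>J. of_nat (e j) * poly (\<Delta> [:- x j, 1:]) (x j) / y j) = 0"
proof (cases "J = {}")
  case False
  define M where "M = (\<Sum>j\<in>J. e j)"
  define N where "N = A\<^sup>2 - G * B\<^sup>2"
  define q where "q = (\<lambda>j. [:- x j, 1:])"
  define W where "W = A * \<Delta> B - B * \<Delta> A + Polynomial.smult \<kappa> (A * B)"
  have N0: "N \<noteq> 0"
  proof
    assume "N = 0"
    then have "A\<^sup>2 = G * B\<^sup>2" by (simp add: N_def)
    with nonsq have "B = 0" by blast
    with \<open>A\<^sup>2 = G * B\<^sup>2\<close> have "A = 0" by simp
    with \<open>B = 0\<close> AB0 show False by simp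
  qed
  have "Polynomial.degree (A\<^sup>2) \<le> 2 * M"
    using degA by (simp add: degree_power_eq M_def degree_power_le order_trans[OF degree_power_le])
  moreover have "Polynomial.degree (G * B\<^sup>2) \<le> 2 * M"
  proof (cases "B = 0")
    case B: False
    have "Polynomial.degree (G * B\<^sup>2) \<le> Polynomial.degree G + Polynomial.degree (B\<^sup>2)"
      by (rule degree_mult_le)
    also have "\<dots> \<le> Polynomial.degree G + 2 * Polynomial.degree B"
      using degree_power_le[of B 2] by (simp add: mult.commute)
    finally show ?thesis using degB[OF B] by (simp add: M_def)
  qed simp
  ultimately have degN: "Polynomial.degree N \<le> 2 * M"
    unfolding N_def by (rule degree_diff_le)
  have "(\<Prod>j\<in>J. q j ^ (2 * e j)) dvd N"
    unfolding q_def
  proof (rule prod_linear_power_dvd[OF J])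
    fix j assume j: "j \<in> J"
    have "N = (A + B * T j) * (A - B * T j) + B\<^sup>2 * ((T j)\<^sup>2 - G)"
      by (simp add: N_def algebra_simps power2_eq_square)
    moreover have "[:- x j, 1:] ^ (2 * e j) dvd (T j)\<^sup>2 - G"
      using T(2)[OF j] by (rule power_le_dvd) simp
    ultimately show "[:- x j, 1:] ^ (2 * e j) dvd N"
      using T(3)[OF j] by (metis dvd_add dvd_mult dvd_mult2)
  qed
  then obtain c where c: "N = (\<Prod>j\<in>J. q j ^ (2 * e j)) * c" by (auto simp: dvd_def)
  have degq: "Polynomial.degree (\<Prod>j\<in>J. q j ^ (2 * e j)) = 2 * M"
    unfolding q_def degree_prod_linear_power by (simp add: M_def sum_distrib_left)
  have c0: "c \<noteq> 0" "(\<Prod>j\<in>J. q j ^ (2 * e j)) \<noteq> 0" using N0 c by auto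
  have "Polynomial.degree N = 2 * M + Polynomial.degree c"
    unfolding c using c0 degq by (simp add: degree_mult_eq)
  then have "Polynomial.degree c = 0" using degN by simp
  then obtain c' where c': "c = [:c':]" by (auto elim: degree_eq_zeroE)
  with c0 have c'0: "c' \<noteq> 0" by simp
  define Nj where "Nj = (\<lambda>j. (\<Prod>i\<in>J - {j}. q i ^ (2 * e i)) * c)"
  have Nj: "N = q j ^ (2 * e j) * Nj j" if "j \<in> J" for j
    unfolding Nj_def c using J that by (simp add: prod.remove mult.assoc)
  have "\<exists>Wj. \<forall>j\<in>J. W = q j ^ (2 * e j - 1) * Wj j \<and>
      poly (Wj j) (x j) * y j = of_nat (e j) * poly (\<Delta> (q j)) (x j) * poly (Nj j) (x j)"
  proof (rule bchoice, rule ballI)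
    fix j assume j: "j \<in> J"
    from local_residue[OF G e[OF j] T(1)[OF j] y[OF j] T(2)[OF j] T(3)[OF j] Nj[OF j, unfolded N_def q_def]]
    show "\<exists>Wj. W = q j ^ (2 * e j - 1) * Wj \<and>
      poly Wj (x j) * y j = of_nat (e j) * poly (\<Delta> (q j)) (x j) * poly (Nj j) (x j)"
      unfolding W_def q_def by blast
  qed
  then obtain Wj where Wj: "\<And>j. j \<in> J \<Longrightarrow> W = q j ^ (2 * e j - 1) * Wj j"
    and Wx: "\<And>j. j \<in> J \<Longrightarrow> poly (Wj j) (x j) * y j = of_nat (e j) * poly (\<Delta> (q j)) (x j) * poly (Nj j) (x j)"
    by blast
  have "(\<Prod>j\<in>J. q j ^ (2 * e j - 1)) dvd W"
    unfolding q_def by (rule prod_linear_power_dvd[OF J]) (metis Wj q_def dvd_triv_left)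
  then obtain V where V: "W = (\<Prod>j\<in>J. q j ^ (2 * e j - 1)) * V" by (auto simp: dvd_def)
  define r where "r = (\<lambda>j. of_nat (e j) * poly (\<Delta> (q j)) (x j) / y j)"
  have Vx: "poly V (x j) = c' * r j * poly (\<Prod>i\<in>J - {j}. q i) (x j)" if j: "j \<in> J" for j
  proof -
    define R where "R = (\<Prod>i\<in>J - {j}. q i ^ (2 * e i - 1))"
    have R0: "poly R (x j) \<noteq> 0"
      using j J by (auto simp: R_def q_def poly_prod inj_on_def)
    have "W = q j ^ (2 * e j - 1) * (R * V)"
      unfolding V R_def using J j by (simp add: prod.remove mult.assoc)
    then have "q j ^ (2 * e j - 1) * Wj j = q j ^ (2 * e j - 1) * (R * V)"
      using Wj[OF j] by simp
    then have W2: "Wj j = R * V" by (simp add: q_def)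
    have "(\<Prod>i\<in>J - {j}. q i ^ (2 * e i)) = R * (\<Prod>i\<in>J - {j}. q i)"
      unfolding R_def prod.distrib[symmetric]
    proof (rule prod.cong)
      fix i assume "i \<in> J - {j}"
      then have "2 * e i = Suc (2 * e i - 1)" using e[of i] by simp
      then show "q i ^ (2 * e i) = q i ^ (2 * e i - 1) * q i" by (metis power_Suc2)
    qed simp
    then have "Nj j = R * (\<Prod>i\<in>J - {j}. q i) * [:c':]"
      by (simp add: Nj_def c')
    with Wx[OF j] W2 have "poly R (x j) * (poly V (x j) * y j) =
       poly R (x j) * (of_nat (e j) * poly (\<Delta> (q j)) (x j) * poly (\<Prod>i\<in>J - {j}. q i) (x j) * c')"
      by (simp add: algebra_simps)
    then have "poly V (x j) * y j = of_nat (e j) * poly (\<Delta> (q j)) (x j) * poly (\<Prod>i\<in>J - {j}. q i) (x j) * c'"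
      using R0 by simp
    then show ?thesis using y[OF j] by (simp add: r_def field_simps)
  qed
  have card: "card J > 0" using False J by (simp add: card_gt_0_iff)
  have degV: "Polynomial.degree V < card J - 1" if V0: "V \<noteq> 0"
  proof -
    have W0: "W \<noteq> 0" using V0 V by (auto simp: q_def J)
    have AB: "A \<noteq> 0" "B \<noteq> 0" using W0 by (auto simp: W_def zero)
    let ?d = "Polynomial.degree A + Polynomial.degree B"
    have "Polynomial.degree (A * \<Delta> B) \<le> ?d" "Polynomial.degree (B * \<Delta> A) \<le> ?d"
      using degree_mult_le[of A "\<Delta> B"] degree_mult_le[of B "\<Delta> A"] degree_le[of A] degree_le[of B]
      by linarith+
    moreover have "Polynomial.degree (Polynomial.smult \<kappa> (A * B)) \<le> ?d"
      by (rule order_trans[OF degree_smult_le degree_mult_le])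
    ultimately have "Polynomial.degree W \<le> ?d"
      unfolding W_def by (intro degree_add_le degree_diff_le)
    \<comment> \<open>This is where positive genus enters. As \<open>4 * M - 3\<close> is odd, the
      degree of \<open>W\<close> is at most \<open>2 * M - 2\<close>; for \<open>G\<close> of degree
      2 only \<open>2 * M - 1\<close> would follow, and a residue at infinity could survive.\<close>
    also have "2 * ?d \<le> 4 * M - 3"
      using degA degB[OF AB(2)] degG by (simp add: M_def)
    finally have dW: "Polynomial.degree W + 2 \<le> 2 * M"
      using degB[OF AB(2)] degG by (simp add: M_def)
    have "Polynomial.degree W = (\<Sum>j\<in>J. 2 * e j - 1) + Polynomial.degree V"
      unfolding V using V0 by (subst degree_mult_eq) (auto simp: q_def J degree_prod_linear_power)
    moreover have "(\<Sum>j\<in>J. 2 * e j - 1) + card J = 2 * M"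
    proof -
      have "(\<Sum>j\<in>J. 2 * e j - 1) + card J = (\<Sum>j\<in>J. 2 * e j - 1 + 1)"
        by (subst sum.distrib) simp
      also have "\<dots> = (\<Sum>j\<in>J. 2 * e j)" by (rule sum.cong) (use e in force)+
      finally show ?thesis by (simp add: M_def sum_distrib_left)
    qed
    ultimately show ?thesis using dW card by linarith
  qed
  \<comment> \<open>Partial fractions by Lagrange interpolation: \<open>V\<close> and
    \<open>V'\<close> agree at the \<open>card J\<close> nodes and have smaller degree. The basis
    products are monic of degree \<open>card J - 1\<close>, so that coefficient of \<open>V'\<close>
    is the sum of the residues up to the factor \<open>c'\<close>.\<close>
  define V' where "V' = (\<Sum>j\<in>J. Polynomial.smult (c' * r j) (\<Prod>i\<in>J - {j}. q i))"
  have degq': "Polynomial.degree (\<Prod>i\<in>J - {j}. q i) = card J - 1" if "j \<in> J" for j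
    using degree_prod_linear_power[of x "\<lambda>_. 1" "J - {j}"] J that by (simp add: q_def)
  have coq': "Polynomial.coeff (\<Prod>i\<in>J - {j}. q i) (card J - 1) = 1" if "j \<in> J" for j
    using coeff_prod_linear[of "J - {j}" x] J that by (simp add: q_def)
  have "V = V'"
  proof (rule ccontr)
    assume ne: "V \<noteq> V'"
    have "poly (V - V') (x j) = 0" if j: "j \<in> J" for j
    proof -
      have "poly V' (x j) = (\<Sum>k\<in>J. c' * r k * poly (\<Prod>i\<in>J - {k}. q i) (x j))"
        by (simp add: V'_def poly_sum)
      also have "\<dots> = (\<Sum>k\<in>{j}. c' * r k * poly (\<Prod>i\<in>J - {k}. q i) (x j))"
        using J j by (intro sum.mono_neutral_right) (auto simp: poly_prod q_def)
      finally show ?thesis using Vx[OF j] by simp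
    qed
    then have "x ` J \<subseteq> {z. poly (V - V') z = 0}" by auto
    then have "card (x ` J) \<le> Polynomial.degree (V - V')"
      using ne by (intro order_trans[OF card_mono card_poly_roots_bound] poly_roots_finite) auto
    then have "card J \<le> Polynomial.degree (V - V')" using J by (simp add: card_image)
    moreover have "Polynomial.degree V' \<le> card J - 1"
      unfolding V'_def using J degq'
      by (intro degree_sum_le) (auto intro: order_trans[OF degree_smult_le])
    moreover have "Polynomial.degree V \<le> card J - 1"
      using degV by (cases "V = 0") auto
    ultimately have "card J \<le> card J - 1"
      by (meson degree_diff_le order_trans)
    then show False using card by simp
  qed
  moreover have "Polynomial.coeff V (card J - 1) = 0"
    using degV by (cases "V = 0") (auto intro: coeff_eq_0)
  moreover have "Polynomial.coeff V' (card J - 1) = c' * (\<Sum>j\<in>J. r j)"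
    unfolding V'_def using coq' by (simp add: coeff_sum sum_distrib_left)
  ultimately show ?thesis using c'0 by (simp add: r_def q_def)
qed simp

section \<open>Descent and evaluation at Laurent series\<close>

text \<open>One statement for two kinds of map: ring homomorphisms (h the identity, k = l) and
  linear functionals from the algebraic closure to the base field (h = \<open>to_ac\<close>, k the
  identity), which are not multiplicative.\<close>

lemma map_poly_semilinear_mult:
  fixes l :: "'b::comm_ring_1 \<Rightarrow> 'c::comm_ring_1" and h :: "'a::zero \<Rightarrow> 'b" and k :: "'a \<Rightarrow> 'c"
  assumes add: "\<And>a b. l (a + b) = l a + l b"
    and mult: "\<And>c a. l (h c * a) = k c * l a"
    and [simp]: "h 0 = 0" "k 0 = 0"
  shows "map_poly l (map_poly h p * q) = map_poly k p * map_poly l q"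
proof (rule poly_eqI)
  fix n
  have [simp]: "l 0 = 0" using add[of 0 0] by simp
  have "l (\<Sum>i\<le>n. h (Polynomial.coeff p i) * Polynomial.coeff q (n - i)) =
        (\<Sum>i\<le>n. l (h (Polynomial.coeff p i) * Polynomial.coeff q (n - i)))"
    by (subst sum_comp_morphism[of l, symmetric]) (auto simp: add o_def)
  then show "Polynomial.coeff (map_poly l (map_poly h p * q)) n =
      Polynomial.coeff (map_poly k p * map_poly l q) n"
    by (simp add: coeff_map_poly coeff_mult mult)
qed

lemma map_poly_add_hom:
  assumes "\<And>a b. l (a + b) = l a + l b" "l 0 = 0"
  shows "map_poly l (p + q) = map_poly l p + map_poly l q"
  by (rule poly_eqI) (simp add: coeff_map_poly assms)

lemma map_poly_mult_hom:
  fixes h :: "'a::comm_ring_1 \<Rightarrow> 'b::comm_ring_1"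
  assumes "\<And>a b. h (a + b) = h a + h b" "\<And>a b. h (a * b) = h a * h b" "h 0 = 0"
  shows "map_poly h (p * q) = map_poly h p * map_poly h q"
  using map_poly_semilinear_mult[of h id h p q] assms by (simp add: map_poly_id)

section \<open>Base change of polynomials to the algebraic closure\<close>

abbreviation ac_poly :: "'k::field poly \<Rightarrow> 'k alg_closure poly" where
  "ac_poly \<equiv> map_poly to_ac"

lemma ac_poly_add [simp]: "ac_poly (p + q) = ac_poly p + ac_poly q"
  by (rule map_poly_add_hom) auto

lemma ac_poly_mult [simp]: "ac_poly (p * q) = ac_poly p * ac_poly q"
  by (rule map_poly_mult_hom) auto

lemma ac_poly_diff [simp]: "ac_poly (p - q) = ac_poly p - ac_poly q"
  by (rule poly_eqI) (simp add: coeff_map_poly)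

lemma ac_poly_1 [simp]: "ac_poly 1 = 1"
  by simp

lemma ac_poly_power [simp]: "ac_poly (p ^ n) = ac_poly p ^ n"
  by (induction n) auto

lemma ac_poly_linear [simp]: "ac_poly [:- x, 1:] = [:- to_ac x, 1:]"
  by (simp add: map_poly_pCons)

lemma poly_ac_poly [simp]: "poly (ac_poly p) (to_ac x) = to_ac (poly p x)"
  by (induction p) (auto simp: map_poly_pCons)

lemma degree_ac_poly [simp]: "Polynomial.degree (ac_poly p) = Polynomial.degree p"
  by (rule degree_map_poly) auto

lemma ac_poly_eq_0_iff [simp]: "ac_poly p = 0 \<longleftrightarrow> p = 0"
  by (auto simp: poly_eq_iff coeff_map_poly)

lemma exists_linear_functional:
  fixes z :: "'k::field alg_closure"
  assumes "z \<noteq> 0"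
  obtains l :: "'k alg_closure \<Rightarrow> 'k"
  where "\<And>a b. l (a + b) = l a + l b" "\<And>c a. l (to_ac c * a) = c * l a" "l z = 1"
proof -
  interpret vector_space_pair "\<lambda>c (a :: 'k alg_closure). to_ac c * a" "(*) :: 'k \<Rightarrow> 'k \<Rightarrow> 'k"
    by unfold_locales (auto simp: algebra_simps)
  have "vs1.independent {z}" using assms by simp
  from linear_independent_extend[OF this, of "\<lambda>_. 1"]
  obtain l where l: "Vector_Spaces.linear (\<lambda>c (a :: 'k alg_closure). to_ac c * a) (*) l" "l z = 1"
    by auto
  interpret l: Vector_Spaces.linear "\<lambda>c (a :: 'k alg_closure). to_ac c * a" "(*)" l by fact
  show ?thesis using that[of l] l.add l.scale l(2) by blast
qed

text \<open>With \<open>Q j\<close> and \<open>T j\<close> over the base field, the divisibilities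
  are linear conditions over that field on the coefficients of \<open>A\<close>, \<open>B\<close>
  and the quotients. A linear functional applied coefficientwise preserves them and cannot raise
  degrees. It is made to take the value 1 on some nonzero coefficient, so that the images do not
  both vanish.\<close>

lemma descent:
  fixes A B :: "'k::field alg_closure poly"
  assumes AB: "A \<noteq> 0 \<or> B \<noteq> 0"
    and dvd: "\<And>j. j \<in> J \<Longrightarrow> ac_poly (Q j) dvd A + B * ac_poly (T j)"
  obtains A' B' :: "'k poly" where "A' \<noteq> 0 \<or> B' \<noteq> 0"
    "Polynomial.degree A' \<le> Polynomial.degree A"
    "B' \<noteq> 0 \<Longrightarrow> B \<noteq> 0" "Polynomial.degree B' \<le> Polynomial.degree B"
    "\<And>j. j \<in> J \<Longrightarrow> Q j dvd A' + B' * T j"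
proof -
  obtain n where n: "Polynomial.coeff A n \<noteq> 0 \<or> Polynomial.coeff B n \<noteq> 0"
    using AB by (auto simp: poly_eq_iff)
  define z where "z = (if Polynomial.coeff A n \<noteq> 0 then Polynomial.coeff A n else Polynomial.coeff B n)"
  have "z \<noteq> 0" using n by (auto simp: z_def)
  then obtain l :: "'k alg_closure \<Rightarrow> 'k" where l: "\<And>a b. l (a + b) = l a + l b"
     "\<And>c a. l (to_ac c * a) = c * l a" "l z = 1" by (rule exists_linear_functional) blast
  have l0 [simp]: "l 0 = 0" using l(2)[of 0 0] by simp
  have lm: "map_poly l (ac_poly p * q) = p * map_poly l q" for p q
    using map_poly_semilinear_mult[of l to_ac id p q] l by (simp add: map_poly_id)
  show ?thesis
  proof
    have "Polynomial.coeff (map_poly l A) n \<noteq> 0 \<or> Polynomial.coeff (map_poly l B) n \<noteq> 0"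
      using l(3) by (auto simp: coeff_map_poly z_def split: if_splits)
    then show "map_poly l A \<noteq> 0 \<or> map_poly l B \<noteq> 0" by auto
    show "Polynomial.degree (map_poly l A) \<le> Polynomial.degree A"
      "Polynomial.degree (map_poly l B) \<le> Polynomial.degree B" by (intro degree_le; simp add: coeff_map_poly coeff_eq_0)+
    show "map_poly l B \<noteq> 0 \<Longrightarrow> B \<noteq> 0" by auto
    fix j assume "j \<in> J"
    then obtain C where C: "A + ac_poly (T j) * B = ac_poly (Q j) * C"
      using dvd by (metis dvdE mult.commute)
    have "map_poly l A + T j * map_poly l B = Q j * map_poly l C"
      unfolding lm[symmetric] C[symmetric] by (rule map_poly_add_hom[symmetric]) (auto simp: l)
    then show "Q j dvd map_poly l A + map_poly l B * T j"
      by (metis dvd_triv_left mult.commute)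
  qed
qed

section \<open>Square roots modulo powers of X - x and in Laurent series\<close>

lemma Hensel_sqrt:
  fixes G :: "'a::field_char_0 poly"
  assumes "y\<^sup>2 = poly G x" "y \<noteq> 0"
  obtains T where "poly T x = y" "[:-x, 1:] ^ n dvd T\<^sup>2 - G"
proof -
  have "\<exists>T. poly T x = y \<and> [:-x, 1:] ^ Suc n dvd T\<^sup>2 - G"
  proof (induction n)
    case 0
    show ?case
      by (rule exI[of _ "[:y:]"]) (use assms in \<open>auto simp: poly_eq_0_iff_dvd[symmetric]\<close>)
  next
    case (Suc n)
    define q where "q = [:-x, 1:]"
    from Suc obtain T E where T: "poly T x = y" and E: "T\<^sup>2 - G = q ^ Suc n * E"
      by (auto simp: dvd_def q_def)
    \<comment> \<open>Newton step: at x the new cofactor takes the value E(x) + 2 y c, and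
      \<open>c\<close> is the root of this linear equation.\<close>
    define c where "c = - poly E x / (2 * y)"
    have "(T + [:c:] * q ^ Suc n)\<^sup>2 - G = q ^ Suc n * (E + 2 * T * [:c:] + [:c:]\<^sup>2 * q ^ Suc n)"
    proof -
      have "(T + [:c:] * q ^ Suc n)\<^sup>2 - G = (T\<^sup>2 - G) + q ^ Suc n * (2 * T * [:c:] + [:c:]\<^sup>2 * q ^ Suc n)"
        by (simp only: power2_eq_square algebra_simps) (simp add: algebra_simps)
      then show ?thesis unfolding E by (simp only: algebra_simps)
    qed
    moreover have "poly (E + 2 * T * [:c:] + [:c:]\<^sup>2 * q ^ Suc n) x = 0"
      using assms(2) by (simp add: T c_def q_def)
    then have "q dvd E + 2 * T * [:c:] + [:c:]\<^sup>2 * q ^ Suc n"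
      unfolding q_def by (simp only: poly_eq_0_iff_dvd)
    ultimately have "q ^ Suc n * q dvd (T + [:c:] * q ^ Suc n)\<^sup>2 - G"
      by (metis dvd_refl mult_dvd_mono)
    then have "[:-x, 1:] ^ Suc (Suc n) dvd (T + [:c:] * q ^ Suc n)\<^sup>2 - G"
      by (simp add: q_def mult_ac)
    moreover have "poly (T + [:c:] * q ^ Suc n) x = y"
      by (simp add: T q_def)
    ultimately show ?case by blast
  qed
  then obtain T where "poly T x = y" "[:-x, 1:] ^ Suc n dvd T\<^sup>2 - G" by blast
  moreover from this(2) have "[:-x, 1:] ^ n dvd T\<^sup>2 - G" by (rule power_le_dvd) simp
  ultimately show ?thesis using that by blast
qed

lemma fls_sqrt_exists:
  fixes h :: "'a::{alg_closed_field, field_char_0} fls"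
  assumes "h \<noteq> 0" "even (fls_subdegree h)"
  obtains S where "S\<^sup>2 = h"
proof -
  define u where "u = fls_base_factor_to_fps h"
  have u0: "fps_nth u 0 \<noteq> 0" using assms(1) by (simp add: u_def)
  obtain r where r: "r\<^sup>2 = fps_nth u 0"
    using nth_root_exists[of 2 "fps_nth u 0"] by auto
  have "fps_radical (\<lambda>_ _. r) (Suc 1) u ^ Suc 1 = u"
    using power_radical[OF u0, of "\<lambda>_ _. r" 1] r by (simp add: power2_eq_square)
  then obtain s where s: "s\<^sup>2 = u" by (metis Suc_1)
  obtain k where k: "fls_subdegree h = k + k" using assms(2) by (auto elim!: evenE)
  have "(fls_shift (- k) (fps_to_fls s))\<^sup>2 = fls_shift (- (k + k)) (fps_to_fls (s * s))"
    by (simp add: power2_eq_square fls_times_both_shifted_simp fls_times_fps_to_fls)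
  also have "\<dots> = h"
    using fls_conv_base_factor_to_fps_shift_subdegree[of h] s
    by (simp add: k u_def power2_eq_square)
  finally show ?thesis using that by blast
qed

lemma fls_sqrt_exists_const:
  fixes h :: "'a::field_char_0 fls"
  assumes "fls_subdegree h \<ge> 0" "fls_nth h 0 = y\<^sup>2" "y \<noteq> 0"
  obtains S where "S\<^sup>2 = h" "fls_nth S 0 = y" "fls_subdegree S \<ge> 0"
proof -
  define u where "u = fls_regpart h"
  have h: "h = fps_to_fls u" using assms(1) by (simp add: u_def)
  have u0: "fps_nth u 0 \<noteq> 0" "fps_nth u 0 = y\<^sup>2" using assms by (simp_all add: u_def)
  define s where "s = fps_radical (\<lambda>_ _. y) (Suc 1) u"
  have "s ^ Suc 1 = u"
    using power_radical[OF u0(1), of "\<lambda>_ _. y" 1] u0 by (simp add: power2_eq_square s_def)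
  then have "(fps_to_fls s)\<^sup>2 = h"
    by (simp add: h power2_eq_square fls_times_fps_to_fls[symmetric])
  moreover have "fls_nth (fps_to_fls s) 0 = y" by (simp add: s_def)
  moreover have "fls_subdegree (fps_to_fls s) \<ge> 0" by (simp add: fls_subdegree_fls_to_fps)
  ultimately show ?thesis using that by blast
qed

section \<open>Substitution of a Laurent series for x\<close>

definition peval :: "'a::field fls \<Rightarrow> 'a poly \<Rightarrow> 'a fls" where
  "peval \<xi> p = poly (map_poly fls_const p) \<xi>"

lemma fls_const_add_hom: "fls_const (a + b :: 'a::comm_ring_1) = fls_const a + fls_const b"
  by (rule fls_eqI) simp

lemma peval_add [simp]: "peval \<xi> (p + q) = peval \<xi> p + peval \<xi> q"
  unfolding peval_def by (subst map_poly_add_hom) (auto simp: fls_const_add_hom)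

lemma peval_mult [simp]: "peval \<xi> (p * q) = peval \<xi> p * peval \<xi> q"
  unfolding peval_def by (subst map_poly_mult_hom) (auto simp: fls_const_add_hom)

lemma peval_0 [simp]: "peval \<xi> 0 = 0"
  by (simp add: peval_def)

lemma peval_const [simp]: "peval \<xi> [:c:] = fls_const c"
  by (simp add: peval_def map_poly_pCons)

lemma peval_1 [simp]: "peval \<xi> 1 = 1"
  using peval_const[of \<xi> 1] by (simp only: fls_const_1 one_pCons[symmetric])

lemma peval_pCons: "peval \<xi> (pCons a p) = fls_const a + \<xi> * peval \<xi> p"
  by (simp add: peval_def map_poly_pCons)

lemma peval_uminus [simp]: "peval \<xi> (- p) = - peval \<xi> p"
  using peval_add[of \<xi> p "- p"] by (simp add: add_eq_0_iff)

lemma peval_diff [simp]: "peval \<xi> (p - q) = peval \<xi> p - peval \<xi> q"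
  using peval_add[of \<xi> p "- q"] by simp

lemma peval_power [simp]: "peval \<xi> (p ^ n) = peval \<xi> p ^ n"
  by (induction n) auto

lemma fls_subdegree_nonneg_add:
  "fls_subdegree a \<ge> 0 \<Longrightarrow> fls_subdegree b \<ge> 0 \<Longrightarrow> fls_subdegree (a + b) \<ge> 0"
  by (cases "a + b = 0") (use fls_plus_subdegree[of a b] in auto)

lemma fls_subdegree_nonneg_mult:
  "fls_subdegree a \<ge> 0 \<Longrightarrow> fls_subdegree b \<ge> 0 \<Longrightarrow> fls_subdegree (a * b :: 'a::field fls) \<ge> 0"
  by (cases "a = 0 \<or> b = 0") auto

lemma fls_subdegree_ge_add:
  assumes "fls_subdegree a \<ge> n" "fls_subdegree b \<ge> n" "a + b \<noteq> 0"
  shows "fls_subdegree (a + b) \<ge> n"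
  using assms fls_plus_subdegree[of a b] by linarith

lemma fls_subdegree_2_mult: "fls_subdegree (2 * z :: 'a::field_char_0 fls) = fls_subdegree z"
  by (cases "z = 0") auto

lemma peval_subdegree_nonneg:
  "fls_subdegree \<xi> \<ge> 0 \<Longrightarrow> fls_subdegree (peval \<xi> p) \<ge> 0"
  by (induction p) (auto simp: peval_pCons intro!: fls_subdegree_nonneg_add fls_subdegree_nonneg_mult)

text \<open>After splitting off the power of X - x0, the cofactor keeps a nonzero constant term
  under the substitution. The case k = 1 serves the points with y nonzero, where x - x0 is a local
  parameter; k = 2 makes all orders even, so that g acquires a square root over branch points as
  well.\<close>

lemma peval_subdegree_finite:
  fixes t :: "'a::field fls"
  assumes k: "fls_subdegree t = int k" "k > 0" and p: "p \<noteq> 0"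
  shows "peval (fls_const x0 + t) p \<noteq> 0 \<and>
    fls_subdegree (peval (fls_const x0 + t) p) = int (k * order x0 p)"
proof -
  let ?\<xi> = "fls_const x0 + t"
  have t0: "t \<noteq> 0" using k by auto
  have \<xi>: "fls_subdegree ?\<xi> \<ge> 0" using k by (intro fls_subdegree_nonneg_add) auto
  have lin: "peval ?\<xi> [:- x0, 1:] = t" by (simp add: peval_pCons)
  obtain q where q: "p = [:- x0, 1:] ^ order x0 p * q" "\<not> [:- x0, 1:] dvd q"
    using order_decomp[OF p] by blast
  define c where "c = poly q x0"
  have c0: "c \<noteq> 0" using q(2) by (simp add: c_def poly_eq_0_iff_dvd)
  have "poly (q - [:c:]) x0 = 0" by (simp add: c_def)
  then obtain r where "q - [:c:] = [:- x0, 1:] * r"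
    unfolding poly_eq_0_iff_dvd by (elim dvdE)
  then have "q = [:c:] + [:- x0, 1:] * r" by (simp add: algebra_simps)
  then have "peval ?\<xi> q = peval ?\<xi> ([:c:] + [:- x0, 1:] * r)" by (rule arg_cong)
  then have pq: "peval ?\<xi> q = fls_const c + t * peval ?\<xi> r"
    by (simp only: peval_add peval_mult lin peval_const)
  have "peval ?\<xi> q \<noteq> 0 \<and> fls_subdegree (peval ?\<xi> q) = 0"
  proof (cases "peval ?\<xi> r = 0")
    case False
    then have "fls_subdegree (t * peval ?\<xi> r) > 0"
      using t0 k peval_subdegree_nonneg[OF \<xi>, of r] by simp
    then have "fls_subdegree (peval ?\<xi> q) = 0" "fls_nth (peval ?\<xi> q) 0 \<noteq> 0"
      using fls_subdegree_add_eq1[of "fls_const c" "t * peval ?\<xi> r"] c0 unfolding pq by auto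
    then show ?thesis by auto
  qed (use pq c0 in auto)
  moreover have "peval ?\<xi> p = t ^ order x0 p * peval ?\<xi> q"
    by (subst q(1)) (simp only: peval_mult peval_power lin)
  ultimately show ?thesis using t0 k by (simp add: fls_subdegree_pow)
qed

lemma peval_subdegree_infinity:
  fixes \<xi> :: "'a::field fls"
  assumes k: "fls_subdegree \<xi> = - int k" "k > 0" and p: "p \<noteq> 0"
  shows "peval \<xi> p \<noteq> 0 \<and> fls_subdegree (peval \<xi> p) = - int (k * Polynomial.degree p)"
  using p
proof (induction p)
  case (pCons a p)
  have X0: "\<xi> \<noteq> 0" using k by auto
  show ?case
  proof (cases "p = 0")
    case False
    with pCons have IH: "peval \<xi> p \<noteq> 0" "fls_subdegree (peval \<xi> p) = - int (k * Polynomial.degree p)" by auto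
    then have s: "fls_subdegree (\<xi> * peval \<xi> p) = - int (k * Suc (Polynomial.degree p))"
      using X0 k by (simp add: algebra_simps)
    have "fls_subdegree (\<xi> * peval \<xi> p + fls_const a) = fls_subdegree (\<xi> * peval \<xi> p)"
    proof (rule fls_subdegree_add_eq1)
      show "fls_subdegree (\<xi> * peval \<xi> p) < fls_subdegree (fls_const a)"
        unfolding s using k(2) by (simp del: of_nat_mult of_nat_Suc mult_Suc_right)
    qed (use IH X0 in auto)
    then have "fls_subdegree (peval \<xi> (pCons a p)) = - int (k * Suc (Polynomial.degree p))"
      using s by (simp add: peval_pCons add.commute)
    moreover have "- int (k * Suc (Polynomial.degree p)) \<noteq> 0"
      using k(2) by (simp del: of_nat_mult of_nat_Suc mult_Suc_right)
    ultimately show ?thesis using False by auto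
  qed (use pCons in \<open>auto simp: peval_pCons\<close>)
qed simp

text \<open>The condition under which substitution extends from polynomials to rational functions:
  no denominator becomes zero.\<close>

definition transcendental :: "'a::field fls \<Rightarrow> bool" where
  "transcendental \<xi> \<longleftrightarrow> (\<forall>p. p \<noteq> 0 \<longrightarrow> peval \<xi> p \<noteq> 0)"

definition reval :: "'a::field fls \<Rightarrow> 'a poly fract \<Rightarrow> 'a fls" where
  "reval \<xi> r = (THE z. \<exists>a b. b \<noteq> 0 \<and> r = Fract a b \<and> z = peval \<xi> a / peval \<xi> b)"

lemma reval_Fract:
  assumes \<xi>: "transcendental \<xi>" and b: "b \<noteq> 0"
  shows "reval \<xi> (Fract a b) = peval \<xi> a / peval \<xi> b"
  unfolding reval_def
proof (rule the_equality)
  fix z assume "\<exists>a' b'. b' \<noteq> 0 \<and> Fract a b = Fract a' b' \<and> z = peval \<xi> a' / peval \<xi> b'"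
  then obtain a' b' where *: "b' \<noteq> 0" "Fract a b = Fract a' b'" "z = peval \<xi> a' / peval \<xi> b'" by blast
  then have "a * b' = a' * b" using b by (simp add: eq_fract)
  then have "peval \<xi> a * peval \<xi> b' = peval \<xi> a' * peval \<xi> b" by (metis peval_mult)
  then show "z = peval \<xi> a / peval \<xi> b"
    using * b \<xi> by (simp add: transcendental_def frac_eq_eq)
qed (use b in blast)

lemma reval_to_fract [simp]: "transcendental \<xi> \<Longrightarrow> reval \<xi> (to_fract p) = peval \<xi> p"
  by (simp add: to_fract_def reval_Fract)

lemma reval_0 [simp]: "transcendental \<xi> \<Longrightarrow> reval \<xi> 0 = 0"
  using reval_to_fract[of \<xi> 0] by simp

lemma reval_1 [simp]: "transcendental \<xi> \<Longrightarrow> reval \<xi> 1 = 1"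
  using reval_to_fract[of \<xi> 1] by simp

lemma reval_add [simp]:
  assumes "transcendental \<xi>" shows "reval \<xi> (r + s) = reval \<xi> r + reval \<xi> s"
proof -
  obtain a b c e where "r = Fract a b" "b \<noteq> 0" "s = Fract c e" "e \<noteq> 0"
    by (metis Fract_cases)
  then show ?thesis using assms
    by (simp add: reval_Fract transcendental_def add_frac_eq)
qed

lemma reval_mult [simp]:
  assumes "transcendental \<xi>" shows "reval \<xi> (r * s) = reval \<xi> r * reval \<xi> s"
proof -
  obtain a b c e where "r = Fract a b" "b \<noteq> 0" "s = Fract c e" "e \<noteq> 0"
    by (metis Fract_cases)
  then show ?thesis using assms by (simp add: reval_Fract)
qed

lemma reval_eq_0_iff [simp]:
  assumes "transcendental \<xi>" shows "reval \<xi> r = 0 \<longleftrightarrow> r = 0"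
proof -
  obtain a b where r: "r = Fract a b" "b \<noteq> 0" by (metis Fract_cases)
  then have "r = 0 \<longleftrightarrow> a = 0" unfolding Zero_fract_def by (simp add: eq_fract)
  then show ?thesis using assms r
    by (cases "a = 0") (auto simp: reval_Fract transcendental_def)
qed

lemma reval_uminus [simp]:
  assumes "transcendental \<xi>" shows "reval \<xi> (- r) = - reval \<xi> r"
  using reval_add[OF assms, of r "- r"] assms by (simp add: add_eq_0_iff)

lemma reval_diff [simp]:
  assumes "transcendental \<xi>" shows "reval \<xi> (r - s) = reval \<xi> r - reval \<xi> s"
  using reval_add[OF assms, of r "- s"] assms by simp

lemma transcendental_finite:
  "fls_subdegree t = int k \<Longrightarrow> k > 0 \<Longrightarrow> transcendental (fls_const x0 + t)"
  using peval_subdegree_finite by (auto simp: transcendental_def)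

lemma transcendental_infinity:
  "fls_subdegree \<xi> = - int k \<Longrightarrow> k > 0 \<Longrightarrow> transcendental \<xi>"
  using peval_subdegree_infinity by (auto simp: transcendental_def)

lemma dvd_if_order_le:
  fixes p q :: "'a::alg_closed_field poly"
  assumes "q \<noteq> 0" "p \<noteq> 0" "\<And>x. order x q \<le> order x p"
  shows "q dvd p"
  using assms
proof (induction "Polynomial.degree q" arbitrary: p q)
  case 0
  then show ?case by (metis degree_eq_zeroE is_unit_pCons_iff pCons_0_0 unit_imp_dvd)
next
  case (Suc n)
  then obtain x where x: "poly q x = 0" using alg_closed_imp_poly_has_root[of q] by auto
  then obtain q' where q': "q = [:- x, 1:] * q'" by (auto simp: poly_eq_0_iff_dvd elim: dvdE)
  have "order x q \<noteq> 0" using x Suc.prems(1) by (simp add: order_root)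
  with Suc.prems(3)[of x] have "order x p \<noteq> 0" by linarith
  then have "poly p x = 0" using order_root by blast
  then obtain p' where p': "p = [:- x, 1:] * p'" by (auto simp: poly_eq_0_iff_dvd elim: dvdE)
  have nz: "q' \<noteq> 0" "p' \<noteq> 0" using Suc.prems q' p' by auto
  have "order z q' \<le> order z p'" for z
    using Suc.prems(3)[of z] order_mult[of "[:- x, 1:]" q' z] order_mult[of "[:- x, 1:]" p' z]
      Suc.prems(1,2) unfolding q' p' by simp
  moreover have "Polynomial.degree q' = n"
    using Suc.hyps(2) nz degree_mult_eq[of "[:- x, 1:]" q'] unfolding q' by (simp del: mult_pCons_left)
  ultimately have "q' dvd p'" using Suc.hyps(1) nz by blast
  then show ?case unfolding p' q' by (rule mult_dvd_mono[OF dvd_refl])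
qed

section \<open>Places of a hyperelliptic function field\<close>

lemma common_denominator:
  fixes A B :: "'a::idom fract"
  obtains a b c where "c \<noteq> 0" "A = Fract a c" "B = Fract b c"
proof -
  obtain a a' b b' where "A = Fract a a'" "a' \<noteq> 0" "B = Fract b b'" "b' \<noteq> 0"
    by (metis Fract_cases)
  then show ?thesis using that[of "a' * b'" "a * b'" "b * a'"] by (simp add: eq_fract)
qed

lemma order_le_1_if_coprime_pderiv:
  fixes g :: "'a::field_char_0 poly"
  assumes "u * g + w * pderiv g = 1"
  shows "order x g \<le> 1"
proof (rule ccontr)
  assume "\<not> order x g \<le> 1"
  then have "2 \<le> order x g" by simp
  with order_1 have "[:- x, 1:] ^ 2 dvd g" by (rule power_le_dvd)
  then obtain r where r: "g = [:- x, 1:] ^ 2 * r" by (elim dvdE)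
  then have g: "g = [:- x, 1:] * ([:- x, 1:] * r)" by (simp only: power2_eq_square mult.assoc)
  have "poly g x = 0" by (simp add: g)
  moreover have "poly (pderiv g) x = 0"
    unfolding g by (simp only: pderiv_mult poly_add poly_mult) simp
  ultimately have "poly (u * g + w * pderiv g) x = 0" by simp
  with assms show False by simp
qed

text \<open>Separability is stated as a Bezout identity because an identity passes to the algebraic
  closure coefficient by coefficient.\<close>

locale hyperelliptic =
  fixes d :: "'f::{alg_closed_field, field_char_0}" and g :: "'f poly"
  assumes d: "d \<noteq> 0" and separable: "\<exists>u w. u * g + w * pderiv g = 1"
    and degree_pos: "Polynomial.degree g > 0"
begin

abbreviation "\<F> \<equiv> curve_field d g"

abbreviation "rhs \<equiv> Fract g [:d:]"

lemma order_le_1: "order x g \<le> 1"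
  using separable order_le_1_if_coprime_pderiv by blast

lemma g_neq_0: "g \<noteq> 0"
  using degree_pos by auto

text \<open>At a root of \<open>g\<close>, which is simple, the two sides would have orders of
  different parity.\<close>

lemma poly_nonsquare:
  assumes "[:d:] * a\<^sup>2 = b\<^sup>2 * g"
  shows "a = 0 \<and> b = 0"
proof -
  obtain e where "poly g e = 0" using alg_closed_imp_poly_has_root[OF degree_pos] by blast
  then have "order e g \<noteq> 0" using g_neq_0 by (simp add: order_root)
  with order_le_1[of e] have e: "order e g = 1" by linarith
  have "b = 0"
  proof (rule ccontr)
    assume b: "b \<noteq> 0"
    then have ne: "b\<^sup>2 * g \<noteq> 0" using g_neq_0 by simp
    with assms have ne': "[:d:] * a\<^sup>2 \<noteq> 0" by simp
    then have a: "a \<noteq> 0" by auto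
    have "order e ([:d:] * a\<^sup>2) = 2 * order e a"
      using a d ne' by (subst order_mult) (auto simp: power2_eq_square order_mult order_0I)
    moreover have "order e (b\<^sup>2 * g) = 2 * order e b + 1"
      using b ne e by (subst order_mult) (auto simp: power2_eq_square order_mult)
    ultimately have "2 * order e a = 2 * order e b + 1" using assms by simp
    then show False by presburger
  qed
  with assms d show ?thesis by simp
qed

lemma norm_neq_0:
  assumes "(A, B) \<noteq> (0, 0)"
  shows "A * A - B * B * rhs \<noteq> 0"
proof
  assume "A * A - B * B * rhs = 0"
  obtain a b c where abc: "c \<noteq> 0" "A = Fract a c" "B = Fract b c" by (rule common_denominator)
  have "A * A = B * B * rhs" using \<open>A * A - B * B * rhs = 0\<close> by simp
  with abc have "a * a * (c * c * [:d:]) = b * b * g * (c * c)"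
    using d by (simp add: eq_fract)
  then have "(c * c) * ([:d:] * a\<^sup>2) = (c * c) * (b\<^sup>2 * g)"
    by (simp only: power2_eq_square mult_ac)
  then have "[:d:] * a\<^sup>2 = b\<^sup>2 * g" using abc(1) by (simp only: mult_cancel_left mult_eq_0_iff) blast
  with poly_nonsquare have "a = 0" "b = 0" by auto
  with abc assms show False by (simp add: fract_collapse)
qed

lemma curve_field_simps [simp]:
  "carrier \<F> = UNIV" "\<zero>\<^bsub>\<F>\<^esub> = (0, 0)" "\<one>\<^bsub>\<F>\<^esub> = (1, 0)"
  "(A, B) \<otimes>\<^bsub>\<F>\<^esub> (A', B') = (A * A' + B * B' * rhs, A * B' + B * A')"
  "(A, B) \<oplus>\<^bsub>\<F>\<^esub> (A', B') = (A + A', B + B')"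
  by (simp_all add: curve_field_def)

lemma curve_field_inverse:
  assumes "\<phi> \<noteq> (0, 0)"
  obtains \<psi> where "\<psi> \<noteq> (0, 0)" "\<phi> \<otimes>\<^bsub>\<F>\<^esub> \<psi> = (1, 0)"
proof -
  obtain A B where \<phi>: "\<phi> = (A, B)" by (cases \<phi>)
  define N where "N = A * A - B * B * rhs"
  have N: "N \<noteq> 0" using norm_neq_0 assms unfolding \<phi> N_def by blast
  have "A * (A / N) + B * (- B / N) * rhs = (A * A - B * B * rhs) / N"
    unfolding diff_divide_distrib by simp
  then have "(A, B) \<otimes>\<^bsub>\<F>\<^esub> (A / N, - B / N) = (N / N, 0)"
    unfolding curve_field_simps by (simp add: N_def[symmetric] mult.commute)
  then have "\<phi> \<otimes>\<^bsub>\<F>\<^esub> (A / N, - B / N) = (1, 0)" using N \<phi> by simp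
  moreover have "(A / N, - B / N) \<noteq> (0, 0)" using assms N \<phi> by auto
  ultimately show ?thesis using that by blast
qed

lemma curve_field_mult_neq_0:
  assumes "\<phi> \<noteq> (0, 0)" "\<psi> \<noteq> (0, 0)"
  shows "\<phi> \<otimes>\<^bsub>\<F>\<^esub> \<psi> \<noteq> (0, 0)"
proof
  assume 0: "\<phi> \<otimes>\<^bsub>\<F>\<^esub> \<psi> = (0, 0)"
  obtain A B A' B' where \<phi>: "\<phi> = (A, B)" "\<psi> = (A', B')" by (metis surj_pair)
  have "(A * A - B * B * rhs) * (A' * A' - B' * B' * rhs) =
     (A * A' + B * B' * rhs) * (A * A' + B * B' * rhs) - (A * B' + B * A') * (A * B' + B * A') * rhs"
    by (simp add: algebra_simps)
  also have "\<dots> = 0" using 0 unfolding \<phi> by simp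
  finally show False using norm_neq_0 assms unfolding \<phi> by fastforce
qed

text \<open>A Laurent series parametrisation of the curve, with \<open>S\<close> in the role of y.
  It embeds the function field in the Laurent series field, and valuations are obtained by pulling
  back the order.\<close>

definition laurent_point :: "'f fls \<Rightarrow> 'f fls \<Rightarrow> bool" where
  "laurent_point \<xi> S \<longleftrightarrow> transcendental \<xi> \<and> S\<^sup>2 * fls_const d = peval \<xi> g"

definition ceval :: "'f fls \<Rightarrow> 'f fls \<Rightarrow> 'f poly fract \<times> 'f poly fract \<Rightarrow> 'f fls" where
  "ceval \<xi> S \<phi> = reval \<xi> (fst \<phi>) + reval \<xi> (snd \<phi>) * S"

lemma reval_rhs: "laurent_point \<xi> S \<Longrightarrow> reval \<xi> rhs = S * S"
  using d by (auto simp: laurent_point_def reval_Fract power2_eq_square field_simps)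

lemma ceval_mult:
  assumes "laurent_point \<xi> S"
  shows "ceval \<xi> S (\<phi> \<otimes>\<^bsub>\<F>\<^esub> \<psi>) = ceval \<xi> S \<phi> * ceval \<xi> S \<psi>"
  using assms by (cases \<phi>; cases \<psi>)
    (simp add: ceval_def laurent_point_def reval_rhs[OF assms] algebra_simps)

lemma ceval_add:
  assumes "laurent_point \<xi> S"
  shows "ceval \<xi> S (\<phi> \<oplus>\<^bsub>\<F>\<^esub> \<psi>) = ceval \<xi> S \<phi> + ceval \<xi> S \<psi>"
  using assms by (cases \<phi>; cases \<psi>) (simp add: ceval_def laurent_point_def algebra_simps)

lemma ceval_one: "laurent_point \<xi> S \<Longrightarrow> ceval \<xi> S (1, 0) = 1"
  by (simp add: ceval_def laurent_point_def)

lemma ceval_neq_0: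
  assumes "laurent_point \<xi> S" "\<phi> \<noteq> (0, 0)"
  shows "ceval \<xi> S \<phi> \<noteq> 0"
proof -
  obtain \<psi> where "\<phi> \<otimes>\<^bsub>\<F>\<^esub> \<psi> = (1, 0)" using curve_field_inverse[OF assms(2)] .
  then have "ceval \<xi> S \<phi> * ceval \<xi> S \<psi> = 1"
    using ceval_mult[OF assms(1)] ceval_one[OF assms(1)] by metis
  then show ?thesis by auto
qed

text \<open>The pulled-back order may take all its values in a proper subgroup of the integers,
  whereas a place must be onto; \<open>k\<close> is meant to generate this subgroup.\<close>

definition cval :: "'f fls \<Rightarrow> 'f fls \<Rightarrow> int \<Rightarrow> 'f poly fract \<times> 'f poly fract \<Rightarrow> int" where
  "cval \<xi> S k = restrict (\<lambda>\<phi>. fls_subdegree (ceval \<xi> S \<phi>) div k) (UNIV - {(0, 0)})"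

lemma cval_in_places:
  assumes XS: "laurent_point \<xi> S" and k: "k > 0"
    and dvd: "\<And>\<phi>. \<phi> \<noteq> (0, 0) \<Longrightarrow> k dvd fls_subdegree (ceval \<xi> S \<phi>)"
    and \<pi>: "\<pi> \<noteq> (0, 0)" "fls_subdegree (ceval \<xi> S \<pi>) = k"
  shows "cval \<xi> S k \<in> places \<F> curve_constants"
proof -
  let ?w = "\<lambda>\<phi>. fls_subdegree (ceval \<xi> S \<phi>)"
  have mult: "?w (\<phi> \<otimes>\<^bsub>\<F>\<^esub> \<psi>) = ?w \<phi> + ?w \<psi>" if "\<phi> \<noteq> (0, 0)" "\<psi> \<noteq> (0, 0)" for \<phi> \<psi>
    using ceval_mult[OF XS] ceval_neq_0[OF XS] that by simp
  have val: "cval \<xi> S k \<phi> = ?w \<phi> div k" if "\<phi> \<noteq> (0, 0)" for \<phi>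
    using that by (simp add: cval_def)
  have cmult: "cval \<xi> S k (\<phi> \<otimes>\<^bsub>\<F>\<^esub> \<psi>) = cval \<xi> S k \<phi> + cval \<xi> S k \<psi>"
    if "\<phi> \<noteq> (0, 0)" "\<psi> \<noteq> (0, 0)" for \<phi> \<psi>
    using that curve_field_mult_neq_0[OF that] dvd by (simp add: val mult div_plus_div_distrib_dvd_left)
  have pow: "\<exists>\<phi>. \<phi> \<noteq> (0, 0) \<and> cval \<xi> S k \<phi> = int n" for n
  proof (induction n)
    case 0
    show ?case by (rule exI[of _ "(1, 0)"]) (simp add: val ceval_one[OF XS])
  next
    case (Suc n)
    then obtain \<phi> where "\<phi> \<noteq> (0, 0)" "cval \<xi> S k \<phi> = int n" by blast
    then have "cval \<xi> S k (\<phi> \<otimes>\<^bsub>\<F>\<^esub> \<pi>) = int (Suc n)" "\<phi> \<otimes>\<^bsub>\<F>\<^esub> \<pi> \<noteq> (0, 0)"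
      using cmult[of \<phi> \<pi>] \<pi> k val[OF \<pi>(1)] curve_field_mult_neq_0[of \<phi> \<pi>] by auto
    then show ?case by blast
  qed
  have "\<exists>\<phi>. \<phi> \<noteq> (0, 0) \<and> cval \<xi> S k \<phi> = n" for n
  proof (cases "n \<ge> 0")
    case True
    then show ?thesis using pow[of "nat n"] by auto
  next
    case False
    then obtain \<phi> where \<phi>: "\<phi> \<noteq> (0, 0)" "cval \<xi> S k \<phi> = - n" using pow[of "nat (- n)"] by auto
    obtain \<psi> where \<psi>: "\<psi> \<noteq> (0, 0)" "\<phi> \<otimes>\<^bsub>\<F>\<^esub> \<psi> = (1, 0)"
      using curve_field_inverse[OF \<phi>(1)] .
    have "cval \<xi> S k (1, 0) = 0" by (simp add: val ceval_one[OF XS])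
    then have "cval \<xi> S k \<psi> = n" using cmult[OF \<phi>(1) \<psi>(1)] \<psi>(2) \<phi>(2) by simp
    with \<psi> show ?thesis by blast
  qed
  then have surj: "cval \<xi> S k ` (UNIV - {(0, 0)}) = UNIV"
    by (metis (no_types, lifting) DiffI UNIV_I UNIV_eq_I image_eqI singletonD)
  have add: "min (cval \<xi> S k \<phi>) (cval \<xi> S k \<psi>) \<le> cval \<xi> S k (\<phi> \<oplus>\<^bsub>\<F>\<^esub> \<psi>)"
    if "\<phi> \<noteq> (0, 0)" "\<psi> \<noteq> (0, 0)" "\<phi> \<oplus>\<^bsub>\<F>\<^esub> \<psi> \<noteq> (0, 0)" for \<phi> \<psi>
  proof -
    have "min (?w \<phi>) (?w \<psi>) \<le> ?w (\<phi> \<oplus>\<^bsub>\<F>\<^esub> \<psi>)"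
      using ceval_neq_0[OF XS that(3)] fls_plus_subdegree unfolding ceval_add[OF XS] by blast
    then consider "?w \<phi> \<le> ?w (\<phi> \<oplus>\<^bsub>\<F>\<^esub> \<psi>)" | "?w \<psi> \<le> ?w (\<phi> \<oplus>\<^bsub>\<F>\<^esub> \<psi>)"
      by (auto simp only: min_le_iff_disj)
    then have "min (?w \<phi> div k) (?w \<psi> div k) \<le> ?w (\<phi> \<oplus>\<^bsub>\<F>\<^esub> \<psi>) div k"
      by cases (auto simp only: min_le_iff_disj intro: zdiv_mono1[OF _ k])
    then show ?thesis by (simp only: val[OF that(1)] val[OF that(2)] val[OF that(3)])
  qed
  have const: "cval \<xi> S k c = 0" if "c \<in> curve_constants - {(0, 0)}" for c
    using that XS by (auto simp: curve_constants_def val ceval_def laurent_point_def)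
  show ?thesis
    unfolding places_def mem_Collect_eq curve_field_simps(1,2)
  proof (intro conjI ballI impI)
    show "cval \<xi> S k \<in> extensional (UNIV - {(0, 0)})" by (simp add: cval_def)
  qed (use surj cmult add const in blast)+
qed

text \<open>The orders form a subgroup of the integers, nonzero because of \<rho>, and k is its
  least positive element. The ramification of the parametrisation thus need not be known
  beforehand.\<close>

lemma normalise:
  assumes XS: "laurent_point \<xi> S" and \<rho>: "\<rho> \<noteq> (0, 0)" "fls_subdegree (ceval \<xi> S \<rho>) \<noteq> 0"
  obtains k where "k > 0" "\<And>\<phi>. \<phi> \<noteq> (0, 0) \<Longrightarrow> k dvd fls_subdegree (ceval \<xi> S \<phi>)"
    "cval \<xi> S k \<in> places \<F> curve_constants"
proof -
  let ?w = "\<lambda>\<phi>. fls_subdegree (ceval \<xi> S \<phi>)"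
  have mult: "?w (\<phi> \<otimes>\<^bsub>\<F>\<^esub> \<psi>) = ?w \<phi> + ?w \<psi>" if "\<phi> \<noteq> (0, 0)" "\<psi> \<noteq> (0, 0)" for \<phi> \<psi>
    using ceval_mult[OF XS] ceval_neq_0[OF XS] that by simp
  have neg: "\<exists>\<psi>. \<psi> \<noteq> (0, 0) \<and> ?w \<psi> = - ?w \<phi>" if \<phi>: "\<phi> \<noteq> (0, 0)" for \<phi>
  proof -
    obtain \<psi> where \<psi>: "\<psi> \<noteq> (0, 0)" "\<phi> \<otimes>\<^bsub>\<F>\<^esub> \<psi> = (1, 0)" using curve_field_inverse[OF \<phi>] .
    then have "?w \<phi> + ?w \<psi> = 0" using mult[OF \<phi> \<psi>(1)] by (simp add: ceval_one[OF XS])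
    then have "?w \<psi> = - ?w \<phi>" by linarith
    with \<psi>(1) show ?thesis by blast
  qed
  define P where "P = (\<lambda>n. n > 0 \<and> (\<exists>\<phi>. \<phi> \<noteq> (0, 0) \<and> ?w \<phi> = int n))"
  have "\<exists>n. P n"
  proof (cases "?w \<rho> > 0")
    case True
    then show ?thesis using \<rho> by (intro exI[of _ "nat (?w \<rho>)"]) (auto simp: P_def simp del: split_paired_Ex)
  next
    case False
    then show ?thesis using \<rho> neg[OF \<rho>(1)] by (intro exI[of _ "nat (- ?w \<rho>)"]) (auto simp: P_def simp del: split_paired_Ex)
  qed
  define k where "k = (LEAST n. P n)"
  have Pk: "P k" unfolding k_def using \<open>\<exists>n. P n\<close> by (rule LeastI_ex)
  then obtain \<pi> where k: "k > 0" and \<pi>: "\<pi> \<noteq> (0, 0)" "?w \<pi> = int k" unfolding P_def by blast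
  have shift: "\<exists>\<psi>. \<psi> \<noteq> (0, 0) \<and> ?w \<psi> = ?w \<phi> + int k * n" if "\<phi> \<noteq> (0, 0)" for \<phi> n
  proof (induction n rule: int_induct[where k = 0])
    case base
    then show ?case using that by (auto simp del: split_paired_Ex)
  next
    case (step1 i)
    then obtain \<psi> where "\<psi> \<noteq> (0, 0)" "?w \<psi> = ?w \<phi> + int k * i" by blast
    then have "?w (\<psi> \<otimes>\<^bsub>\<F>\<^esub> \<pi>) = ?w \<phi> + int k * (i + 1)" "\<psi> \<otimes>\<^bsub>\<F>\<^esub> \<pi> \<noteq> (0, 0)"
      using mult[of \<psi> \<pi>] \<pi> curve_field_mult_neq_0[of \<psi> \<pi>] by (auto simp: algebra_simps)
    then show ?case by blast
  next
    case (step2 i)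
    then obtain \<psi> where \<psi>: "\<psi> \<noteq> (0, 0)" "?w \<psi> = ?w \<phi> + int k * i" by blast
    obtain \<pi>' where "\<pi>' \<noteq> (0, 0)" "?w \<pi>' = - int k" using neg[OF \<pi>(1)] \<pi>(2) by auto
    with \<psi> have "?w (\<psi> \<otimes>\<^bsub>\<F>\<^esub> \<pi>') = ?w \<phi> + int k * (i - 1)" "\<psi> \<otimes>\<^bsub>\<F>\<^esub> \<pi>' \<noteq> (0, 0)"
      using mult[of \<psi> \<pi>'] curve_field_mult_neq_0[of \<psi> \<pi>'] by (auto simp: algebra_simps)
    then show ?case by blast
  qed
  have dvd: "int k dvd ?w \<phi>" if \<phi>: "\<phi> \<noteq> (0, 0)" for \<phi>
  proof (rule ccontr)
    assume "\<not> int k dvd ?w \<phi>"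
    then have r: "?w \<phi> mod int k > 0" "?w \<phi> mod int k < int k"
      using k pos_mod_sign[of "int k" "?w \<phi>"] by (simp_all add: dvd_eq_mod_eq_0 order.not_eq_order_implies_strict)
    obtain \<psi> where "\<psi> \<noteq> (0, 0)" "?w \<psi> = ?w \<phi> + int k * (- (?w \<phi> div int k))"
      using shift[OF \<phi>] by blast
    then have "\<psi> \<noteq> (0, 0)" "?w \<psi> = ?w \<phi> mod int k"
      by (simp_all add: minus_mult_div_eq_mod)
    then have "P (nat (?w \<phi> mod int k))" unfolding P_def using r by (auto simp del: split_paired_Ex)
    then have "k \<le> nat (?w \<phi> mod int k)" unfolding k_def by (rule Least_le)
    with r show False by linarith
  qed
  show ?thesis
    by (rule that[of "int k"]) (use k dvd cval_in_places[OF XS _ dvd \<pi>] in auto)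
qed

text \<open>The expansion of y in powers of X at a point with nonzero ordinate. The prescribed
  constant term selects one of the two branches, hence one of the two points over x.\<close>

definition point_sqrt :: "'f \<Rightarrow> 'f \<Rightarrow> 'f fls" where
  "point_sqrt x y = (SOME S. S\<^sup>2 * fls_const d = peval (fls_const x + fls_X) g \<and> fls_nth S 0 = y
     \<and> fls_subdegree S \<ge> 0)"

definition point_place :: "'f \<Rightarrow> 'f \<Rightarrow> 'f poly fract \<times> 'f poly fract \<Rightarrow> int" where
  "point_place x y = cval (fls_const x + fls_X) (point_sqrt x y) 1"

lemma peval_X_nth_0: "fls_nth (peval (fls_const x + fls_X) p) 0 = poly p x"
  for p :: "'f poly"
proof (induction p)
  case (pCons a p)
  have "fls_subdegree (peval (fls_const x + fls_X) p) \<ge> 0"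
    by (intro peval_subdegree_nonneg fls_subdegree_nonneg_add) auto
  then have "fls_nth (fls_X * peval (fls_const x + fls_X) p) 0 = 0"
    by (simp add: fls_X_times_conv_shift)
  then show ?case using pCons by (simp add: peval_pCons algebra_simps)
qed simp

lemma transcendental_X: "transcendental (fls_const x + fls_X :: 'f fls)"
  by (rule transcendental_finite[of _ 1]) auto

lemma point_sqrt:
  assumes "d * y\<^sup>2 = poly g x" "y \<noteq> 0"
  shows "(point_sqrt x y)\<^sup>2 * fls_const d = peval (fls_const x + fls_X) g"
    "fls_nth (point_sqrt x y) 0 = y" "fls_subdegree (point_sqrt x y) \<ge> 0"
proof -
  let ?h = "fls_const (1 / d) * peval (fls_const x + fls_X) g"
  have "fls_subdegree ?h \<ge> 0"
    by (intro fls_subdegree_nonneg_mult peval_subdegree_nonneg fls_subdegree_nonneg_add) auto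
  moreover have "fls_nth ?h 0 = y\<^sup>2"
    using assms d by (simp add: peval_X_nth_0 nonzero_eq_divide_eq mult.commute flip: assms(1))
  ultimately obtain S where "S\<^sup>2 = ?h" "fls_nth S 0 = y" "fls_subdegree S \<ge> 0"
    using fls_sqrt_exists_const assms(2) by blast
  moreover have "?h * fls_const d = peval (fls_const x + fls_X) g"
    using d by (simp add: mult.commute mult.left_commute)
  ultimately have "\<exists>S. S\<^sup>2 * fls_const d = peval (fls_const x + fls_X) g \<and> fls_nth S 0 = y
      \<and> fls_subdegree S \<ge> 0" by metis
  from someI_ex[OF this] show "(point_sqrt x y)\<^sup>2 * fls_const d = peval (fls_const x + fls_X) g"
    "fls_nth (point_sqrt x y) 0 = y" "fls_subdegree (point_sqrt x y) \<ge> 0"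
    unfolding point_sqrt_def by blast+
qed

lemma laurent_point_X:
  assumes "d * y\<^sup>2 = poly g x" "y \<noteq> 0"
  shows "laurent_point (fls_const x + fls_X) (point_sqrt x y)"
  using point_sqrt[OF assms] transcendental_X by (simp add: laurent_point_def)

lemma point_place_eq:
  "\<phi> \<noteq> (0, 0) \<Longrightarrow> point_place x y \<phi> = fls_subdegree (ceval (fls_const x + fls_X) (point_sqrt x y) \<phi>)"
  by (simp add: point_place_def cval_def)

lemma point_place_to_fract:
  assumes "p \<noteq> 0"
  shows "point_place x y (to_fract p, 0) = int (order x p)"
  using assms peval_subdegree_finite[of "fls_X" 1 p x]
  by (simp add: point_place_eq ceval_def transcendental_X)

lemma point_place_in_places:
  assumes "d * y\<^sup>2 = poly g x" "y \<noteq> 0"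
  shows "point_place x y \<in> places \<F> curve_constants"
proof -
  have "order x [:- x, 1:] = 1" using order_power_n_n[of x 1] by simp
  then have "point_place x y (to_fract [:- x, 1:], 0) = 1"
    by (subst point_place_to_fract) auto
  then show ?thesis
    unfolding point_place_def
    by (intro cval_in_places[of _ _ _ "(to_fract [:- x, 1:], 0)"] laurent_point_X[OF assms])
      (auto simp: point_place_def cval_def)
qed

lemma point_place_neq:
  assumes "d * y\<^sup>2 = poly g x" "y \<noteq> 0" "x \<noteq> x'"
  shows "point_place x y \<noteq> point_place x' y'"
proof -
  have "order x [:- x, 1:] = 1" using order_power_n_n[of x 1] by simp
  moreover have "order x' [:- x, 1:] = 0" using assms(3) by (intro order_0I) simp
  ultimately show ?thesis
    using point_place_to_fract[of "[:- x, 1:]" x y] point_place_to_fract[of "[:- x, 1:]" x' y'] by auto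
qed

lemma point_place_neq_minus:
  assumes "d * y\<^sup>2 = poly g x" "y \<noteq> 0"
  shows "point_place x y \<noteq> point_place x (- y)"
proof -
  \<comment> \<open>The function that subtracts the constant y from the coordinate function: it
    vanishes at the first point and has the value -2y at the second.\<close>
  define \<phi> where "\<phi> = (to_fract [:- y:], 1 :: 'f poly fract)"
  have \<phi>0: "\<phi> \<noteq> (0, 0)" by (simp add: \<phi>_def)
  have y': "d * (- y)\<^sup>2 = poly g x" "- y \<noteq> 0" using assms by auto
  let ?\<xi> = "fls_const x + fls_X"
  have c: "ceval ?\<xi> S \<phi> = S - fls_const y" for S
    by (simp add: \<phi>_def ceval_def transcendental_X)
  let ?z = "ceval ?\<xi> (point_sqrt x y) \<phi>" and ?z' = "ceval ?\<xi> (point_sqrt x (- y)) \<phi>"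
  have nz: "?z \<noteq> 0" using ceval_neq_0[OF laurent_point_X[OF assms] \<phi>0] .
  have "fls_nth ?z 0 = 0" using point_sqrt(2)[OF assms] by (simp add: c)
  moreover have "fls_subdegree ?z \<ge> 0"
    using point_sqrt(3)[OF assms] fls_subdegree_nonneg_add[of "point_sqrt x y" "fls_const (- y)"]
    by (simp add: c)
  ultimately have "fls_subdegree ?z > 0"
    using nz by (metis le_less nth_fls_subdegree_nonzero)
  moreover have "fls_nth ?z' 0 \<noteq> 0" using point_sqrt(2)[OF y'] assms(2) by (simp add: c)
  then have "fls_subdegree ?z' \<le> 0" by (rule fls_subdegree_leI)
  ultimately show ?thesis using point_place_eq[OF \<phi>0] by (metis not_le)
qed

text \<open>The value of a place at a point is determined by polynomials over the field of definition of
  that point: this is what makes it Galois invariant.\<close>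

lemma subdegree_ge_iff_dvd:
  assumes xy: "d * y\<^sup>2 = poly g x" "y \<noteq> 0"
    and T: "poly T x = y" "[:- x, 1:] ^ n dvd [:d:] * T\<^sup>2 - g"
    and AB: "A \<noteq> 0 \<or> B \<noteq> 0"
  shows "int n \<le> fls_subdegree (peval (fls_const x + fls_X) A + peval (fls_const x + fls_X) B * point_sqrt x y)
    \<longleftrightarrow> [:- x, 1:] ^ n dvd A + B * T"
proof -
  let ?\<xi> = "fls_const x + fls_X" and ?S = "point_sqrt x y"
  \<comment> \<open>The zero series counts as having infinite order here, whereas
    \<open>fls_subdegree\<close> assigns it 0.\<close>
  define ge where "ge = (\<lambda>z :: 'f fls. z = 0 \<or> int n \<le> fls_subdegree z)"
  have ge_add: "ge (a + b)" if "ge a" "ge b" for a b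
    using that fls_plus_subdegree[of a b]
    by (cases "a = 0 \<or> b = 0 \<or> a + b = 0") (auto simp: ge_def min_def split: if_splits)
  have ge_minus: "ge (- a)" if "ge a" for a using that by (auto simp: ge_def)
  have ge_add_iff: "ge (a + b) \<longleftrightarrow> ge a" if "ge b" for a b
    using ge_add[of a b] ge_add[of "a + b" "- b"] ge_minus[OF that] that by auto
  have ge_mult: "ge (a * b)" if "ge a" "fls_subdegree b \<ge> 0" for a b
    using that by (cases "a = 0 \<or> b = 0") (auto simp: ge_def)
  have \<xi>: "fls_subdegree (?\<xi> :: 'f fls) \<ge> 0" by (intro fls_subdegree_nonneg_add) auto
  have ge_poly: "ge (peval ?\<xi> p) \<longleftrightarrow> [:- x, 1:] ^ n dvd p" for p
  proof (cases "p = 0")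
    case False
    then show ?thesis using peval_subdegree_finite[of fls_X 1 p x] by (simp add: ge_def order_divides)
  qed (simp add: ge_def)
  \<comment> \<open>\<open>T\<close> and the power series root of g/d agree to order n: the product
    \<open>z * z'\<close> is the evaluation of d T^2 - g, and \<open>z'\<close> has the nonzero
    constant term 2 d y, so all the vanishing falls on \<open>z\<close>.\<close>
  define z where "z = peval ?\<xi> T - ?S"
  define z' where "z' = fls_const d * (peval ?\<xi> T + ?S)"
  have "z * z' = peval ?\<xi> ([:d:] * T\<^sup>2 - g)"
    using point_sqrt(1)[OF xy]
    by (simp only: z_def z'_def peval_diff peval_mult peval_power peval_const)
      (simp add: algebra_simps power2_eq_square)
  then have zz': "ge (z * z')" using T(2) ge_poly by metis
  have "fls_nth z' 0 = d * (y + y)" using point_sqrt(2)[OF xy] T(1) by (simp add: z'_def peval_X_nth_0)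
  also have "\<dots> \<noteq> 0" using d xy(2) by (simp flip: mult_2)
  finally have z'0: "fls_nth z' 0 \<noteq> 0" .
  then have "z' \<noteq> 0" "fls_subdegree z' \<le> 0" by (auto intro: fls_subdegree_leI)
  with zz' have "ge z" by (cases "z = 0") (auto simp: ge_def)
  have "peval ?\<xi> A + peval ?\<xi> B * ?S = peval ?\<xi> (A + B * T) + - (z * peval ?\<xi> B)"
    by (simp add: z_def algebra_simps)
  moreover have "ge (- (z * peval ?\<xi> B))"
    using \<open>ge z\<close> by (intro ge_minus ge_mult peval_subdegree_nonneg \<xi>)
  ultimately have "ge (peval ?\<xi> A + peval ?\<xi> B * ?S) \<longleftrightarrow> ge (peval ?\<xi> (A + B * T))"
    by (simp only: ge_add_iff)
  moreover have "peval ?\<xi> A + peval ?\<xi> B * ?S \<noteq> 0"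
    using ceval_neq_0[OF laurent_point_X[OF xy], of "(to_fract A, to_fract B)"] AB
    by (simp add: ceval_def transcendental_X)
  ultimately show ?thesis using ge_poly[of "A + B * T"] by (simp only: ge_def) blast
qed

end

context hyperelliptic
begin

text \<open>Substituting \<open>x\<^sub>0 + t\<^sup>2\<close> (or \<open>t\<^sup>-\<^sup>2\<close>) for \<open>x\<close> makes \<open>g\<close> a square of a Laurent series whether or
  not \<open>x\<^sub>0\<close> is a branch point. The valuation obtained need not be normalised.\<close>

lemma polynomial_if_integral:
  assumes "\<And>x0. \<exists>s. s \<noteq> 0 \<and> fls_subdegree s \<le> 1 \<and>
    fls_subdegree (reval (fls_const x0 + fls_X\<^sup>2) A * s) \<ge> 0"
  obtains p :: "'f poly" where "A = to_fract p"
proof (cases "A = 0")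
  case False
  obtain a c where A: "A = Fract a c" "c \<noteq> 0" by (metis Fract_cases)
  with False have a: "a \<noteq> 0" by (auto simp: fract_collapse)
  have "order x0 c \<le> order x0 a" for x0
  proof -
    let ?\<xi> = "fls_const x0 + fls_X\<^sup>2"
    have sub: "fls_subdegree (fls_X\<^sup>2 :: 'f fls) = int 2" by simp
    have t: "transcendental ?\<xi>" using transcendental_finite[OF sub] by simp
    note pa = peval_subdegree_finite[OF sub _ a, of x0]
    note pc = peval_subdegree_finite[OF sub _ A(2), of x0]
    obtain s where s: "s \<noteq> 0" "fls_subdegree s \<le> 1" "fls_subdegree (reval ?\<xi> A * s) \<ge> 0"
      using assms by blast
    have "fls_subdegree (reval ?\<xi> A * s) = fls_subdegree (reval ?\<xi> A) + fls_subdegree s"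
      using s(1) t False by simp
    moreover have "fls_subdegree (reval ?\<xi> A) = 2 * int (order x0 a) - 2 * int (order x0 c)"
      using pa pc A t by (simp add: reval_Fract fls_divide_subdegree)
    \<comment> \<open>The order of \<open>A\<close> after substitution is even, so the bound -1 that
      \<open>s\<close> leaves already forces it to be nonnegative. The tolerance of 1 is there for
      y, which vanishes to order 1 in t over a branch point.\<close>
    ultimately show ?thesis using s by linarith
  qed
  then have "c dvd a" using dvd_if_order_le A(2) a by blast
  then obtain p where "a = c * p" by (elim dvdE)
  then have "A = to_fract p" using A by (simp add: to_fract_def eq_fract)
  then show ?thesis using that by blast
qed (use that[of 0] in simp)

lemma laurent_point_exists:
  assumes "transcendental \<xi>" "even (fls_subdegree (peval \<xi> g))"
  obtains S where "laurent_point \<xi> S" "laurent_point \<xi> (- S)" "S \<noteq> 0"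
    "2 * fls_subdegree S = fls_subdegree (peval \<xi> g)"
proof -
  have nz: "peval \<xi> g \<noteq> 0" using assms(1) g_neq_0 by (simp add: transcendental_def)
  let ?h = "fls_const (1 / d) * peval \<xi> g"
  have sub: "fls_subdegree ?h = fls_subdegree (peval \<xi> g)" "?h \<noteq> 0"
    using nz d by auto
  then obtain S where S: "S\<^sup>2 = ?h" using assms(2) fls_sqrt_exists[of ?h] by metis
  have "?h * fls_const d = peval \<xi> g" using d by (simp add: mult.commute mult.left_commute)
  then have "S\<^sup>2 * fls_const d = peval \<xi> g" using S by simp
  moreover have "S \<noteq> 0" using S sub(2) by auto
  moreover have "2 * fls_subdegree S = fls_subdegree (peval \<xi> g)"
    using sub(1) \<open>S \<noteq> 0\<close> unfolding S[symmetric] by (simp add: power2_eq_square)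
  ultimately show ?thesis using that[of S] assms(1) by (simp add: laurent_point_def)
qed

text \<open>Half the sum and half the difference of the two conjugate evaluations isolate the two
  components.\<close>

lemma subdegree_components:
  assumes \<xi>: "transcendental \<xi>"
    and ge: "fls_subdegree (ceval \<xi> S (A, B)) \<ge> n" "fls_subdegree (ceval \<xi> (- S) (A, B)) \<ge> n"
  shows "A \<noteq> 0 \<Longrightarrow> fls_subdegree (reval \<xi> A) \<ge> n"
    and "B \<noteq> 0 \<Longrightarrow> S \<noteq> 0 \<Longrightarrow> fls_subdegree (reval \<xi> B * S) \<ge> n"
proof -
  assume "A \<noteq> 0"
  have eq: "ceval \<xi> S (A, B) + ceval \<xi> (- S) (A, B) = 2 * reval \<xi> A"
    by (simp add: ceval_def)
  have "fls_subdegree (2 * reval \<xi> A) \<ge> n"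
    using fls_subdegree_ge_add[OF ge] \<xi> \<open>A \<noteq> 0\<close> unfolding eq by simp
  then show "fls_subdegree (reval \<xi> A) \<ge> n" by (simp only: fls_subdegree_2_mult)
next
  assume "B \<noteq> 0" "S \<noteq> 0"
  have eq: "ceval \<xi> S (A, B) + - ceval \<xi> (- S) (A, B) = 2 * (reval \<xi> B * S)"
    by (simp add: ceval_def)
  have "fls_subdegree (2 * (reval \<xi> B * S)) \<ge> n"
    using fls_subdegree_ge_add[OF ge(1), of "- ceval \<xi> (- S) (A, B)"] ge(2) \<xi> \<open>B \<noteq> 0\<close> \<open>S \<noteq> 0\<close>
    unfolding eq by simp
  then show "fls_subdegree (reval \<xi> B * S) \<ge> n" by (simp only: fls_subdegree_2_mult)
qed

text \<open>Let h be the product of the (x - x_j)^(e_j) with e_j = |n_j|. Multiplying \<phi> by h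
  cancels the poles over finite x and raises the zero over each x_j, which lies at y_j or -y_j
  according to the sign of n_j, to order at least 2 e_j. The product therefore has polynomial
  components \<open>A\<close> and \<open>B\<close>, whose degrees are bounded by the order of h at
  infinity.\<close>

lemma functions_of_relation:
  fixes x y :: "'i \<Rightarrow> 'f" and n :: "'i \<Rightarrow> int"
  defines "e \<equiv> \<lambda>j. nat \<bar>n j\<bar>"
  assumes J: "finite J"
    and xy: "\<And>j. j \<in> J \<Longrightarrow> d * (y j)\<^sup>2 = poly g (x j)" "\<And>j. j \<in> J \<Longrightarrow> y j \<noteq> 0"
    and \<phi>: "\<phi> \<noteq> (0, 0)"
    and other: "\<And>v. v \<in> places \<F> curve_constants \<Longrightarrow>
      (\<And>j. j \<in> J \<Longrightarrow> v \<noteq> point_place (x j) (y j) \<and> v \<noteq> point_place (x j) (- y j)) \<Longrightarrow> v \<phi> = 0"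
    and pos: "\<And>j. j \<in> J \<Longrightarrow> point_place (x j) (y j) \<phi> = n j"
    and neg: "\<And>j. j \<in> J \<Longrightarrow> point_place (x j) (- y j) \<phi> = - n j"
  obtains A B where "A \<noteq> 0 \<or> B \<noteq> 0" "Polynomial.degree A \<le> (\<Sum>j\<in>J. e j)"
    "B \<noteq> 0 \<Longrightarrow> 2 * Polynomial.degree B + Polynomial.degree g \<le> 2 * (\<Sum>j\<in>J. e j)"
    "\<And>j. j \<in> J \<Longrightarrow> int (2 * e j) \<le> fls_subdegree (peval (fls_const (x j) + fls_X) A
       + peval (fls_const (x j) + fls_X) B * point_sqrt (x j) (if n j \<ge> 0 then y j else - y j))"
proof -
  define M where "M = (\<Sum>j\<in>J. e j)"
  define h where "h = (\<Prod>j\<in>J. [:- x j, 1:] ^ e j)"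
  have h0: "h \<noteq> 0" using J by (simp add: h_def)
  have degh: "Polynomial.degree h = M" unfolding h_def M_def by (rule degree_prod_linear_power)
  have ordh: "e j \<le> order (x j) h" if "j \<in> J" for j
  proof -
    have "[:- x j, 1:] ^ e j dvd h" unfolding h_def using J that by (intro dvd_prodI)
    then show ?thesis using h0 order_divides by blast
  qed
  obtain A0 B0 where AB0: "\<phi> = (A0, B0)" by (cases \<phi>)
  define A1 where "A1 = to_fract h * A0"
  define B1 where "B1 = to_fract h * B0"
  have AB1: "A1 \<noteq> 0 \<or> B1 \<noteq> 0" using \<phi> h0 by (auto simp: AB0 A1_def B1_def)
  have sub1: "fls_subdegree (ceval \<xi> S (A1, B1)) = fls_subdegree (peval \<xi> h) + fls_subdegree (ceval \<xi> S \<phi>)"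
    if "laurent_point \<xi> S" for \<xi> S
  proof -
    have t: "transcendental \<xi>" using that by (simp add: laurent_point_def)
    have "ceval \<xi> S (A1, B1) = peval \<xi> h * ceval \<xi> S \<phi>"
      using t by (simp add: ceval_def A1_def B1_def AB0 algebra_simps)
    moreover have "peval \<xi> h \<noteq> 0" using t h0 by (simp add: transcendental_def)
    ultimately show ?thesis using ceval_neq_0[OF that \<phi>] by simp
  qed
  have lin: "ceval \<xi> S (to_fract [:- z, 1:], 0) = peval \<xi> [:- z, 1:]" if "transcendental \<xi>" for \<xi> S z
    using that by (simp add: ceval_def)
  have ord1: "order z [:- z, 1:] = 1" for z :: 'f using order_power_n_n[of z 1] by simp
  have special: "point_place (x j) y' (to_fract [:- x j, 1:], 0) = 1" for j y'
    using point_place_to_fract[of "[:- x j, 1:]" "x j" y'] ord1 by simp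
  have sub2: "fls_subdegree (fls_X\<^sup>2 :: 'f fls) = int 2" by simp
  \<comment> \<open>The place obtained over x0 is either none of the given points, and then \<phi>
    has order 0 there, or one of them, and then h compensates the possible pole.\<close>
  have finite: "fls_subdegree (ceval (fls_const x0 + fls_X\<^sup>2) S (A1, B1)) \<ge> 0"
    if XS: "laurent_point (fls_const x0 + fls_X\<^sup>2) S" for x0 S
  proof -
    let ?\<xi> = "fls_const x0 + fls_X\<^sup>2"
    have t: "transcendental ?\<xi>" using XS by (simp add: laurent_point_def)
    note sub = peval_subdegree_finite[OF sub2 _ , of _ x0, simplified]
    have "fls_subdegree (ceval ?\<xi> S (to_fract [:- x0, 1:], 0)) \<noteq> 0"
      unfolding lin[OF t] using sub[of "[:- x0, 1:]"] ord1[of x0] by simp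
    then obtain k where k: "k > 0" "\<And>\<phi>. \<phi> \<noteq> (0, 0) \<Longrightarrow> k dvd fls_subdegree (ceval ?\<xi> S \<phi>)"
      "cval ?\<xi> S k \<in> places \<F> curve_constants"
      using normalise[OF XS, of "(to_fract [:- x0, 1:], 0)"] by (metis prod.inject pCons_eq_0_iff to_fract_eq_0_iff zero_neq_one)
    have val: "fls_subdegree (ceval ?\<xi> S \<psi>) = cval ?\<xi> S k \<psi> * k" if "\<psi> \<noteq> (0, 0)" for \<psi>
      using k(2)[OF that] that by (simp add: cval_def)
    show ?thesis
    proof (cases "\<exists>j\<in>J. cval ?\<xi> S k = point_place (x j) (y j) \<or> cval ?\<xi> S k = point_place (x j) (- y j)")
      case False
      then have "cval ?\<xi> S k \<phi> = 0" using other[OF k(3)] by blast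
      then show ?thesis using sub1[OF XS] val[OF \<phi>] sub[OF h0] by simp
    next
      case True
      then obtain j where j: "j \<in> J"
        and v: "cval ?\<xi> S k = point_place (x j) (y j) \<or> cval ?\<xi> S k = point_place (x j) (- y j)" by blast
      then have "cval ?\<xi> S k (to_fract [:- x j, 1:], 0) = 1" using special by metis
      then have kk: "fls_subdegree (peval ?\<xi> [:- x j, 1:]) = k"
        using val[of "(to_fract [:- x j, 1:], 0)"] lin[OF t] by simp
      have x0: "x0 = x j"
      proof (rule ccontr)
        assume "x0 \<noteq> x j"
        then have "order x0 [:- x j, 1:] = 0" by (intro order_0I) simp
        then show False using kk k(1) sub[of "[:- x j, 1:]"] by simp
      qed
      \<comment> \<open>The place has the value 1 on x - x_j, which becomes t^2: at a point with y
        nonzero the substitution traverses the branch doubly.\<close>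
      then have k2: "k = 2" using kk sub[of "[:- x j, 1:]"] ord1 by simp
      have "cval ?\<xi> S k \<phi> \<ge> - int (e j)"
        using v pos[OF j] neg[OF j] by (auto simp: e_def)
      then have "fls_subdegree (ceval ?\<xi> S \<phi>) \<ge> - 2 * int (e j)" using val[OF \<phi>] k2 by simp
      moreover have "fls_subdegree (peval ?\<xi> h) \<ge> 2 * int (e j)"
        using sub[OF h0] ordh[OF j] x0 by simp
      ultimately show ?thesis using sub1[OF XS] by simp
    qed
  qed
  have comp: "\<exists>S. S \<noteq> 0 \<and> fls_subdegree S \<le> 1 \<and> (A1 \<noteq> 0 \<longrightarrow> fls_subdegree (reval (fls_const x0 + fls_X\<^sup>2) A1) \<ge> 0)
     \<and> (B1 \<noteq> 0 \<longrightarrow> fls_subdegree (reval (fls_const x0 + fls_X\<^sup>2) B1 * S) \<ge> 0)" for x0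
  proof -
    let ?\<xi> = "fls_const x0 + fls_X\<^sup>2"
    have t: "transcendental ?\<xi>" using transcendental_finite[OF sub2] by simp
    have sg: "fls_subdegree (peval ?\<xi> g) = 2 * int (order x0 g)"
      using peval_subdegree_finite[OF sub2 _ g_neq_0, of x0] by simp
    then obtain S where S: "laurent_point ?\<xi> S" "laurent_point ?\<xi> (- S)" "S \<noteq> 0"
      "2 * fls_subdegree S = fls_subdegree (peval ?\<xi> g)"
      using laurent_point_exists[OF t] by (metis dvd_triv_left)
    then have "fls_subdegree S \<le> 1" using sg order_le_1[of x0] by simp
    then show ?thesis
      using subdegree_components[OF t finite[OF S(1)] finite[OF S(2)]] S(3) by blast
  qed
  have "\<exists>s. s \<noteq> 0 \<and> fls_subdegree s \<le> 1 \<and> fls_subdegree (reval (fls_const x0 + fls_X\<^sup>2) A1 * s) \<ge> 0" for x0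
    by (rule exI[of _ 1], cases "A1 = 0") (use comp[of x0] transcendental_finite[OF sub2, of x0] in auto)
  then obtain A where A: "A1 = to_fract A" using polynomial_if_integral[of A1] by blast
  have "\<exists>s. s \<noteq> 0 \<and> fls_subdegree s \<le> 1 \<and> fls_subdegree (reval (fls_const x0 + fls_X\<^sup>2) B1 * s) \<ge> 0" for x0
  proof (cases "B1 = 0")
    case True
    then show ?thesis using transcendental_finite[OF sub2, of x0] by (intro exI[of _ 1]) simp
  qed (use comp[of x0] in blast)
  then obtain B where B: "B1 = to_fract B" using polynomial_if_integral[of B1] by blast
  let ?\<xi> = "fls_X_inv\<^sup>2 :: 'f fls"
  have subi: "fls_subdegree ?\<xi> = - int 2" by simp
  have t: "transcendental ?\<xi>" using transcendental_infinity[OF subi] by simp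
  note sub = peval_subdegree_infinity[OF subi, simplified]
  have infinite: "fls_subdegree (ceval ?\<xi> S (A1, B1)) = - 2 * int M" if XS: "laurent_point ?\<xi> S" for S
  proof -
    have s1: "fls_subdegree (ceval ?\<xi> S (to_fract [:- z, 1:], 0)) = -2" for z
      unfolding lin[OF t] using sub[of "[:- z, 1:]"] by simp
    then obtain k where k: "k > 0" "\<And>\<phi>. \<phi> \<noteq> (0, 0) \<Longrightarrow> k dvd fls_subdegree (ceval ?\<xi> S \<phi>)"
      "cval ?\<xi> S k \<in> places \<F> curve_constants"
      using normalise[OF XS, of "(to_fract [:- 0, 1:], 0)"]
      by (metis prod.inject pCons_eq_0_iff to_fract_eq_0_iff zero_neq_one neg_equal_0_iff_equal zero_neq_numeral)
    have val: "fls_subdegree (ceval ?\<xi> S \<psi>) = cval ?\<xi> S k \<psi> * k" if "\<psi> \<noteq> (0, 0)" for \<psi>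
      using k(2)[OF that] that by (simp add: cval_def)
    \<comment> \<open>x - x_j has a pole over infinity and a zero at each of the given points, so
      the place falls under \<open>other\<close>.\<close>
    have "cval ?\<xi> S k \<noteq> point_place (x j) y'" for j y'
    proof
      assume "cval ?\<xi> S k = point_place (x j) y'"
      then have "cval ?\<xi> S k (to_fract [:- x j, 1:], 0) = 1" using special by metis
      then show False using val[of "(to_fract [:- x j, 1:], 0)"] s1[of "x j"] k(1) by simp
    qed
    then have "cval ?\<xi> S k \<phi> = 0" using other[OF k(3)] by blast
    then show ?thesis using sub1[OF XS] val[OF \<phi>] sub[OF h0] degh by simp
  qed
  have sg: "fls_subdegree (peval ?\<xi> g) = 2 * - int (Polynomial.degree g)"
    using sub[OF g_neq_0] by simp
  then obtain S where S: "laurent_point ?\<xi> S" "laurent_point ?\<xi> (- S)" "S \<noteq> 0"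
      "2 * fls_subdegree S = fls_subdegree (peval ?\<xi> g)"
    using laurent_point_exists[OF t] by (metis dvd_triv_left)
  note comp' = subdegree_components[OF t, of "- 2 * int M" S A1 B1]
  show ?thesis
  proof (rule that)
    show "A \<noteq> 0 \<or> B \<noteq> 0" using AB1 A B by auto
    show "Polynomial.degree A \<le> (\<Sum>j\<in>J. e j)"
    proof (cases "A = 0")
      case False
      then have "fls_subdegree (peval ?\<xi> A) \<ge> - 2 * int M"
        using comp'(1) infinite[OF S(1)] infinite[OF S(2)] A t by simp
      then show ?thesis using sub[OF False] unfolding M_def[symmetric] by linarith
    qed simp
    show "2 * Polynomial.degree B + Polynomial.degree g \<le> 2 * (\<Sum>j\<in>J. e j)" if "B \<noteq> 0"
    proof -
      have "fls_subdegree (peval ?\<xi> B * S) \<ge> - 2 * int M"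
        using comp'(2) infinite[OF S(1)] infinite[OF S(2)] B t that S(3) by simp
      then have "- int (2 * Polynomial.degree B) + fls_subdegree S \<ge> - 2 * int M"
        using sub[OF that] S(3) by simp
      \<comment> \<open>Over infinity, with x = t^(-2), the series \<open>S\<close> has order minus
        the degree of g and \<open>B\<close> has order minus twice its degree.\<close>
      then show ?thesis using S(4) sg unfolding M_def[symmetric] by linarith
    qed
    fix j assume j: "j \<in> J"
    define y' where "y' = (if n j \<ge> 0 then y j else - y j)"
    have y': "d * y'\<^sup>2 = poly g (x j)" "y' \<noteq> 0" using xy[OF j] by (auto simp: y'_def)
    have "point_place (x j) y' \<phi> = int (e j)"
      using pos[OF j] neg[OF j] by (auto simp: y'_def e_def)
    then have "fls_subdegree (ceval (fls_const (x j) + fls_X) (point_sqrt (x j) y') \<phi>) = int (e j)"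
      using point_place_eq[OF \<phi>] by simp
    moreover have "fls_subdegree (peval (fls_const (x j) + fls_X) h) \<ge> int (e j)"
      using peval_subdegree_finite[of fls_X 1 h "x j"] h0 ordh[OF j] by simp
    ultimately have "int (2 * e j) \<le> fls_subdegree (ceval (fls_const (x j) + fls_X) (point_sqrt (x j) y') (A1, B1))"
      using sub1[OF laurent_point_X[OF y']] by simp
    then show "int (2 * e j) \<le> fls_subdegree (peval (fls_const (x j) + fls_X) A
       + peval (fls_const (x j) + fls_X) B * point_sqrt (x j) (if n j \<ge> 0 then y j else - y j))"
      using transcendental_X by (simp add: ceval_def A B y'_def)
  qed
qed

end

section \<open>Independence in a divisor class group\<close>

lemma (in comm_group) finprod_subgroup_eq:
  assumes "subgroup H G" "finite I" "f \<in> I \<rightarrow> H"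
  shows "finprod (G\<lparr>carrier := H\<rparr>) f I = finprod G f I"
proof -
  interpret H: comm_group "G\<lparr>carrier := H\<rparr>"
    by (rule group.group_comm_groupI[OF subgroup.subgroup_is_group[OF assms(1) is_group]])
      (use subgroup.subset[OF assms(1)] in \<open>auto simp: subset_iff m_comm\<close>)
  have sub: "H \<subseteq> carrier G" using assms(1) by (rule subgroup.subset)
  show ?thesis
    using assms(2,3)
  proof (induction I rule: finite_induct)
    case (insert i I)
    then have "f \<in> I \<rightarrow> carrier G" "f i \<in> carrier G" using sub by auto
    then show ?case using insert by simp
  qed simp
qed

lemma group_hom_finprod:
  assumes "comm_group A" "comm_group Q" "group_hom A Q h" "finite I" "f \<in> I \<rightarrow> carrier A"
  shows "h (finprod A f I) = finprod Q (\<lambda>i. h (f i)) I"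
proof -
  interpret A: comm_group A by fact
  interpret Q: comm_group Q by fact
  interpret h: group_hom A Q h by fact
  show ?thesis
    using assms(4,5)
  proof (induction I rule: finite_induct)
    case (insert i I)
    then have "f \<in> I \<rightarrow> carrier A" "f i \<in> carrier A" by auto
    then show ?case using insert by (simp add: Pi_iff)
  qed simp
qed

text \<open>Independence in the quotient is tested by membership in \<open>N\<close>, so no
  computation with cosets is left to the application. As \<open>int_independent\<close> speaks of a
  set and not of a family, the classes must also be distinct: a coincidence would be a relation with
  coefficients 1 and -1.\<close>

lemma rank_ge_quotient:
  fixes A :: "('a, 'b) monoid_scheme" and \<delta> :: "'i \<Rightarrow> 'a"
  assumes A: "comm_group A" and N: "subgroup N A" and L: "subgroup L A"
    and I: "finite I" and \<delta>: "\<And>i. i \<in> I \<Longrightarrow> \<delta> i \<in> L"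
    and indep: "\<And>n :: 'i \<Rightarrow> int. finprod A (\<lambda>i. \<delta> i [^]\<^bsub>A\<^esub> n i) I \<in> N \<Longrightarrow> (\<forall>i\<in>I. n i = 0)"
  shows "enat (card I) \<le> abelian_group_rank ((A Mod N)\<lparr>carrier := (\<lambda>c. N #>\<^bsub>A\<^esub> c) ` L\<rparr>)"
proof -
  interpret A: comm_group A by fact
  interpret N: normal N A using A.subgroup_imp_normal[OF N] .
  define Q where "Q = A Mod N"
  define \<rho> where "\<rho> = (\<lambda>c. N #>\<^bsub>A\<^esub> c)"
  interpret Q: comm_group Q unfolding Q_def by (rule A.abelian_FactGroup[OF N])
  interpret \<rho>: group_hom A Q \<rho>
    unfolding group_hom_def group_hom_axioms_def Q_def \<rho>_def
    using A.is_group N.factorgroup_is_group N.r_coset_hom_Mod by simp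
  have Q1: "\<one>\<^bsub>Q\<^esub> = N" by (simp add: Q_def FactGroup_def)
  have \<rho>1: "c \<in> N" if "c \<in> carrier A" "\<rho> c = \<one>\<^bsub>Q\<^esub>" for c
    using that Q1 A.rcos_self[OF that(1) N] by (simp add: \<rho>_def)
  define H where "H = \<rho> ` L"
  have H: "subgroup H Q" unfolding H_def by (rule \<rho>.subgroup_img_is_subgroup[OF L])
  have \<delta>A: "\<delta> i \<in> carrier A" if "i \<in> I" for i using \<delta>[OF that] subgroup.subset[OF L] by blast
  have key: "\<forall>i\<in>I. n i = 0" if "finprod Q (\<lambda>i. \<rho> (\<delta> i) [^]\<^bsub>Q\<^esub> n i) I = \<one>\<^bsub>Q\<^esub>" for n :: "'i \<Rightarrow> int"
  proof -
    have "finprod Q (\<lambda>i. \<rho> (\<delta> i) [^]\<^bsub>Q\<^esub> n i) I = finprod Q (\<lambda>i. \<rho> (\<delta> i [^]\<^bsub>A\<^esub> n i)) I"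
      by (rule Q.finprod_cong') (use \<delta>A in \<open>auto simp: \<rho>.hom_int_pow\<close>)
    also have "\<dots> = \<rho> (finprod A (\<lambda>i. \<delta> i [^]\<^bsub>A\<^esub> n i) I)"
      by (rule group_hom_finprod[symmetric, OF A Q.comm_group_axioms \<rho>.group_hom_axioms I])
        (use \<delta>A in auto)
    finally have "\<rho> (finprod A (\<lambda>i. \<delta> i [^]\<^bsub>A\<^esub> n i) I) = \<one>\<^bsub>Q\<^esub>" using that by simp
    then have "finprod A (\<lambda>i. \<delta> i [^]\<^bsub>A\<^esub> n i) I \<in> N"
      using \<delta>A by (intro \<rho>1 A.finprod_closed) auto
    then show ?thesis by (rule indep)
  qed
  have inj: "inj_on (\<lambda>i. \<rho> (\<delta> i)) I"
  proof (rule inj_onI, rule ccontr)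
    fix i j assume ij: "i \<in> I" "j \<in> I" "\<rho> (\<delta> i) = \<rho> (\<delta> j)" "i \<noteq> j"
    define n :: "'i \<Rightarrow> int" where "n = (\<lambda>k. if k = i then 1 else if k = j then -1 else 0)"
    define f where "f = (\<lambda>k. \<rho> (\<delta> k) [^]\<^bsub>Q\<^esub> n k)"
    have f: "f k \<in> carrier Q" if "k \<in> I" for k using \<delta>A[OF that] by (simp add: f_def)
    define R where "R = I - {i} - {j}"
    have IR: "I = insert i (insert j R)" "finite R" "i \<notin> insert j R" "j \<notin> R"
      using ij I by (auto simp: R_def)
    have fR: "f \<in> R \<rightarrow> carrier Q" "f \<in> insert j R \<rightarrow> carrier Q" using f ij by (auto simp: R_def)
    have "finprod Q f R = \<one>\<^bsub>Q\<^esub>"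
      by (rule Q.finprod_one_eqI) (use ij in \<open>auto simp: f_def n_def R_def\<close>)
    then have "finprod Q f I = f i \<otimes>\<^bsub>Q\<^esub> f j"
      unfolding IR(1) using IR(2-4) fR f[OF ij(1)] f[OF ij(2)] by simp
    also have "\<dots> = \<one>\<^bsub>Q\<^esub>"
      using ij \<delta>A[OF ij(2)] by (simp add: f_def n_def Q.int_pow_neg Q.int_pow_1)
    finally have "\<forall>k\<in>I. n k = 0" unfolding f_def by (rule key)
    then show False using ij by (auto simp: n_def)
  qed
  define S where "S = (\<lambda>i. \<rho> (\<delta> i)) ` I"
  have SH: "S \<subseteq> H" using \<delta> by (auto simp: S_def H_def)
  have "int_independent (Q\<lparr>carrier := H\<rparr>) S"
    unfolding int_independent_def
  proof (intro conjI allI impI)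
    show "finite S" using I by (simp add: S_def)
    show "S \<subseteq> carrier (Q\<lparr>carrier := H\<rparr>)" using SH by simp
    fix n :: "_ \<Rightarrow> int"
    assume *: "finprod (Q\<lparr>carrier := H\<rparr>) (\<lambda>s. s [^]\<^bsub>Q\<lparr>carrier := H\<rparr>\<^esub> n s) S = \<one>\<^bsub>Q\<lparr>carrier := H\<rparr>\<^esub>"
    interpret QH: group "Q\<lparr>carrier := H\<rparr>"
      by (rule subgroup.subgroup_is_group[OF H Q.is_group])
    have pH: "s [^]\<^bsub>Q\<lparr>carrier := H\<rparr>\<^esub> n s \<in> H" if "s \<in> S" for s
      using QH.int_pow_closed[of s] that SH by auto
    have "finprod (Q\<lparr>carrier := H\<rparr>) (\<lambda>s. s [^]\<^bsub>Q\<lparr>carrier := H\<rparr>\<^esub> n s) S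
        = finprod Q (\<lambda>s. s [^]\<^bsub>Q\<lparr>carrier := H\<rparr>\<^esub> n s) S"
      by (rule Q.finprod_subgroup_eq[OF H]) (use I pH in \<open>auto simp: S_def\<close>)
    also have "\<dots> = finprod Q (\<lambda>s. s [^]\<^bsub>Q\<^esub> n s) S"
      by (rule Q.finprod_cong')
        (use SH Q.int_pow_consistent[OF H] subgroup.subset[OF H] in \<open>auto intro!: Q.int_pow_closed\<close>)
    also have "\<dots> = finprod Q (\<lambda>i. \<rho> (\<delta> i) [^]\<^bsub>Q\<^esub> n (\<rho> (\<delta> i))) I"
      unfolding S_def by (rule Q.finprod_reindex[OF _ inj]) (use \<delta>A in auto)
    finally have "finprod Q (\<lambda>i. \<rho> (\<delta> i) [^]\<^bsub>Q\<^esub> n (\<rho> (\<delta> i))) I = \<one>\<^bsub>Q\<^esub>"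
      using * by simp
    then have "\<forall>i\<in>I. n (\<rho> (\<delta> i)) = 0" by (rule key)
    then show "\<forall>s\<in>S. n s = 0" by (auto simp: S_def)
  qed
  moreover have "card S = card I" using inj by (simp add: S_def card_image)
  ultimately show ?thesis
    unfolding abelian_group_rank_def Q_def[symmetric] \<rho>_def[symmetric] H_def[symmetric]
    by (metis (mono_tags, lifting) SUP_upper mem_Collect_eq)
qed

lemma finprod_free_Abelian_group:
  assumes "finite I" "\<And>i. i \<in> I \<Longrightarrow> Poly_Mapping.keys (f i) \<subseteq> S"
  shows "finprod (free_Abelian_group S) f I = sum f I"
proof -
  interpret comm_group "free_Abelian_group S" by (rule abelian_free_Abelian_group)
  show ?thesis
    using assms
  proof (induction I rule: finite_induct)
    case (insert i I)
    have "f \<in> I \<rightarrow> carrier (free_Abelian_group S)" "f i \<in> carrier (free_Abelian_group S)"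
      using insert.prems by auto
    then show ?case using insert by simp
  qed simp
qed

section \<open>Degrees of divisors\<close>

lemma divisor_degree_superset:
  assumes "finite T" "Poly_Mapping.keys c \<subseteq> T"
  shows "divisor_degree c = (\<Sum>p\<in>T. Poly_Mapping.lookup c p)"
  unfolding divisor_degree_def
  by (rule sum.mono_neutral_left) (use assms in \<open>auto simp: in_keys_iff\<close>)

lemma divisor_degree_add: "divisor_degree (a + b) = divisor_degree a + divisor_degree b"
proof -
  let ?T = "Poly_Mapping.keys a \<union> Poly_Mapping.keys b"
  have "divisor_degree (a + b) = (\<Sum>p\<in>?T. Poly_Mapping.lookup (a + b) p)"
    by (rule divisor_degree_superset) (auto dest: subsetD[OF keys_add])
  also have "\<dots> = divisor_degree a + divisor_degree b"
    using divisor_degree_superset[of ?T a] divisor_degree_superset[of ?T b]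
    by (simp add: lookup_add sum.distrib)
  finally show ?thesis .
qed

lemma divisor_degree_0 [simp]: "divisor_degree 0 = 0"
  by (simp add: divisor_degree_def)

lemma divisor_degree_minus: "divisor_degree (- a) = - divisor_degree a"
  using divisor_degree_add[of a "- a"] by simp

lemma divisor_degree_frag_of [simp]: "divisor_degree (frag_of p) = 1"
  by (simp add: divisor_degree_def)

context hyperelliptic
begin

abbreviation "\<P> \<equiv> places \<F> curve_constants"
abbreviation "\<D> \<equiv> divisor_group \<F> curve_constants"
abbreviation "\<N> \<equiv> principal_divisors \<F> curve_constants"

section \<open>Principal divisors\<close>

lemma place_mult:
  "v \<in> \<P> \<Longrightarrow> \<phi> \<noteq> (0, 0) \<Longrightarrow> \<psi> \<noteq> (0, 0) \<Longrightarrow> v (\<phi> \<otimes>\<^bsub>\<F>\<^esub> \<psi>) = v \<phi> + v \<psi>"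
  unfolding places_def curve_field_simps(1,2) by blast

lemma place_one: "v \<in> \<P> \<Longrightarrow> v (1, 0) = 0"
  using place_mult[of v "(1, 0)" "(1, 0)"] by simp

lemma in_principal_iff:
  "c \<in> \<N> \<longleftrightarrow> Poly_Mapping.keys c \<subseteq> \<P> \<and> (\<exists>\<phi>. \<phi> \<noteq> (0, 0) \<and> (\<forall>v\<in>\<P>. Poly_Mapping.lookup c v = v \<phi>))"
  unfolding principal_divisors_def divisor_group_def curve_field_simps(1,2) by auto

lemma principal_subgroup: "subgroup \<N> \<D>"
proof (rule subgroup.intro)
  show "\<N> \<subseteq> carrier \<D>" by (auto simp: principal_divisors_def)
  show "\<one>\<^bsub>\<D>\<^esub> \<in> \<N>"
    unfolding in_principal_iff divisor_group_def
    using place_one by (intro conjI exI[of _ "(1, 0)"]) auto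
next
  fix a b assume "a \<in> \<N>" "b \<in> \<N>"
  then obtain \<phi> \<psi> where a: "Poly_Mapping.keys a \<subseteq> \<P>" "\<phi> \<noteq> (0, 0)" "\<forall>v\<in>\<P>. Poly_Mapping.lookup a v = v \<phi>"
    and b: "Poly_Mapping.keys b \<subseteq> \<P>" "\<psi> \<noteq> (0, 0)" "\<forall>v\<in>\<P>. Poly_Mapping.lookup b v = v \<psi>"
    unfolding in_principal_iff by blast
  have "\<forall>v\<in>\<P>. Poly_Mapping.lookup (a + b) v = v (\<phi> \<otimes>\<^bsub>\<F>\<^esub> \<psi>)"
    using a b place_mult by (simp add: lookup_add)
  moreover have "Poly_Mapping.keys (a + b) \<subseteq> \<P>" using a b keys_add[of a b] by blast
  ultimately have "a + b \<in> \<N>"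
    unfolding in_principal_iff using curve_field_mult_neq_0[OF a(2) b(2)] by blast
  then show "a \<otimes>\<^bsub>\<D>\<^esub> b \<in> \<N>" by (simp add: divisor_group_def)
next
  fix a assume "a \<in> \<N>"
  then obtain \<phi> where a: "Poly_Mapping.keys a \<subseteq> \<P>" "\<phi> \<noteq> (0, 0)" "\<forall>v\<in>\<P>. Poly_Mapping.lookup a v = v \<phi>"
    unfolding in_principal_iff by blast
  obtain \<psi> where \<psi>: "\<psi> \<noteq> (0, 0)" "\<phi> \<otimes>\<^bsub>\<F>\<^esub> \<psi> = (1, 0)" using curve_field_inverse[OF a(2)] .
  have "v \<psi> = - v \<phi>" if "v \<in> \<P>" for v
    using place_mult[OF that a(2) \<psi>(1)] place_one[OF that] \<psi>(2) by simp
  then have "\<forall>v\<in>\<P>. Poly_Mapping.lookup (- a) v = v \<psi>" using a by simp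
  then have "- a \<in> \<N>" unfolding in_principal_iff using \<psi>(1) a(1) keys_minus[of a] by metis
  then show "inv\<^bsub>\<D>\<^esub> a \<in> \<N>" using a(1) by (simp add: divisor_group_def)
qed

end

section \<open>The absolute Galois group acting on polynomials and rational functions\<close>

lemma absolute_galoisD:
  assumes "\<sigma> \<in> absolute_galois"
  shows "bij \<sigma>" "\<sigma> (x + y) = \<sigma> x + \<sigma> y" "\<sigma> (x * y) = \<sigma> x * \<sigma> y" "\<sigma> (to_ac c) = to_ac c"
    "\<sigma> 0 = 0" "\<sigma> z = 0 \<longleftrightarrow> z = 0"
proof -
  show *: "bij \<sigma>" "\<sigma> (x + y) = \<sigma> x + \<sigma> y" "\<sigma> (x * y) = \<sigma> x * \<sigma> y" "\<sigma> (to_ac c) = to_ac c" for x y c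
    using assms by (auto simp: absolute_galois_def)
  show 0: "\<sigma> 0 = 0" using *(4)[of 0] by simp
  show "\<sigma> z = 0 \<longleftrightarrow> z = 0" using *(1) 0 by (metis bij_pointE)
qed

lemma absolute_galois_inv:
  assumes "\<sigma> \<in> absolute_galois"
  shows "inv_into UNIV \<sigma> \<in> absolute_galois"
proof -
  let ?\<tau> = "inv_into UNIV \<sigma>"
  note D = absolute_galoisD[OF assms]
  have b: "\<sigma> (?\<tau> x) = x" "?\<tau> (\<sigma> x) = x" for x
    using D(1) by (simp_all add: bij_is_surj surj_f_inv_f bij_is_inj)
  have "?\<tau> (x + y) = ?\<tau> x + ?\<tau> y" "?\<tau> (x * y) = ?\<tau> x * ?\<tau> y" for x y
    by (metis b D(2)) (metis b D(3))
  moreover have "?\<tau> (to_ac c) = to_ac c" for c by (metis b D(4))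
  ultimately show ?thesis unfolding absolute_galois_def using D(1) by (auto intro: bij_imp_bij_inv)
qed

definition galois_fract :: "('k::field alg_closure \<Rightarrow> 'k alg_closure) \<Rightarrow> 'k alg_closure poly fract \<Rightarrow> 'k alg_closure poly fract" where
  "galois_fract \<sigma> = map_fract (map_poly \<sigma>)"

context
  fixes \<sigma> :: "'k::field alg_closure \<Rightarrow> 'k alg_closure"
  assumes \<sigma>: "\<sigma> \<in> absolute_galois"
begin

lemma galois_poly_mult: "map_poly \<sigma> (p * q) = map_poly \<sigma> p * map_poly \<sigma> q"
  by (rule map_poly_mult_hom) (auto simp: absolute_galoisD[OF \<sigma>])

lemma galois_poly_add: "map_poly \<sigma> (p + q) = map_poly \<sigma> p + map_poly \<sigma> q"
  by (rule map_poly_add_hom) (auto simp: absolute_galoisD[OF \<sigma>])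

lemma galois_poly_eq_0_iff: "map_poly \<sigma> p = 0 \<longleftrightarrow> p = 0"
  by (auto simp: poly_eq_iff coeff_map_poly absolute_galoisD[OF \<sigma>])

lemma galois_poly_ac_poly: "map_poly \<sigma> (ac_poly p) = ac_poly p"
  by (rule poly_eqI) (simp add: coeff_map_poly absolute_galoisD[OF \<sigma>])

lemma galois_fract_Fract: "b \<noteq> 0 \<Longrightarrow> galois_fract \<sigma> (Fract a b) = Fract (map_poly \<sigma> a) (map_poly \<sigma> b)"
  unfolding galois_fract_def
  by (rule map_fract_Fract) (auto simp: galois_poly_mult galois_poly_eq_0_iff)

lemma galois_fract_mult: "galois_fract \<sigma> (r * s) = galois_fract \<sigma> r * galois_fract \<sigma> s"
proof -
  obtain a b c e where "r = Fract a b" "b \<noteq> 0" "s = Fract c e" "e \<noteq> 0" by (metis Fract_cases)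
  then show ?thesis by (simp add: galois_fract_Fract galois_poly_mult)
qed

lemma galois_fract_add: "galois_fract \<sigma> (r + s) = galois_fract \<sigma> r + galois_fract \<sigma> s"
proof -
  obtain a b c e where "r = Fract a b" "b \<noteq> 0" "s = Fract c e" "e \<noteq> 0" by (metis Fract_cases)
  then show ?thesis by (simp add: galois_fract_Fract galois_poly_mult galois_poly_add galois_poly_eq_0_iff)
qed

lemma galois_fract_0: "galois_fract \<sigma> 0 = 0"
  using galois_fract_Fract[of 1 0] by (simp add: fract_collapse)

lemma galois_fract_const: "galois_fract \<sigma> (to_fract [:c:]) = to_fract [:\<sigma> c:]"
proof -
  have "\<sigma> 1 = 1" using absolute_galoisD(4)[OF \<sigma>, of 1] by simp
  then show ?thesis
    using galois_fract_Fract[of 1 "[:c:]"] absolute_galoisD(5)[OF \<sigma>] by (simp add: to_fract_def map_poly_pCons)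
qed

lemma galois_function_eq: "galois_function \<sigma> (A, B) = (galois_fract \<sigma> A, galois_fract \<sigma> B)"
  by (simp add: galois_function_def galois_fract_def)

end

lemma galois_fract_cancel:
  assumes "\<sigma> \<in> absolute_galois" "\<tau> \<in> absolute_galois" "\<And>x. \<sigma> (\<tau> x) = x"
  shows "galois_fract \<sigma> (galois_fract \<tau> r) = r"
proof -
  obtain a b where r: "r = Fract a b" "b \<noteq> 0" by (metis Fract_cases)
  have "map_poly \<sigma> (map_poly \<tau> p) = p" for p
    by (rule poly_eqI) (simp add: coeff_map_poly absolute_galoisD(5)[OF assms(1)] absolute_galoisD(5)[OF assms(2)] assms(3))
  then show ?thesis
    using r by (simp add: galois_fract_Fract assms galois_poly_eq_0_iff)
qed

lemma galois_function_cancel: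
  assumes "\<sigma> \<in> absolute_galois" "\<tau> \<in> absolute_galois" "\<And>x. \<sigma> (\<tau> x) = x"
  shows "galois_function \<sigma> (galois_function \<tau> \<phi>) = \<phi>"
  by (cases \<phi>) (simp add: galois_function_eq assms galois_fract_cancel[OF assms])

section \<open>Galois action\<close>

locale curve_over =
  fixes d :: "'k::field_char_0" and g :: "'k poly"
  assumes d_neq_0: "d \<noteq> 0" and bezout: "\<exists>u w. u * g + w * pderiv g = 1"
    and degree_ge_3: "Polynomial.degree g \<ge> 3"

lemma pderiv_ac_poly: "pderiv (ac_poly p) = ac_poly (pderiv p)"
  by (rule poly_eqI) (simp add: coeff_pderiv coeff_map_poly)

sublocale curve_over \<subseteq> hyperelliptic "to_ac d" "ac_poly g"
proof
  show "to_ac d \<noteq> 0" using d_neq_0 by simp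
  obtain u w where "u * g + w * pderiv g = 1" using bezout by blast
  then have "ac_poly u * ac_poly g + ac_poly w * pderiv (ac_poly g) = 1"
    by (metis ac_poly_1 ac_poly_add ac_poly_mult pderiv_ac_poly)
  then show "\<exists>u w. u * ac_poly g + w * pderiv (ac_poly g) = 1" by blast
  show "Polynomial.degree (ac_poly g) > 0" using degree_ge_3 by simp
qed

context curve_over
begin

context
  fixes \<sigma> :: "'k alg_closure \<Rightarrow> 'k alg_closure"
  assumes \<sigma>: "\<sigma> \<in> absolute_galois"
begin

lemma galois_rhs: "galois_fract \<sigma> rhs = rhs"
  using galois_fract_Fract[OF \<sigma>, of "[:to_ac d:]" "ac_poly g"] d absolute_galoisD(4,5)[OF \<sigma>]
  by (simp add: galois_poly_ac_poly[OF \<sigma>] map_poly_pCons)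

lemma galois_function_mult:
  "galois_function \<sigma> (\<phi> \<otimes>\<^bsub>\<F>\<^esub> \<psi>) = galois_function \<sigma> \<phi> \<otimes>\<^bsub>\<F>\<^esub> galois_function \<sigma> \<psi>"
  by (cases \<phi>; cases \<psi>)
    (simp add: galois_function_eq[OF \<sigma>] galois_fract_mult[OF \<sigma>] galois_fract_add[OF \<sigma>] galois_rhs)

lemma galois_function_add:
  "galois_function \<sigma> (\<phi> \<oplus>\<^bsub>\<F>\<^esub> \<psi>) = galois_function \<sigma> \<phi> \<oplus>\<^bsub>\<F>\<^esub> galois_function \<sigma> \<psi>"
  by (cases \<phi>; cases \<psi>) (simp add: galois_function_eq[OF \<sigma>] galois_fract_add[OF \<sigma>])

lemma galois_function_0: "galois_function \<sigma> (0, 0) = (0, 0)"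
  by (simp add: galois_function_eq[OF \<sigma>] galois_fract_0[OF \<sigma>])

lemma galois_inverse:
  "\<sigma> (inv_into UNIV \<sigma> x) = x" "inv_into UNIV \<sigma> (\<sigma> x) = x"
  using absolute_galoisD(1)[OF \<sigma>] by (simp_all add: bij_is_surj surj_f_inv_f bij_is_inj)

lemma galois_function_inverse:
  "galois_function \<sigma> (galois_function (inv_into UNIV \<sigma>) \<phi>) = \<phi>"
  "galois_function (inv_into UNIV \<sigma>) (galois_function \<sigma> \<phi>) = \<phi>"
  using galois_function_cancel[OF \<sigma> absolute_galois_inv[OF \<sigma>] galois_inverse(1)]
    galois_function_cancel[OF absolute_galois_inv[OF \<sigma>] \<sigma> galois_inverse(2)] by auto

lemma galois_place_apply:
  "\<phi> \<noteq> (0, 0) \<Longrightarrow> galois_place \<sigma> v \<phi> = v (galois_function (inv_into UNIV \<sigma>) \<phi>)"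
  by (simp add: galois_place_def)

end

lemma galois_function_neq_0:
  "\<sigma> \<in> absolute_galois \<Longrightarrow> \<phi> \<noteq> (0, 0) \<Longrightarrow> galois_function \<sigma> \<phi> \<noteq> (0, 0)"
  for \<sigma> :: "'k alg_closure \<Rightarrow> 'k alg_closure"
  using galois_function_inverse(2)[of \<sigma> \<phi>] galois_function_0[OF absolute_galois_inv[of \<sigma>]] by auto

lemma inv_inv_galois: "\<sigma> \<in> absolute_galois \<Longrightarrow> inv_into UNIV (inv_into UNIV \<sigma>) = \<sigma>"
  for \<sigma> :: "'k alg_closure \<Rightarrow> 'k alg_closure"
  using absolute_galoisD(1) inv_inv_eq by blast

section \<open>Galois action on places, divisors and divisor classes\<close>

lemma galois_place_in_places:
  assumes \<sigma>: "\<sigma> \<in> absolute_galois" and v: "v \<in> \<P>"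
  shows "galois_place \<sigma> v \<in> \<P>"
proof -
  let ?\<tau> = "inv_into UNIV \<sigma>"
  have \<tau>: "?\<tau> \<in> absolute_galois" using \<sigma> by (rule absolute_galois_inv)
  note app = galois_place_apply[OF \<sigma>, of _ v]
  note nz = galois_function_neq_0[OF \<tau>]
  have add: "min (v \<phi>) (v \<psi>) \<le> v (\<phi> \<oplus>\<^bsub>\<F>\<^esub> \<psi>)"
    if "\<phi> \<noteq> (0, 0)" "\<psi> \<noteq> (0, 0)" "\<phi> \<oplus>\<^bsub>\<F>\<^esub> \<psi> \<noteq> (0, 0)" for \<phi> \<psi>
    using v that unfolding places_def curve_field_simps(1,2) by blast
  have surj: "v ` (UNIV - {(0, 0)}) = UNIV" and const: "c \<in> curve_constants - {(0, 0)} \<Longrightarrow> v c = 0" for c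
    using v unfolding places_def curve_field_simps(1,2) by blast+
  show ?thesis
    unfolding places_def mem_Collect_eq curve_field_simps(1,2)
  proof (intro conjI ballI impI)
    show "galois_place \<sigma> v \<in> extensional (UNIV - {(0, 0)})" by (simp add: galois_place_def)
    show "galois_place \<sigma> v ` (UNIV - {(0, 0)}) = UNIV"
    proof (rule UNIV_eq_I[symmetric])
      fix n :: int
      obtain \<psi> where \<psi>: "\<psi> \<noteq> (0, 0)" "n = v \<psi>" using surj by (metis (no_types) DiffE UNIV_I imageE singletonI)
      have "galois_place \<sigma> v (galois_function \<sigma> \<psi>) = n"
        using app[OF galois_function_neq_0[OF \<sigma> \<psi>(1)]] galois_function_inverse(2)[OF \<sigma>] \<psi>(2) by simp
      then show "n \<in> galois_place \<sigma> v ` (UNIV - {(0, 0)})"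
        using galois_function_neq_0[OF \<sigma> \<psi>(1)] by (metis DiffI UNIV_I image_eqI singletonD)
    qed
  next
    fix \<phi> \<psi> :: "'k alg_closure poly fract \<times> 'k alg_closure poly fract"
    assume "\<phi> \<in> UNIV - {(0, 0)}" "\<psi> \<in> UNIV - {(0, 0)}"
    then have ne: "\<phi> \<noteq> (0, 0)" "\<psi> \<noteq> (0, 0)" by blast+
    show "galois_place \<sigma> v (\<phi> \<otimes>\<^bsub>\<F>\<^esub> \<psi>) = galois_place \<sigma> v \<phi> + galois_place \<sigma> v \<psi>"
      using app[OF ne(1)] app[OF ne(2)] app[OF curve_field_mult_neq_0[OF ne]]
        place_mult[OF v nz[OF ne(1)] nz[OF ne(2)]] galois_function_mult[OF \<tau>] by simp
    assume ne': "\<phi> \<oplus>\<^bsub>\<F>\<^esub> \<psi> \<noteq> (0, 0)"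
    show "min (galois_place \<sigma> v \<phi>) (galois_place \<sigma> v \<psi>) \<le> galois_place \<sigma> v (\<phi> \<oplus>\<^bsub>\<F>\<^esub> \<psi>)"
      using app[OF ne(1)] app[OF ne(2)] app[OF ne'] add[OF nz[OF ne(1)] nz[OF ne(2)]]
        nz[OF ne'] galois_function_add[OF \<tau>] by simp
  next
    fix c :: "'k alg_closure poly fract \<times> 'k alg_closure poly fract"
    assume c: "c \<in> curve_constants - {(0, 0)}"
    then obtain a where a: "c = (to_fract [:a:], 0)" by (auto simp: curve_constants_def)
    have "galois_function ?\<tau> c \<in> curve_constants"
      by (simp add: a galois_function_eq[OF \<tau>] galois_fract_const[OF \<tau>] galois_fract_0[OF \<tau>] curve_constants_def)
    then show "galois_place \<sigma> v c = 0"
      using app[of c] nz[of c] const c by (metis DiffE DiffI singletonD singletonI)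
  qed
qed

lemma galois_place_inverse:
  assumes \<sigma>: "\<sigma> \<in> absolute_galois" and v: "v \<in> \<P>"
  shows "galois_place \<sigma> (galois_place (inv_into UNIV \<sigma>) v) = v"
    "galois_place (inv_into UNIV \<sigma>) (galois_place \<sigma> v) = v"
proof -
  have ext: "v \<in> extensional (UNIV - {(0, 0)})"
    using v unfolding places_def curve_field_simps(1,2) by blast
  have *: "galois_place \<rho> (galois_place (inv_into UNIV \<rho>) v) = v" if \<rho>: "\<rho> \<in> absolute_galois" for \<rho>
  proof (rule extensionalityI[OF _ ext])
    show "galois_place \<rho> (galois_place (inv_into UNIV \<rho>) v) \<in> extensional (UNIV - {(0, 0)})"
      by (simp add: galois_place_def)
    fix \<phi> :: "'k alg_closure poly fract \<times> 'k alg_closure poly fract"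
    assume "\<phi> \<in> UNIV - {(0, 0)}"
    then have ne: "\<phi> \<noteq> (0, 0)" by blast
    let ?\<tau> = "inv_into UNIV \<rho>"
    have \<tau>: "?\<tau> \<in> absolute_galois" using \<rho> by (rule absolute_galois_inv)
    show "galois_place \<rho> (galois_place ?\<tau> v) \<phi> = v \<phi>"
      using galois_place_apply[OF \<rho> ne] galois_place_apply[OF \<tau> galois_function_neq_0[OF \<tau> ne], of v]
        inv_inv_galois[OF \<rho>] galois_function_inverse(1)[OF \<rho>] by simp
  qed
  show "galois_place \<sigma> (galois_place (inv_into UNIV \<sigma>) v) = v" using *[OF \<sigma>] .
  show "galois_place (inv_into UNIV \<sigma>) (galois_place \<sigma> v) = v"
    using *[OF absolute_galois_inv[OF \<sigma>]] inv_inv_galois[OF \<sigma>] by simp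
qed

lemma keys_galois_divisor:
  assumes "\<sigma> \<in> absolute_galois" "Poly_Mapping.keys c \<subseteq> \<P>"
  shows "Poly_Mapping.keys (galois_divisor \<sigma> c) \<subseteq> \<P>"
  using keys_frag_extend[of "\<lambda>v. frag_of (galois_place \<sigma> v)" c] galois_place_in_places[OF assms(1)] assms(2)
  unfolding galois_divisor_def by fastforce

lemma lookup_galois_divisor:
  assumes \<sigma>: "\<sigma> \<in> absolute_galois" and c: "Poly_Mapping.keys c \<subseteq> \<P>" and v: "v \<in> \<P>"
  shows "Poly_Mapping.lookup (galois_divisor \<sigma> c) v = Poly_Mapping.lookup c (galois_place (inv_into UNIV \<sigma>) v)"
  using c
proof (induction c rule: frag_induction)
  case zero
  show ?case by (simp add: galois_divisor_def)
next
  case (one w)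
  have "galois_place \<sigma> w = v \<longleftrightarrow> w = galois_place (inv_into UNIV \<sigma>) v"
    using galois_place_inverse[OF \<sigma> v] galois_place_inverse[OF \<sigma> one] by metis
  then show ?case by (auto simp: galois_divisor_def)
next
  case (diff a b)
  then show ?case by (simp add: galois_divisor_def frag_extend_diff lookup_minus)
qed

lemma galois_divisor_principal:
  assumes \<sigma>: "\<sigma> \<in> absolute_galois" and c: "c \<in> \<N>"
  shows "galois_divisor \<sigma> c \<in> \<N>"
proof -
  obtain \<phi> where k: "Poly_Mapping.keys c \<subseteq> \<P>" and \<phi>: "\<phi> \<noteq> (0, 0)" "\<forall>v\<in>\<P>. Poly_Mapping.lookup c v = v \<phi>"
    using c unfolding in_principal_iff by blast
  let ?\<tau> = "inv_into UNIV \<sigma>"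
  have \<tau>: "?\<tau> \<in> absolute_galois" using \<sigma> by (rule absolute_galois_inv)
  have "Poly_Mapping.lookup (galois_divisor \<sigma> c) v = v (galois_function \<sigma> \<phi>)" if v: "v \<in> \<P>" for v
    using lookup_galois_divisor[OF \<sigma> k v] galois_place_in_places[OF \<tau> v] \<phi>
      galois_place_apply[OF \<tau> \<phi>(1), of v] inv_inv_galois[OF \<sigma>] by simp
  then show ?thesis
    unfolding in_principal_iff using keys_galois_divisor[OF \<sigma> k] galois_function_neq_0[OF \<sigma> \<phi>(1)] by blast
qed

lemma galois_divisor_inverse:
  assumes \<sigma>: "\<sigma> \<in> absolute_galois" and c: "Poly_Mapping.keys c \<subseteq> \<P>"
  shows "galois_divisor \<sigma> (galois_divisor (inv_into UNIV \<sigma>) c) = c"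
proof (rule poly_mapping_eqI)
  fix v
  let ?\<tau> = "inv_into UNIV \<sigma>"
  have \<tau>: "?\<tau> \<in> absolute_galois" using \<sigma> by (rule absolute_galois_inv)
  have k: "Poly_Mapping.keys (galois_divisor ?\<tau> c) \<subseteq> \<P>" using keys_galois_divisor[OF \<tau> c] .
  show "Poly_Mapping.lookup (galois_divisor \<sigma> (galois_divisor ?\<tau> c)) v = Poly_Mapping.lookup c v"
  proof (cases "v \<in> \<P>")
    case True
    then show ?thesis
      using lookup_galois_divisor[OF \<sigma> k True] lookup_galois_divisor[OF \<tau> c galois_place_in_places[OF \<tau> True]]
        inv_inv_galois[OF \<sigma>] galois_place_inverse(1)[OF \<sigma> True] by simp
  next
    case False
    then have "v \<notin> Poly_Mapping.keys (galois_divisor \<sigma> (galois_divisor ?\<tau> c))" "v \<notin> Poly_Mapping.keys c"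
      using keys_galois_divisor[OF \<sigma> k] c by blast+
    then show ?thesis by (simp add: in_keys_iff)
  qed
qed

text \<open>Principal divisors are preserved by \<sigma> and by its inverse, hence mapped onto
  themselves; the action on a class can be computed on any representative.\<close>

lemma galois_coset:
  assumes \<sigma>: "\<sigma> \<in> absolute_galois" and c: "c \<in> carrier \<D>"
  shows "galois_divisor \<sigma> ` (\<N> #>\<^bsub>\<D>\<^esub> c) = \<N> #>\<^bsub>\<D>\<^esub> galois_divisor \<sigma> c"
proof -
  have coset: "\<N> #>\<^bsub>\<D>\<^esub> c = (\<lambda>p. p + c) ` \<N>" for c
    by (auto simp: r_coset_def divisor_group_def)
  have eq: "\<N> = galois_divisor \<sigma> ` \<N>"
  proof
    show "galois_divisor \<sigma> ` \<N> \<subseteq> \<N>" using galois_divisor_principal[OF \<sigma>] by blast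
    show "\<N> \<subseteq> galois_divisor \<sigma> ` \<N>"
    proof
      fix p assume p: "p \<in> \<N>"
      then have "Poly_Mapping.keys p \<subseteq> \<P>" by (simp add: in_principal_iff)
      then have "p = galois_divisor \<sigma> (galois_divisor (inv_into UNIV \<sigma>) p)"
        using galois_divisor_inverse[OF \<sigma>] by simp
      then show "p \<in> galois_divisor \<sigma> ` \<N>"
        using galois_divisor_principal[OF absolute_galois_inv[OF \<sigma>] p] by blast
    qed
  qed
  have "galois_divisor \<sigma> ` (\<lambda>p. p + c) ` \<N> = (\<lambda>p. p + galois_divisor \<sigma> c) ` galois_divisor \<sigma> ` \<N>"
    by (simp add: image_image galois_divisor_def frag_extend_add)
  then show ?thesis unfolding coset eq[symmetric] .
qed

text \<open>Rational only up to principal divisors: this is the full preimage of the Mordell-Weil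
  group among the divisors of degree zero, which presents that group in the form
  \<open>rank_ge_quotient\<close> asks for.\<close>

definition rational_divisors :: "(('k alg_closure poly fract \<times> 'k alg_closure poly fract \<Rightarrow> int) \<Rightarrow>\<^sub>0 int) set" where
  "rational_divisors = {c \<in> carrier \<D>. divisor_degree c = 0 \<and>
     (\<forall>\<sigma>\<in>absolute_galois. \<N> #>\<^bsub>\<D>\<^esub> galois_divisor \<sigma> c = \<N> #>\<^bsub>\<D>\<^esub> c)}"

lemma divisor_comm_group: "comm_group \<D>"
  unfolding divisor_group_def by (rule abelian_free_Abelian_group)

lemma galois_divisor_closed:
  "\<sigma> \<in> absolute_galois \<Longrightarrow> c \<in> carrier \<D> \<Longrightarrow> galois_divisor \<sigma> c \<in> carrier \<D>"
  using keys_galois_divisor by (simp add: divisor_group_def)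

lemma rational_divisors_subgroup: "subgroup rational_divisors \<D>"
proof -
  interpret D: comm_group \<D> by (rule divisor_comm_group)
  interpret N: normal \<N> \<D> using D.subgroup_imp_normal[OF principal_subgroup] .
  show ?thesis
  proof (rule subgroup.intro)
    show "rational_divisors \<subseteq> carrier \<D>" by (auto simp: rational_divisors_def)
    show "\<one>\<^bsub>\<D>\<^esub> \<in> rational_divisors"
      by (simp add: rational_divisors_def divisor_group_def galois_divisor_def)
  next
    fix a b assume ab: "a \<in> rational_divisors" "b \<in> rational_divisors"
    then have car: "a \<in> carrier \<D>" "b \<in> carrier \<D>" by (auto simp: rational_divisors_def)
    have "\<N> #>\<^bsub>\<D>\<^esub> galois_divisor \<sigma> (a \<otimes>\<^bsub>\<D>\<^esub> b) = \<N> #>\<^bsub>\<D>\<^esub> (a \<otimes>\<^bsub>\<D>\<^esub> b)" if \<sigma>: "\<sigma> \<in> absolute_galois" for \<sigma>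
    proof -
      have "galois_divisor \<sigma> (a \<otimes>\<^bsub>\<D>\<^esub> b) = galois_divisor \<sigma> a \<otimes>\<^bsub>\<D>\<^esub> galois_divisor \<sigma> b"
        by (simp add: divisor_group_def galois_divisor_def frag_extend_add)
      then have "\<N> #>\<^bsub>\<D>\<^esub> galois_divisor \<sigma> (a \<otimes>\<^bsub>\<D>\<^esub> b)
          = (\<N> #>\<^bsub>\<D>\<^esub> galois_divisor \<sigma> a) <#>\<^bsub>\<D>\<^esub> (\<N> #>\<^bsub>\<D>\<^esub> galois_divisor \<sigma> b)"
        using N.rcos_sum galois_divisor_closed[OF \<sigma>] car by simp
      also have "\<dots> = (\<N> #>\<^bsub>\<D>\<^esub> a) <#>\<^bsub>\<D>\<^esub> (\<N> #>\<^bsub>\<D>\<^esub> b)"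
        using ab \<sigma> by (simp add: rational_divisors_def)
      also have "\<dots> = \<N> #>\<^bsub>\<D>\<^esub> (a \<otimes>\<^bsub>\<D>\<^esub> b)" using N.rcos_sum car by simp
      finally show ?thesis .
    qed
    moreover have "divisor_degree (a \<otimes>\<^bsub>\<D>\<^esub> b) = 0"
      using ab by (simp add: rational_divisors_def divisor_group_def divisor_degree_add)
    ultimately show "a \<otimes>\<^bsub>\<D>\<^esub> b \<in> rational_divisors" using car by (simp add: rational_divisors_def)
  next
    fix a assume a: "a \<in> rational_divisors"
    then have car: "a \<in> carrier \<D>" by (auto simp: rational_divisors_def)
    have inv: "inv\<^bsub>\<D>\<^esub> c = - c" if "c \<in> carrier \<D>" for c using that by (simp add: divisor_group_def)
    have "\<N> #>\<^bsub>\<D>\<^esub> galois_divisor \<sigma> (inv\<^bsub>\<D>\<^esub> a) = \<N> #>\<^bsub>\<D>\<^esub> (inv\<^bsub>\<D>\<^esub> a)" if \<sigma>: "\<sigma> \<in> absolute_galois" for \<sigma>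
    proof -
      have "galois_divisor \<sigma> (inv\<^bsub>\<D>\<^esub> a) = inv\<^bsub>\<D>\<^esub> (galois_divisor \<sigma> a)"
        using inv[OF car] inv[OF galois_divisor_closed[OF \<sigma> car]] by (simp add: galois_divisor_def frag_extend_minus)
      then have "\<N> #>\<^bsub>\<D>\<^esub> galois_divisor \<sigma> (inv\<^bsub>\<D>\<^esub> a) = set_inv\<^bsub>\<D>\<^esub> (\<N> #>\<^bsub>\<D>\<^esub> galois_divisor \<sigma> a)"
        using N.rcos_inv galois_divisor_closed[OF \<sigma> car] by simp
      also have "\<dots> = set_inv\<^bsub>\<D>\<^esub> (\<N> #>\<^bsub>\<D>\<^esub> a)" using a \<sigma> by (simp add: rational_divisors_def)
      also have "\<dots> = \<N> #>\<^bsub>\<D>\<^esub> (inv\<^bsub>\<D>\<^esub> a)" using N.rcos_inv car by simp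
      finally show ?thesis .
    qed
    moreover have "divisor_degree (inv\<^bsub>\<D>\<^esub> a) = 0"
      using a inv[OF car] by (simp add: rational_divisors_def divisor_degree_minus)
    ultimately show "inv\<^bsub>\<D>\<^esub> a \<in> rational_divisors" using car by (simp add: rational_divisors_def)
  qed
qed

lemma mordell_weil_group_eq:
  "mordell_weil_group d g = (\<D> Mod \<N>)\<lparr>carrier := (\<lambda>c. \<N> #>\<^bsub>\<D>\<^esub> c) ` rational_divisors\<rparr>"
proof -
  have "{\<xi> \<in> {\<N> #>\<^bsub>\<D>\<^esub> c |c. c \<in> carrier \<D> \<and> divisor_degree c = 0}.
       \<forall>\<sigma>\<in>absolute_galois. galois_divisor \<sigma> ` \<xi> = \<xi>} = (\<lambda>c. \<N> #>\<^bsub>\<D>\<^esub> c) ` rational_divisors"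
    (is "?L = ?R")
  proof (rule Set.set_eqI)
    fix \<xi>
    have "\<xi> \<in> ?L \<longleftrightarrow> (\<exists>c. c \<in> carrier \<D> \<and> divisor_degree c = 0 \<and> \<xi> = \<N> #>\<^bsub>\<D>\<^esub> c \<and>
        (\<forall>\<sigma>\<in>absolute_galois. galois_divisor \<sigma> ` (\<N> #>\<^bsub>\<D>\<^esub> c) = \<N> #>\<^bsub>\<D>\<^esub> c))" by blast
    also have "\<dots> \<longleftrightarrow> (\<exists>c. c \<in> carrier \<D> \<and> divisor_degree c = 0 \<and> \<xi> = \<N> #>\<^bsub>\<D>\<^esub> c \<and>
        (\<forall>\<sigma>\<in>absolute_galois. \<N> #>\<^bsub>\<D>\<^esub> galois_divisor \<sigma> c = \<N> #>\<^bsub>\<D>\<^esub> c))"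
      by (rule ex_cong1, intro conj_cong refl ball_cong) (simp only: galois_coset)
    also have "\<dots> \<longleftrightarrow> \<xi> \<in> ?R" unfolding rational_divisors_def by blast
    finally show "\<xi> \<in> ?L \<longleftrightarrow> \<xi> \<in> ?R" .
  qed
  then show ?thesis unfolding mordell_weil_group_def Pic0_def Pic_def Let_def by simp
qed

text \<open>For a rational point \<open>Hensel_sqrt\<close> provides \<open>T\<close> over the base
  field, so that divisibility of A + B T by a power of X - x survives any automorphism of the
  coefficients. Orders therefore cannot drop under an automorphism; applying this to the inverse too
  gives equality.\<close>

lemma galois_point_place:
  assumes \<sigma>: "\<sigma> \<in> absolute_galois" and xy: "d * y\<^sup>2 = poly g x" "y \<noteq> 0"
  shows "galois_place \<sigma> (point_place (to_ac x) (to_ac y)) = point_place (to_ac x) (to_ac y)"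
proof (rule extensionalityI)
  show "galois_place \<sigma> (point_place (to_ac x) (to_ac y)) \<in> extensional (UNIV - {(0, 0)})"
    by (simp add: galois_place_def)
  show "point_place (to_ac x) (to_ac y) \<in> extensional (UNIV - {(0, 0)})"
    by (simp add: point_place_def cval_def)
  fix \<phi> :: "'k alg_closure poly fract \<times> 'k alg_closure poly fract"
  assume "\<phi> \<in> UNIV - {(0, 0)}"
  then have ne: "\<phi> \<noteq> (0, 0)" by blast
  have xy': "to_ac d * (to_ac y)\<^sup>2 = poly (ac_poly g) (to_ac x)" "to_ac y \<noteq> 0"
    using xy by (auto simp flip: to_ac_mult to_ac_power)
  let ?\<xi> = "fls_const (to_ac x) + fls_X" and ?S = "point_sqrt (to_ac x) (to_ac y)"
  define w where "w = (\<lambda>A B. fls_subdegree (peval ?\<xi> A + peval ?\<xi> B * ?S))"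
  have w_ge: "w A B \<ge> 0" for A B
    unfolding w_def using point_sqrt(3)[OF xy']
    by (intro fls_subdegree_nonneg_add fls_subdegree_nonneg_mult peval_subdegree_nonneg) auto
  have le: "w A B \<le> w (map_poly \<tau> A) (map_poly \<tau> B)"
    if \<tau>: "\<tau> \<in> absolute_galois" and AB: "A \<noteq> 0 \<or> B \<noteq> 0" for \<tau> :: "'k alg_closure \<Rightarrow> 'k alg_closure" and A B
  proof -
    define n where "n = nat (w A B)"
    have n: "int n = w A B" using w_ge by (simp add: n_def)
    have "y\<^sup>2 = poly (Polynomial.smult (1 / d) g) x" using xy d_neq_0 by (simp add: field_simps flip: xy(1))
    then obtain T where T: "poly T x = y" "[:-x, 1:] ^ n dvd T\<^sup>2 - Polynomial.smult (1 / d) g"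
      using Hensel_sqrt xy(2) by blast
    have "[:-x, 1:] ^ n dvd [:d:] * (T\<^sup>2 - Polynomial.smult (1 / d) g)" using T(2) by (rule dvd_mult)
    also have "[:d:] * (T\<^sup>2 - Polynomial.smult (1 / d) g) = [:d:] * T\<^sup>2 - g"
      using d_neq_0 by (simp add: smult_diff_right)
    finally obtain E where E: "[:d:] * T\<^sup>2 - g = [:-x, 1:] ^ n * E" by (elim dvdE)
    have "ac_poly ([:d:] * T\<^sup>2 - g) = ac_poly ([:-x, 1:] ^ n * E)" by (rule arg_cong[OF E])
    then have T': "[:- to_ac x, 1:] ^ n dvd [:to_ac d:] * (ac_poly T)\<^sup>2 - ac_poly g"
      unfolding ac_poly_mult ac_poly_diff ac_poly_power ac_poly_linear by (simp add: map_poly_pCons)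
    have T0: "poly (ac_poly T) (to_ac x) = to_ac y" using T(1) by simp
    note iff = subdegree_ge_iff_dvd[OF xy' T0 T']
    have "[:- to_ac x, 1:] ^ n dvd A + B * ac_poly T" using iff[OF AB] n by (simp add: w_def)
    then obtain C where C: "A + B * ac_poly T = [:- to_ac x, 1:] ^ n * C" by (elim dvdE)
    have q: "map_poly \<tau> ([:- to_ac x, 1:] ^ n) = [:- to_ac x, 1:] ^ n"
      using galois_poly_ac_poly[OF \<tau>, of "[:- x, 1:] ^ n"] by (simp only: ac_poly_power ac_poly_linear)
    have "map_poly \<tau> (A + B * ac_poly T) = map_poly \<tau> ([:- to_ac x, 1:] ^ n * C)" by (simp only: C)
    then have "map_poly \<tau> A + map_poly \<tau> B * ac_poly T = [:- to_ac x, 1:] ^ n * map_poly \<tau> C"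
      unfolding galois_poly_add[OF \<tau>] galois_poly_mult[OF \<tau>] galois_poly_ac_poly[OF \<tau>] q .
    then have "[:- to_ac x, 1:] ^ n dvd map_poly \<tau> A + map_poly \<tau> B * ac_poly T" by simp
    moreover have "map_poly \<tau> A \<noteq> 0 \<or> map_poly \<tau> B \<noteq> 0" using AB galois_poly_eq_0_iff[OF \<tau>] by blast
    ultimately have "int n \<le> w (map_poly \<tau> A) (map_poly \<tau> B)" using iff by (simp add: w_def)
    then show ?thesis using n by simp
  qed
  let ?\<tau> = "inv_into UNIV \<sigma>"
  have \<tau>: "?\<tau> \<in> absolute_galois" using \<sigma> by (rule absolute_galois_inv)
  have eq: "w (map_poly ?\<tau> A) (map_poly ?\<tau> B) = w A B" if AB: "A \<noteq> 0 \<or> B \<noteq> 0" for A B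
  proof (rule antisym)
    have cancel: "map_poly \<sigma> (map_poly ?\<tau> p) = p" for p
      by (rule poly_eqI) (simp add: coeff_map_poly absolute_galoisD(5)[OF \<sigma>] absolute_galoisD(5)[OF \<tau>] galois_inverse[OF \<sigma>])
    have "map_poly ?\<tau> A \<noteq> 0 \<or> map_poly ?\<tau> B \<noteq> 0" using AB galois_poly_eq_0_iff[OF \<tau>] by blast
    from le[OF \<sigma> this] show "w (map_poly ?\<tau> A) (map_poly ?\<tau> B) \<le> w A B" unfolding cancel .
    show "w A B \<le> w (map_poly ?\<tau> A) (map_poly ?\<tau> B)" using le[OF \<tau> AB] .
  qed
  have pp: "point_place (to_ac x) (to_ac y) (Fract a c, Fract b c) = w a b - w c 0"
    if c: "c \<noteq> 0" and ab: "a \<noteq> 0 \<or> b \<noteq> 0" for a b c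
  proof -
    have ne: "(Fract a c, Fract b c) \<noteq> (0, 0)"
      using ab c unfolding Zero_fract_def by (auto simp: eq_fract)
    have c0: "peval ?\<xi> c \<noteq> 0" using transcendental_X c by (simp add: transcendental_def)
    have "ceval ?\<xi> ?S (Fract a c, Fract b c) = (peval ?\<xi> a + peval ?\<xi> b * ?S) / peval ?\<xi> c"
      using c by (simp add: ceval_def reval_Fract transcendental_X add_divide_distrib)
    moreover have "peval ?\<xi> a + peval ?\<xi> b * ?S \<noteq> 0"
      using ceval_neq_0[OF laurent_point_X[OF xy'], of "(to_fract a, to_fract b)"] ab
      by (simp add: ceval_def transcendental_X)
    ultimately show ?thesis
      using c0 by (simp add: point_place_eq[OF ne] fls_divide_subdegree w_def)
  qed
  obtain a b c where abc: "c \<noteq> 0" "fst \<phi> = Fract a c" "snd \<phi> = Fract b c" by (rule common_denominator)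
  then have \<phi>: "\<phi> = (Fract a c, Fract b c)" by (metis prod.collapse)
  have ab: "a \<noteq> 0 \<or> b \<noteq> 0" using ne unfolding \<phi> by (auto simp: fract_collapse)
  have "galois_place \<sigma> (point_place (to_ac x) (to_ac y)) \<phi>
     = point_place (to_ac x) (to_ac y) (Fract (map_poly ?\<tau> a) (map_poly ?\<tau> c), Fract (map_poly ?\<tau> b) (map_poly ?\<tau> c))"
    using galois_place_apply[OF \<sigma> ne] abc(1) unfolding \<phi>
    by (simp add: galois_function_eq[OF \<tau>] galois_fract_Fract[OF \<tau>])
  also have "\<dots> = w (map_poly ?\<tau> a) (map_poly ?\<tau> b) - w (map_poly ?\<tau> c) (map_poly ?\<tau> 0)"
    using pp abc(1) ab galois_poly_eq_0_iff[OF \<tau>] by simp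
  also have "\<dots> = w a b - w c 0" using eq[OF ab] eq[of c 0] abc(1) by simp
  also have "\<dots> = point_place (to_ac x) (to_ac y) \<phi>" using pp[OF abc(1) ab] \<phi> by simp
  finally show "galois_place \<sigma> (point_place (to_ac x) (to_ac y)) \<phi> = point_place (to_ac x) (to_ac y) \<phi>" .
qed

end

section \<open>The differential criterion for the rank\<close>

context curve_over
begin

lemma poly_nonsquare_over:
  fixes A B :: "'k poly"
  assumes "A\<^sup>2 = Polynomial.smult (1 / d) g * B\<^sup>2"
  shows "B = 0"
proof -
  have "[:d:] * A\<^sup>2 = B\<^sup>2 * g" unfolding assms using d_neq_0 by (simp add: mult.commute)
  then have "ac_poly ([:d:] * A\<^sup>2) = ac_poly (B\<^sup>2 * g)" by (rule arg_cong)
  then have "[:to_ac d:] * (ac_poly A)\<^sup>2 = (ac_poly B)\<^sup>2 * ac_poly g"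
    unfolding ac_poly_mult ac_poly_power by (simp add: map_poly_pCons)
  then show ?thesis using poly_nonsquare[of "ac_poly A" "ac_poly B"] by simp
qed

text \<open>The difference with the conjugate point has degree zero without recourse to a rational
  base point, which the curve may lack when g has even degree.\<close>

definition point_divisor :: "'k \<Rightarrow> 'k \<Rightarrow> ('k alg_closure poly fract \<times> 'k alg_closure poly fract \<Rightarrow> int) \<Rightarrow>\<^sub>0 int" where
  "point_divisor x y = frag_of (point_place (to_ac x) (to_ac y)) - frag_of (point_place (to_ac x) (to_ac (- y)))"

lemma on_curve_ac:
  assumes "d * y\<^sup>2 = poly g x" "y \<noteq> 0"
  shows "to_ac d * (to_ac y)\<^sup>2 = poly (ac_poly g) (to_ac x)" "to_ac y \<noteq> 0"
  using assms by (auto simp flip: to_ac_mult to_ac_power)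

lemma point_divisor_rational:
  assumes xy: "d * y\<^sup>2 = poly g x" "y \<noteq> 0"
  shows "point_divisor x y \<in> rational_divisors"
proof -
  have xy': "d * (- y)\<^sup>2 = poly g x" "- y \<noteq> 0" using xy by auto
  have "point_place (to_ac x) (to_ac y) \<in> \<P>" "point_place (to_ac x) (to_ac (- y)) \<in> \<P>"
    using point_place_in_places[OF on_curve_ac[OF xy]] point_place_in_places[OF on_curve_ac[OF xy']] by auto
  then have "Poly_Mapping.keys (point_divisor x y) \<subseteq> \<P>"
    using keys_diff[of "frag_of (point_place (to_ac x) (to_ac y))" "frag_of (point_place (to_ac x) (to_ac (- y)))"]
    unfolding point_divisor_def by auto
  moreover have "divisor_degree (point_divisor x y) = 0"
    using divisor_degree_add[of "frag_of (point_place (to_ac x) (to_ac y))" "- frag_of (point_place (to_ac x) (to_ac (- y)))"]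
    unfolding point_divisor_def by (simp add: divisor_degree_minus)
  moreover have "galois_divisor \<sigma> (point_divisor x y) = point_divisor x y" if "\<sigma> \<in> absolute_galois" for \<sigma>
    using galois_point_place[OF that xy] galois_point_place[OF that xy']
    by (simp add: galois_divisor_def point_divisor_def frag_extend_diff)
  ultimately show ?thesis by (simp add: rational_divisors_def divisor_group_def)
qed

text \<open>When \<Delta> maps X to \<mu>X, the terms compared in \<open>indep\<close> are (\<mu>x_i
  - x_i') / y_i: the velocity of the i-th point relative to the flow that trivialises the family,
  measured by dx/y. A relation between the divisor classes forces the same integral relation between
  these elements of the base field.\<close>

theorem mordell_weil_rank_ge:
  fixes x y :: "'i \<Rightarrow> 'k"
  assumes \<Delta>: "poly_derivation \<Delta>"
    and \<Delta>g: "\<Delta> (Polynomial.smult (1 / d) g) = Polynomial.smult (2 * \<kappa>) (Polynomial.smult (1 / d) g)"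
    and I: "finite I" "inj_on x I"
    and xy: "\<And>i. i \<in> I \<Longrightarrow> d * (y i)\<^sup>2 = poly g (x i)" "\<And>i. i \<in> I \<Longrightarrow> y i \<noteq> 0"
    and indep: "\<And>n :: 'i \<Rightarrow> int. (\<Sum>i\<in>I. of_int (n i) * poly (\<Delta> [:- x i, 1:]) (x i) / y i) = 0 \<Longrightarrow> \<forall>i\<in>I. n i = 0"
  shows "enat (card I) \<le> mordell_weil_rank d g"
  unfolding mordell_weil_rank_def mordell_weil_group_eq
proof (rule rank_ge_quotient[OF divisor_comm_group principal_subgroup rational_divisors_subgroup I(1)])
  interpret \<Delta>: poly_derivation \<Delta> by fact
  show "point_divisor (x i) (y i) \<in> rational_divisors" if "i \<in> I" for i
    using point_divisor_rational[OF xy[OF that]] .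
  fix n :: "'i \<Rightarrow> int"
  let ?P = "\<lambda>i. point_place (to_ac (x i)) (to_ac (y i))"
  let ?Q = "\<lambda>i. point_place (to_ac (x i)) (- to_ac (y i))"
  define c where "c = (\<Sum>i\<in>I. frag_cmul (n i) (point_divisor (x i) (y i)))"
  assume rel: "finprod \<D> (\<lambda>i. point_divisor (x i) (y i) [^]\<^bsub>\<D>\<^esub> n i) I \<in> \<N>"
  have keys: "Poly_Mapping.keys (point_divisor (x i) (y i)) \<subseteq> \<P>" if "i \<in> I" for i
    using point_divisor_rational[OF xy[OF that]] by (simp add: rational_divisors_def divisor_group_def)
  have "finprod \<D> (\<lambda>i. point_divisor (x i) (y i) [^]\<^bsub>\<D>\<^esub> n i) I = c"
  proof -
    interpret D: comm_group \<D> by (rule divisor_comm_group)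
    have "finprod \<D> (\<lambda>i. point_divisor (x i) (y i) [^]\<^bsub>\<D>\<^esub> n i) I
        = finprod \<D> (\<lambda>i. frag_cmul (n i) (point_divisor (x i) (y i))) I"
      by (rule D.finprod_cong')
        (use keys order_trans[OF keys_cmul keys] in \<open>auto simp: divisor_group_def\<close>)
    also have "\<dots> = c"
      unfolding c_def divisor_group_def
      by (rule finprod_free_Abelian_group[OF I(1)]) (rule order_trans[OF keys_cmul keys])
    finally show ?thesis .
  qed
  with rel have "c \<in> \<N>" by simp
  then obtain \<phi> where \<phi>: "\<phi> \<noteq> (0, 0)" "\<And>v. v \<in> \<P> \<Longrightarrow> Poly_Mapping.lookup c v = v \<phi>"
    unfolding in_principal_iff by blast
  have lookup: "Poly_Mapping.lookup c v = (\<Sum>i\<in>I. n i * ((if v = ?P i then 1 else 0) - (if v = ?Q i then 1 else 0)))" for v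
    unfolding c_def point_divisor_def using I(1) by (simp add: lookup_sum lookup_minus)
  note xy' = on_curve_ac[OF xy]
  have xy'': "to_ac d * (- to_ac (y i))\<^sup>2 = poly (ac_poly g) (to_ac (x i))" "- to_ac (y i) \<noteq> 0" if "i \<in> I" for i
    using xy'[OF that that] by auto
  have PinP: "?P i \<in> \<P>" "?Q i \<in> \<P>" if "i \<in> I" for i
    using point_place_in_places[OF xy'[OF that that]] point_place_in_places[OF xy''[OF that]] by auto
  have PQ: "?P i \<noteq> ?Q i" if "i \<in> I" for i using point_place_neq_minus[OF xy'[OF that that]] .
  have neq: "point_place (to_ac (x i)) s \<noteq> point_place (to_ac (x j)) t"
    if "i \<in> I" "j \<in> I" "i \<noteq> j" "s = to_ac (y i) \<or> s = - to_ac (y i)" for i j s t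
  proof -
    have "to_ac (x i) \<noteq> to_ac (x j)" using I(2) that(1-3) by (auto simp: inj_on_def)
    moreover have "to_ac d * s\<^sup>2 = poly (ac_poly g) (to_ac (x i))" "s \<noteq> 0"
      using that(4) xy'[OF that(1) that(1)] by auto
    ultimately show ?thesis by (intro point_place_neq)
  qed
  have atP: "?P j \<phi> = n j" if j: "j \<in> I" for j
  proof -
    have "?P j \<phi> = (\<Sum>i\<in>I. if i = j then n i else 0)"
      unfolding \<phi>(2)[OF PinP(1)[OF j], symmetric] lookup
      by (rule sum.cong) (use neq[OF j] PQ[OF j] in auto)
    then show ?thesis using I(1) j by simp
  qed
  have atQ: "?Q j \<phi> = - n j" if j: "j \<in> I" for j
  proof -
    have "?Q j \<phi> = (\<Sum>i\<in>I. if i = j then - n i else 0)"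
      unfolding \<phi>(2)[OF PinP(2)[OF j], symmetric] lookup
      by (rule sum.cong) (use neq[OF j] PQ[OF j] in auto)
    then show ?thesis using I(1) j by simp
  qed
  \<comment> \<open>Indices with coefficient 0 are dropped since \<open>sum_residues_eq_0\<close>
    asks for positive multiplicities.\<close>
  define J where "J = {i \<in> I. n i \<noteq> 0}"
  have J: "finite J" "J \<subseteq> I" using I(1) by (auto simp: J_def)
  define e where "e = (\<lambda>j. nat \<bar>n j\<bar>)"
  have other: "v \<phi> = 0" if v: "v \<in> \<P>" "\<And>j. j \<in> J \<Longrightarrow> v \<noteq> ?P j \<and> v \<noteq> ?Q j" for v
    unfolding \<phi>(2)[OF v(1), symmetric] lookup
  proof (rule sum.neutral, rule ballI)
    fix i assume "i \<in> I"
    then show "n i * ((if v = ?P i then 1 else 0) - (if v = ?Q i then 1 else 0)) = 0"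
      using v(2)[of i] by (cases "n i = 0") (auto simp: J_def)
  qed
  obtain A B where AB: "A \<noteq> 0 \<or> B \<noteq> 0" "Polynomial.degree A \<le> (\<Sum>j\<in>J. e j)"
    "B \<noteq> 0 \<Longrightarrow> 2 * Polynomial.degree B + Polynomial.degree (ac_poly g) \<le> 2 * (\<Sum>j\<in>J. e j)"
    "\<And>j. j \<in> J \<Longrightarrow> int (2 * e j) \<le> fls_subdegree (peval (fls_const (to_ac (x j)) + fls_X) A
       + peval (fls_const (to_ac (x j)) + fls_X) B * point_sqrt (to_ac (x j)) (if n j \<ge> 0 then to_ac (y j) else - to_ac (y j)))"
    unfolding e_def
    using functions_of_relation[of J "\<lambda>j. to_ac (y j)" "\<lambda>j. to_ac (x j)" \<phi> n] J xy' \<phi>(1) other atP atQ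
    by (smt (verit) subsetD)
  \<comment> \<open>The ordinate of the zero over x_j. Changing the sign of y_j together with that
    of n_j does not affect n_j / y_j, so the residues come out as in \<open>indep\<close>.\<close>
  define y' where "y' = (\<lambda>j. if n j \<ge> 0 then y j else - y j)"
  have y'0: "y' j \<noteq> 0" if "j \<in> J" for j using xy(2)[of j] that J(2) by (auto simp: y'_def)
  have y'c: "d * (y' j)\<^sup>2 = poly g (x j)" if "j \<in> J" for j using xy(1)[of j] that J(2) by (auto simp: y'_def)
  let ?G = "Polynomial.smult (1 / d) g"
  have "\<exists>T. \<forall>j\<in>J. poly (T j) (x j) = y' j \<and> [:- x j, 1:] ^ (2 * e j + 1) dvd (T j)\<^sup>2 - ?G"
  proof (rule bchoice, rule ballI)
    fix j assume j: "j \<in> J"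
    have "(y' j)\<^sup>2 = poly ?G (x j)" using y'c[OF j] d_neq_0 by (simp flip: y'c[OF j])
    then show "\<exists>T. poly T (x j) = y' j \<and> [:- x j, 1:] ^ (2 * e j + 1) dvd T\<^sup>2 - ?G"
      using Hensel_sqrt y'0[OF j] by blast
  qed
  then obtain T where T: "\<And>j. j \<in> J \<Longrightarrow> poly (T j) (x j) = y' j"
    "\<And>j. j \<in> J \<Longrightarrow> [:- x j, 1:] ^ (2 * e j + 1) dvd (T j)\<^sup>2 - ?G" by blast
  have dvd: "ac_poly ([:- x j, 1:] ^ (2 * e j)) dvd A + B * ac_poly (T j)" if j: "j \<in> J" for j
  proof -
    have "[:- x j, 1:] ^ (2 * e j) dvd [:d:] * ((T j)\<^sup>2 - ?G)"
      by (intro dvd_mult power_le_dvd[OF T(2)[OF j]]) simp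
    also have "[:d:] * ((T j)\<^sup>2 - ?G) = [:d:] * (T j)\<^sup>2 - g"
      using d_neq_0 by (simp add: smult_diff_right)
    finally obtain E where E: "[:d:] * (T j)\<^sup>2 - g = [:- x j, 1:] ^ (2 * e j) * E" by (elim dvdE)
    have "ac_poly ([:d:] * (T j)\<^sup>2 - g) = ac_poly ([:- x j, 1:] ^ (2 * e j) * E)" by (rule arg_cong[OF E])
    then have T': "[:- to_ac (x j), 1:] ^ (2 * e j) dvd [:to_ac d:] * (ac_poly (T j))\<^sup>2 - ac_poly g"
      unfolding ac_poly_mult ac_poly_diff ac_poly_power ac_poly_linear by (simp add: map_poly_pCons)
    have T0: "poly (ac_poly (T j)) (to_ac (x j)) = to_ac (y' j)" using T(1)[OF j] by simp
    have "(if n j \<ge> 0 then to_ac (y j) else - to_ac (y j)) = to_ac (y' j)" by (simp add: y'_def)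
    with AB(4)[OF j] have "int (2 * e j) \<le> fls_subdegree (peval (fls_const (to_ac (x j)) + fls_X) A
       + peval (fls_const (to_ac (x j)) + fls_X) B * point_sqrt (to_ac (x j)) (to_ac (y' j)))" by simp
    then show ?thesis
      unfolding subdegree_ge_iff_dvd[OF on_curve_ac[OF y'c[OF j] y'0[OF j]] T0 T' AB(1)]
      by (simp only: ac_poly_power ac_poly_linear)
  qed
  \<comment> \<open>\<Delta> acts on polynomials over the base field, so the residue argument needs
    \<open>A\<close> and \<open>B\<close> there.\<close>
  obtain A' B' :: "'k poly" where AB': "A' \<noteq> 0 \<or> B' \<noteq> 0" "Polynomial.degree A' \<le> Polynomial.degree A"
    "B' \<noteq> 0 \<Longrightarrow> B \<noteq> 0" "Polynomial.degree B' \<le> Polynomial.degree B"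
    "\<And>j. j \<in> J \<Longrightarrow> [:- x j, 1:] ^ (2 * e j) dvd A' + B' * T j"
    using descent[of A B J "\<lambda>j. [:- x j, 1:] ^ (2 * e j)" T, OF AB(1) dvd] by blast
  have "(\<Sum>j\<in>J. of_nat (e j) * poly (\<Delta> [:- x j, 1:]) (x j) / y' j) = 0"
  proof (rule \<Delta>.sum_residues_eq_0[where G = ?G and A = A' and B = B' and T = T and \<kappa> = \<kappa>])
    show "Polynomial.degree ?G \<ge> 3" using degree_ge_3 d_neq_0 by simp
    show "inj_on x J" using I(2) J(2) by (rule inj_on_subset)
    show "Polynomial.degree A' \<le> (\<Sum>j\<in>J. e j)" using AB'(2) AB(2) by linarith
    show "2 * Polynomial.degree B' + Polynomial.degree ?G \<le> 2 * (\<Sum>j\<in>J. e j)" if "B' \<noteq> 0"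
      using AB(3)[OF AB'(3)[OF that]] AB'(4) d_neq_0 by simp
  qed (use \<Delta>g poly_nonsquare_over J(1) y'0 AB' T in \<open>auto simp: e_def J_def\<close>)
  moreover have "(\<Sum>j\<in>J. of_nat (e j) * poly (\<Delta> [:- x j, 1:]) (x j) / y' j)
      = (\<Sum>j\<in>J. of_int (n j) * poly (\<Delta> [:- x j, 1:]) (x j) / y j)"
  proof (rule sum.cong[OF refl])
    fix j
    show "of_nat (e j) * poly (\<Delta> [:- x j, 1:]) (x j) / y' j = of_int (n j) * poly (\<Delta> [:- x j, 1:]) (x j) / y j"
    proof (cases "n j \<ge> 0")
      case True
      then have "of_nat (e j) = (of_int (n j) :: 'k)" by (simp add: e_def)
      then show ?thesis using True by (simp add: y'_def)
    next
      case False
      then have "of_nat (e j) = (- of_int (n j) :: 'k)" by (simp add: e_def)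
      then show ?thesis using False by (simp add: y'_def)
    qed
  qed
  moreover have "\<dots> = (\<Sum>i\<in>I. of_int (n i) * poly (\<Delta> [:- x i, 1:]) (x i) / y i)"
    by (rule sum.mono_neutral_left) (use I(1) in \<open>auto simp: J_def\<close>)
  ultimately show "\<forall>i\<in>I. n i = 0" using indep by simp
qed

end

section \<open>Derivations\<close>

instance fract :: ("{idom, ring_char_0}") field_char_0
proof
  show "inj (of_nat :: nat \<Rightarrow> 'a fract)"
    by (rule injI) (simp add: of_nat_fract eq_fract)
qed

section \<open>Derivations of a field and their extension to polynomials\<close>

locale field_derivation =
  fixes \<delta> :: "'a::field_char_0 \<Rightarrow> 'a"
  assumes deriv_add: "\<delta> (x + y) = \<delta> x + \<delta> y"
    and deriv_mult: "\<delta> (x * y) = \<delta> x * y + x * \<delta> y"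
begin

lemma deriv_0 [simp]: "\<delta> 0 = 0"
  using deriv_mult[of 0 0] by simp

lemma deriv_1 [simp]: "\<delta> 1 = 0"
  using deriv_mult[of 1 1] by simp

lemma deriv_minus: "\<delta> (- x) = - \<delta> x"
  using deriv_add[of x "- x"] by (simp add: add_eq_0_iff)

lemma deriv_diff: "\<delta> (x - y) = \<delta> x - \<delta> y"
  using deriv_add[of x "- y"] deriv_minus by simp

lemma deriv_of_nat [simp]: "\<delta> (of_nat n) = 0"
  by (induction n) (auto simp: deriv_add)

lemma deriv_numeral [simp]: "\<delta> (numeral n) = 0"
  using deriv_of_nat[of "numeral n"] by (simp del: deriv_of_nat)

lemma deriv_power_Suc: "\<delta> (x ^ Suc n) = of_nat (Suc n) * x ^ n * \<delta> x"
proof (induction n)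
  case (Suc n)
  have "\<delta> (x ^ Suc (Suc n)) = \<delta> x * x ^ Suc n + x * \<delta> (x ^ Suc n)"
    by (metis deriv_mult power_Suc)
  then show ?case unfolding Suc by (simp add: algebra_simps)
qed simp

lemma deriv_power: "x * \<delta> (x ^ n) = of_nat n * x ^ n * \<delta> x"
  by (cases n) (simp_all only: deriv_power_Suc, simp_all)

lemma deriv_sum: "\<delta> (\<Sum>i\<in>I. f i) = (\<Sum>i\<in>I. \<delta> (f i))"
  by (induction I rule: infinite_finite_induct) (auto simp: deriv_add)

text \<open>The extension of \<delta> with X mapped to \<mu>X: \<delta> on the coefficients plus
  \<mu> times the Euler operator X d/dX. Neither summand raises the degree, as the estimate at
  infinity requires.\<close>

definition poly_deriv :: "'a \<Rightarrow> 'a poly \<Rightarrow> 'a poly" where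
  "poly_deriv \<mu> p = map_poly \<delta> p + Polynomial.smult \<mu> (pCons 0 (pderiv p))"

lemma map_poly_deriv_mult: "map_poly \<delta> (p * q) = map_poly \<delta> p * q + p * map_poly \<delta> q"
  by (rule poly_eqI) (simp add: coeff_map_poly coeff_mult deriv_sum deriv_mult sum.distrib)

lemma poly_derivation: "poly_derivation (poly_deriv \<mu>)"
proof
  fix p q :: "'a poly"
  show "poly_deriv \<mu> (p + q) = poly_deriv \<mu> p + poly_deriv \<mu> q"
    by (simp add: poly_deriv_def map_poly_add_hom deriv_add pderiv_add smult_add_right)
  have "pCons 0 (pderiv (p * q)) = pCons 0 (pderiv p) * q + p * pCons 0 (pderiv q)"
    by (simp add: pderiv_mult algebra_simps)
  then show "poly_deriv \<mu> (p * q) = poly_deriv \<mu> p * q + p * poly_deriv \<mu> q"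
    unfolding poly_deriv_def map_poly_deriv_mult by (simp only: smult_add_right) (simp add: algebra_simps)
  show "Polynomial.degree (poly_deriv \<mu> p) \<le> Polynomial.degree p"
    unfolding poly_deriv_def
  proof (rule degree_add_le)
    show "Polynomial.degree (map_poly \<delta> p) \<le> Polynomial.degree p"
      by (rule degree_le) (simp add: coeff_map_poly coeff_eq_0)
    have "Polynomial.degree (pCons 0 (pderiv p)) \<le> Polynomial.degree p"
    proof (cases "pderiv p = 0")
      case False
      then have "Polynomial.degree p \<noteq> 0" by (auto simp: pderiv_eq_0_iff)
      then show ?thesis by (simp add: degree_pderiv False)
    qed simp
    then show "Polynomial.degree (Polynomial.smult \<mu> (pCons 0 (pderiv p))) \<le> Polynomial.degree p"
      using degree_smult_le order_trans by blast
  qed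
qed

lemma poly_deriv_linear: "poly (poly_deriv \<mu> [:- x, 1:]) x = \<mu> * x - \<delta> x"
  by (simp add: poly_deriv_def map_poly_pCons deriv_minus pderiv_pCons)

end

text \<open>The derivative in the outermost variable, for which all inner variables are
  constants.\<close>

definition fract_deriv :: "'a::idom poly fract \<Rightarrow> 'a poly fract" where
  "fract_deriv q = (THE r. \<exists>a b. b \<noteq> 0 \<and> q = Fract a b \<and> r = Fract (pderiv a * b - a * pderiv b) (b * b))"

lemma fract_deriv_Fract:
  assumes b: "b \<noteq> 0"
  shows "fract_deriv (Fract a b) = Fract (pderiv a * b - a * pderiv b) (b * b)"
  unfolding fract_deriv_def
proof (rule the_equality)
  fix r assume "\<exists>a' b'. b' \<noteq> 0 \<and> Fract a b = Fract a' b' \<and> r = Fract (pderiv a' * b' - a' * pderiv b') (b' * b')"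
  then obtain a' b' where *: "b' \<noteq> 0" "Fract a b = Fract a' b'"
    and r: "r = Fract (pderiv a' * b' - a' * pderiv b') (b' * b')" by blast
  then have eq: "a * b' = a' * b" using b by (simp add: eq_fract)
  then have "pderiv (a * b') = pderiv (a' * b)" by simp
  then have "a * pderiv b' + b' * pderiv a = a' * pderiv b + b * pderiv a'" by (simp add: pderiv_mult)
  then have h: "b' * pderiv a = a' * pderiv b + b * pderiv a' - a * pderiv b'" by (simp add: algebra_simps)
  have "(pderiv a * b - a * pderiv b) * (b' * b') = (b' * pderiv a) * (b * b') - (a * b') * (pderiv b * b')"
    by (simp add: algebra_simps)
  also have "\<dots> = (a' * pderiv b + b * pderiv a') * (b * b') - (a * b') * (pderiv b' * b) - (a' * b) * (pderiv b * b')"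
    unfolding h eq[symmetric] by (simp add: algebra_simps)
  also have "\<dots> = (pderiv a' * b' - a' * pderiv b') * (b * b)"
    unfolding eq by (simp add: algebra_simps)
  finally have "(pderiv a' * b' - a' * pderiv b') * (b * b) = (pderiv a * b - a * pderiv b) * (b' * b')" ..
  then show "r = Fract (pderiv a * b - a * pderiv b) (b * b)"
    using * b by (simp add: r eq_fract)
qed (use b in blast)

lemma fract_deriv_field_derivation: "field_derivation (fract_deriv :: 'a::{idom, ring_char_0} poly fract \<Rightarrow> _)"
proof
  fix x y :: "'a poly fract"
  obtain a b c e where xy: "x = Fract a b" "b \<noteq> 0" "y = Fract c e" "e \<noteq> 0" by (metis Fract_cases)
  show "fract_deriv (x + y) = fract_deriv x + fract_deriv y"
    unfolding xy(1,3) using xy(2,4)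
    by (simp add: fract_deriv_Fract eq_fract pderiv_mult pderiv_add) (simp add: algebra_simps)
  show "fract_deriv (x * y) = fract_deriv x * y + x * fract_deriv y"
    unfolding xy(1,3) using xy(2,4)
    by (simp add: fract_deriv_Fract eq_fract pderiv_mult pderiv_add) (simp add: algebra_simps)
qed

lemma fract_deriv_const: "fract_deriv (to_fract [:c:]) = 0"
  by (simp add: to_fract_def fract_deriv_Fract fract_collapse)

lemma fract_deriv_X: "fract_deriv (to_fract [:0, 1:]) = 1"
  by (simp add: to_fract_def fract_deriv_Fract pderiv_pCons One_fract_def eq_fract)

text \<open>Evaluating at the variable only renames it. This is why f(t) is nonzero and t is
  transcendental.\<close>

lemma poly_fract_X:
  assumes "h 0 = 0"
  shows "poly (map_poly (\<lambda>c. to_fract [:h c:]) p) (to_fract [:0, 1:]) = to_fract (map_poly h p)"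
proof (induction p)
  case (pCons a p)
  have "to_fract [:h a:] + to_fract [:0, 1:] * to_fract (map_poly h p) = to_fract ([:h a:] + [:0, 1:] * map_poly h p)"
    by (simp only: to_fract_add to_fract_mult)
  also have "[:h a:] + [:0, 1:] * map_poly h p = pCons (h a) (map_poly h p)" by simp
  finally show ?case using pCons assms by (simp add: map_poly_pCons)
qed simp

lemma of_int_to_fract: "(of_int k :: 'a::idom poly fract) = to_fract [:of_int k:]"
proof -
  have n: "(of_nat n :: 'a poly fract) = to_fract [:of_nat n:]" for n
    by (simp add: of_nat_fract to_fract_def of_nat_poly)
  show ?thesis
  proof (cases k)
    case (nonneg n)
    then show ?thesis using n[of n] by simp
  next
    case (neg n)
    have "to_fract [:- of_nat (Suc n) :: 'a:] = - to_fract [:of_nat (Suc n):]"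
      by (simp only: to_fract_uminus[symmetric] minus_pCons minus_zero)
    then show ?thesis using n[of "Suc n"] neg by (simp del: of_nat_Suc)
  qed
qed

text \<open>If a prime p divides f = p q and its derivative, it divides q p'. In characteristic 0 it
  cannot divide p', which is nonzero of smaller degree, so it divides q and p^2 divides f.\<close>

lemma separable_if_squarefree:
  fixes f :: "rat poly"
  assumes "squarefree f" "f \<noteq> 0"
  obtains u w where "u * f + w * pderiv f = 1"
proof -
  have "coprime f (pderiv f)"
  proof (rule ccontr)
    assume "\<not> coprime f (pderiv f)"
    then have "\<not> is_unit (gcd f (pderiv f))" by (simp add: coprime_iff_gcd_eq_1)
    moreover have "gcd f (pderiv f) \<noteq> 0" using assms(2) by simp
    ultimately obtain p where p: "p dvd gcd f (pderiv f)" "prime p"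
      using prime_divisor_exists by blast
    then obtain q where q: "f = p * q" by (meson dvdE gcd_dvd1 dvd_trans)
    have "p dvd pderiv f" using p(1) by simp
    then have "p dvd p * pderiv q + q * pderiv p" unfolding q by (simp add: pderiv_mult)
    then have "p dvd q * pderiv p" by (simp add: dvd_add_right_iff)
    then have "p dvd q \<or> p dvd pderiv p" using p(2) by (simp add: prime_dvd_mult_iff)
    moreover have "\<not> p dvd pderiv p"
    proof
      assume dvd: "p dvd pderiv p"
      have deg: "Polynomial.degree p \<noteq> 0"
        using p(2) by (metis is_unit_iff_degree not_prime_0 not_prime_unit)
      then have "pderiv p \<noteq> 0" by (simp add: pderiv_eq_0_iff)
      then have "Polynomial.degree p \<le> Polynomial.degree (pderiv p)" using dvd by (rule dvd_imp_degree_le[rotated])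
      then show False using deg by (simp add: degree_pderiv)
    qed
    ultimately have "p ^ 2 dvd f" unfolding q by (auto simp: power2_eq_square intro: mult_dvd_mono)
    then have "is_unit p" using assms(1) by (simp add: squarefreeD)
    then show False using p(2) not_prime_unit by blast
  qed
  then have "fst (bezout_coefficients f (pderiv f)) * f + snd (bezout_coefficients f (pderiv f)) * pderiv f = 1"
    using bezout_coefficients_fst_snd[of f "pderiv f"] by simp
  then show ?thesis using that by blast
qed

section \<open>The twists\<close>

text \<open>The Euler operator X d/dX has monomials as eigenvectors. This gives both the
  separability of D X^m + a^2 and the value of \<mu> for which \<open>poly_deriv\<close> kills
  it.\<close>

lemma pCons_pderiv_monom:
  "pCons 0 (pderiv (Polynomial.monom c m + [:e:])) = Polynomial.monom (of_nat m * c) m"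
  for c :: "'a::idom"
  by (rule poly_eqI) (auto simp: coeff_pCons coeff_pderiv split: nat.splits)

lemma monom_curve_over:
  fixes D a :: "'k::field_char_0"
  assumes "D \<noteq> 0" "a \<noteq> 0" "m \<ge> 3"
  shows "curve_over 1 (Polynomial.monom D m + [:a\<^sup>2:])"
proof
  let ?g = "Polynomial.monom D m + [:a\<^sup>2:]"
  have m: "(of_nat m :: 'k) \<noteq> 0" using assms by simp
  note pCons_pderiv_monom[of D m "a\<^sup>2"]
  \<comment> \<open>The identity g - X g' / m = a^2, divided by a^2.\<close>
  then have "Polynomial.smult (1 / a\<^sup>2) ?g + Polynomial.smult (- 1 / (of_nat m * a\<^sup>2)) (pCons 0 (pderiv ?g)) = 1"
    using m assms(2) by (simp add: smult_add_right smult_monom add_monom flip: one_pCons)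
  moreover have "Polynomial.smult (- 1 / (of_nat m * a\<^sup>2)) (pCons 0 (pderiv ?g)) = [:0, - 1 / (of_nat m * a\<^sup>2):] * pderiv ?g"
    by simp
  ultimately have "[:1 / a\<^sup>2:] * ?g + [:0, - 1 / (of_nat m * a\<^sup>2):] * pderiv ?g = 1" by simp
  then show "\<exists>u w. u * ?g + w * pderiv ?g = 1" by blast
  have "Polynomial.degree ?g = m"
    using assms by (subst degree_add_eq_left) (auto simp: degree_monom_eq)
  then show "Polynomial.degree ?g \<ge> 3" using assms by simp
qed simp

text \<open>What the argument asks of the base field: a derivation and a transcendental t with
  derivative 1. Integer polynomials suffice in \<open>transcendental_t\<close>, since both the
  relations and the constants 1 and 2 are integral.\<close>

locale twist_setup = field_derivation \<delta> for \<delta> :: "'k::field_char_0 \<Rightarrow> 'k" +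
  fixes t a F :: 'k and m :: nat
  assumes t: "\<delta> t = 1"
    and transcendental_t: "\<And>p :: int poly. poly (map_poly of_int p) t = 0 \<Longrightarrow> p = 0"
    and a: "\<delta> a = 0" "a \<noteq> 0" and F: "F \<noteq> 0" and m: "odd m" "m \<ge> 3"
begin

text \<open>\<open>w\<close>, \<open>1\<close> and \<open>b\<close> are the powers \<open>v\<^sub>i\<^sup>m\<close> for \<open>v = (t, 1, 2)\<close>.\<close>

definition w :: 'k where "w = t ^ m"
definition b :: 'k where "b = 2 ^ m"

text \<open>Here (A_1, A_2, A_3) = (w^2, 1, b^2), and (w^2 - 1 - b^2)^2 - 4 b^2 is the symmetric
  expression s_1^2 - 4 s_2. In this form D_0 w^2 + a^2 is visibly a square, since a^2 cancels the
  last term.\<close>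

definition D\<^sub>0 :: 'k where "D\<^sub>0 = a\<^sup>2 * ((w\<^sup>2 - 1 - b\<^sup>2)\<^sup>2 - 4 * b\<^sup>2) / (4 * w\<^sup>2 * b\<^sup>2)"

text \<open>In \<open>D * px i ^ m\<close> the power F^m cancels and one factor D_0 is left. Since m
  - 1 is even, D is also F times a square.\<close>

definition D :: 'k where "D = 1 / (D\<^sub>0 ^ (m - 1) * F ^ m)"

definition v :: "nat \<Rightarrow> 'k" where "v i = (if i = 0 then t else if i = 1 then 1 else 2)"

definition px :: "nat \<Rightarrow> 'k" where "px i = F * D\<^sub>0 * (v i)\<^sup>2"

text \<open>Up to the choice of sign these are a (A_i - A_j - A_k) / (2 sqrt (A_j A_k)), where {i,
  j, k} are the three indices.\<close>

definition py :: "nat \<Rightarrow> 'k" where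
  "py i = (if i = 0 then a * (w\<^sup>2 - 1 - b\<^sup>2) / (2 * b)
     else if i = 1 then a * (1 - w\<^sup>2 - b\<^sup>2) / (2 * w * b) else a * (b\<^sup>2 - w\<^sup>2 - 1) / (2 * w))"

section \<open>The three points on the m-twist\<close>

lemma power_t_neq: "n > 0 \<Longrightarrow> t ^ n \<noteq> of_int k"
proof
  assume n: "n > 0" and eq: "t ^ n = of_int k"
  let ?p = "Polynomial.monom 1 n - [:k:]"
  have "map_poly of_int ?p = Polynomial.monom (1 :: 'k) n - [:of_int k:]"
    by (rule poly_eqI) (simp add: coeff_map_poly coeff_pCons split: nat.splits)
  then have "poly (map_poly of_int ?p) t = 0" using eq by (simp add: poly_monom)
  then have "?p = 0" by (rule transcendental_t)
  then have "Polynomial.coeff ?p n = 0" by simp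
  then show False using n by (simp add: coeff_pCons split: nat.splits)
qed

lemma t_neq_0: "t \<noteq> 0"
  using power_t_neq[of 1 0] by simp

lemma w_neq_0: "w \<noteq> 0"
  using t_neq_0 by (simp add: w_def)

lemma b_neq_0: "b \<noteq> 0"
  by (simp add: b_def)

lemma w2_neq: "w\<^sup>2 \<noteq> of_int k"
  using power_t_neq[of "m * 2" k] m by (simp add: w_def power_mult)

lemma D\<^sub>0_neq_0: "D\<^sub>0 \<noteq> 0"
proof -
  have "(w\<^sup>2 - 1 - b\<^sup>2)\<^sup>2 - 4 * b\<^sup>2 = (w\<^sup>2 - (1 + b)\<^sup>2) * (w\<^sup>2 - (1 - b)\<^sup>2)"
    by (simp add: power2_eq_square algebra_simps)
  moreover have "w\<^sup>2 \<noteq> (1 + b)\<^sup>2" "w\<^sup>2 \<noteq> (1 - b)\<^sup>2"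
    using w2_neq[of "(1 + 2 ^ m)\<^sup>2"] w2_neq[of "(1 - 2 ^ m)\<^sup>2"] by (simp_all add: b_def)
  ultimately show ?thesis using a(2) w_neq_0 b_neq_0 by (simp add: D\<^sub>0_def)
qed

lemma D_neq_0: "D \<noteq> 0"
  using D\<^sub>0_neq_0 F by (simp add: D_def)

lemma v_power: "(v i) ^ m = (if i = 0 then w else if i = 1 then 1 else b)"
  by (simp add: v_def w_def b_def)

lemma v_power2: "((v i)\<^sup>2) ^ m = ((v i) ^ m)\<^sup>2"
  by (simp add: power_mult[symmetric] mult.commute)

lemma D_px: "D * px i ^ m = D\<^sub>0 * ((v i) ^ m)\<^sup>2"
proof -
  obtain k where k: "m = Suc k" using m by (cases m) auto
  have "px i ^ m = F ^ m * D\<^sub>0 ^ m * ((v i) ^ m)\<^sup>2"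
    by (simp add: px_def power_mult_distrib v_power2)
  then show ?thesis using F D\<^sub>0_neq_0 unfolding D_def by (simp add: k)
qed

lemma on_curve: "i \<le> 2 \<Longrightarrow> (py i)\<^sup>2 = D * px i ^ m + a\<^sup>2"
  unfolding D_px v_power D\<^sub>0_def py_def using w_neq_0 b_neq_0
  by (auto simp: field_simps power2_eq_square)

lemma py_neq_0: "py i \<noteq> 0"
proof -
  have "w\<^sup>2 - 1 - b\<^sup>2 \<noteq> 0" "1 - w\<^sup>2 - b\<^sup>2 \<noteq> 0" "b\<^sup>2 - w\<^sup>2 - 1 \<noteq> 0"
    using w2_neq[of "1 + (2 ^ m)\<^sup>2"] w2_neq[of "1 - (2 ^ m)\<^sup>2"] w2_neq[of "(2 ^ m)\<^sup>2 - 1"]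
    by (auto simp: b_def algebra_simps)
  then show ?thesis using a(2) w_neq_0 b_neq_0 by (simp add: py_def)
qed

lemma deriv_b: "\<delta> b = 0"
  using deriv_of_nat[of "2 ^ m"] by (simp add: b_def)

lemma deriv_w_neq_0: "\<delta> w \<noteq> 0"
proof -
  have "t * \<delta> w = of_nat m * w" using deriv_power[of t m] t by (simp add: w_def)
  then show ?thesis using w_neq_0 m by auto
qed

text \<open>Denominators are cleared before differentiating, so that the product rule and
  \<open>\<delta> b = 0\<close> suffice.\<close>

lemma deriv_py:
  "b * \<delta> (py 0) = a * w * \<delta> w"
  "2 * b * w\<^sup>2 * \<delta> (py 1) = - a * (1 - b\<^sup>2 + w\<^sup>2) * \<delta> w"
  "2 * w\<^sup>2 * \<delta> (py 2) = - a * (b\<^sup>2 - 1 + w\<^sup>2) * \<delta> w"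
proof -
  have b2: "\<delta> (b\<^sup>2) = 0" by (simp add: power2_eq_square deriv_mult deriv_b)
  have w2: "\<delta> (w\<^sup>2) = 2 * w * \<delta> w" by (simp add: power2_eq_square deriv_mult)
  have "2 * b * py 0 = a * (w\<^sup>2 - 1 - b\<^sup>2)" using b_neq_0 by (simp add: py_def)
  then have "\<delta> (2 * b * py 0) = \<delta> (a * (w\<^sup>2 - 1 - b\<^sup>2))" by (rule arg_cong)
  then have "2 * (b * \<delta> (py 0)) = 2 * (a * w * \<delta> w)"
    by (simp add: deriv_mult deriv_diff deriv_b a b2 w2 mult_ac)
  then show "b * \<delta> (py 0) = a * w * \<delta> w" by simp
  have e1: "2 * b * (w * py 1) = a * (1 - w\<^sup>2 - b\<^sup>2)" using b_neq_0 w_neq_0 by (simp add: py_def)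
  then have "\<delta> (2 * b * (w * py 1)) = \<delta> (a * (1 - w\<^sup>2 - b\<^sup>2))" by (rule arg_cong)
  then have "2 * b * (\<delta> w * py 1 + w * \<delta> (py 1)) = - 2 * a * w * \<delta> w"
    by (simp add: deriv_mult deriv_diff deriv_b a b2 w2 mult_ac)
  then have "w * (2 * b * (\<delta> w * py 1 + w * \<delta> (py 1))) = w * (- 2 * a * w * \<delta> w)" by (simp only:)
  then have "2 * b * w\<^sup>2 * \<delta> (py 1) = w * (- 2 * a * w * \<delta> w) - (2 * b * (w * py 1)) * \<delta> w"
    by (simp add: algebra_simps power2_eq_square)
  then show "2 * b * w\<^sup>2 * \<delta> (py 1) = - a * (1 - b\<^sup>2 + w\<^sup>2) * \<delta> w"
    unfolding e1 by (simp add: algebra_simps power2_eq_square)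
  have e2: "2 * (w * py 2) = a * (b\<^sup>2 - w\<^sup>2 - 1)" using w_neq_0 by (simp add: py_def)
  then have "\<delta> (2 * (w * py 2)) = \<delta> (a * (b\<^sup>2 - w\<^sup>2 - 1))" by (rule arg_cong)
  then have "2 * (\<delta> w * py 2 + w * \<delta> (py 2)) = - 2 * a * w * \<delta> w"
    by (simp add: deriv_mult deriv_diff deriv_b a b2 w2 mult_ac)
  then have "w * (2 * (\<delta> w * py 2 + w * \<delta> (py 2))) = w * (- 2 * a * w * \<delta> w)" by (simp only:)
  then have "2 * w\<^sup>2 * \<delta> (py 2) = w * (- 2 * a * w * \<delta> w) - (2 * (w * py 2)) * \<delta> w"
    by (simp add: algebra_simps power2_eq_square)
  then show "2 * w\<^sup>2 * \<delta> (py 2) = - a * (b\<^sup>2 - 1 + w\<^sup>2) * \<delta> w"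
    unfolding e2 by (simp add: algebra_simps power2_eq_square)
qed

text \<open>Chosen to annihilate D X^m: then D X^m + a^2 is a constant of the extended derivation,
  and \<kappa> = 0.\<close>

definition \<mu> :: 'k where "\<mu> = - \<delta> D / (of_nat m * D)"

text \<open>Differentiating y_i^2 = D x_i^m + a^2 gives 2 y_i y_i' = -m D x_i^(m-1) (\<mu>x_i -
  x_i'). Dividing by y_i trades the derivative of x_i for that of y_i, and with the value of D x_i^m
  the complicated D_0 cancels.\<close>

lemma differential:
  assumes "i \<le> 2"
  shows "(\<mu> * px i - \<delta> (px i)) / py i = - (2 * F / of_nat m) * ((v i)\<^sup>2 * \<delta> (py i) / ((v i) ^ m)\<^sup>2)"
proof -
  have m0: "(of_nat m :: 'k) \<noteq> 0" using m by simp
  have v0: "v i \<noteq> 0" using t_neq_0 by (simp add: v_def)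
  have px0: "px i \<noteq> 0" using F D\<^sub>0_neq_0 v0 by (simp add: px_def)
  have "\<delta> ((py i)\<^sup>2) = \<delta> (D * px i ^ m + a\<^sup>2)" using on_curve[OF assms] by simp
  then have "2 * py i * \<delta> (py i) = \<delta> D * px i ^ m + D * \<delta> (px i ^ m)"
    by (simp add: power2_eq_square deriv_mult deriv_add a mult.assoc)
  then have "px i * (2 * py i * \<delta> (py i)) = px i * (\<delta> D * px i ^ m + D * \<delta> (px i ^ m))" by simp
  also have "\<dots> = \<delta> D * px i * px i ^ m + D * (px i * \<delta> (px i ^ m))" by (simp add: algebra_simps)
  also have "\<dots> = \<delta> D * px i * px i ^ m + D * (of_nat m * px i ^ m * \<delta> (px i))" by (simp only: deriv_power)
  also have "\<dots> = - (of_nat m) * (D * px i ^ m) * (\<mu> * px i - \<delta> (px i))"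
    using m0 D_neq_0 by (simp add: \<mu>_def algebra_simps)
  also have "\<dots> = - (of_nat m) * (D\<^sub>0 * ((v i) ^ m)\<^sup>2) * (\<mu> * px i - \<delta> (px i))" by (simp only: D_px)
  finally have "F * D\<^sub>0 * (v i)\<^sup>2 * (2 * py i * \<delta> (py i)) = - (of_nat m) * (D\<^sub>0 * ((v i) ^ m)\<^sup>2) * (\<mu> * px i - \<delta> (px i))"
    by (simp add: px_def)
  then have "D\<^sub>0 * (F * (v i)\<^sup>2 * (2 * py i * \<delta> (py i))) = D\<^sub>0 * (- (of_nat m) * ((v i) ^ m)\<^sup>2 * (\<mu> * px i - \<delta> (px i)))"
    by (simp only: mult_ac)
  then have *: "F * (v i)\<^sup>2 * (2 * py i * \<delta> (py i)) = - (of_nat m) * ((v i) ^ m)\<^sup>2 * (\<mu> * px i - \<delta> (px i))"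
    using mult_left_cancel[OF D\<^sub>0_neq_0] by blast
  define Z where "Z = \<mu> * px i - \<delta> (px i)"
  define V where "V = ((v i) ^ m)\<^sup>2"
  have V0: "V \<noteq> 0" using v0 by (simp add: V_def)
  have "F * (v i)\<^sup>2 * (2 * py i * \<delta> (py i)) = - (of_nat m) * V * Z" using * by (simp add: Z_def V_def)
  then have "Z = - (F * (v i)\<^sup>2 * (2 * py i * \<delta> (py i))) / (of_nat m * V)"
    using m0 V0 by (simp add: field_simps)
  then show ?thesis unfolding Z_def[symmetric] V_def[symmetric] using py_neq_0[of i] m0 V0 by simp
qed

text \<open>Once denominators and the common factor a \<delta>w are removed, a relation becomes an
  integral polynomial equation for t with the exponents m + 2, 2m and 0. Its first coefficient
  contains n_0 alone; the other two give a linear system for n_1 and n_2 that is nonsingular because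
  b is not 1 or -1.\<close>

lemma independent:
  assumes "(\<Sum>i\<le>2. of_int (n i) * (\<mu> * px i - \<delta> (px i)) / py i) = 0"
  shows "\<forall>i\<le>2. n i = (0 :: int)"
proof -
  have "(\<Sum>i\<le>2. of_int (n i) * (\<mu> * px i - \<delta> (px i)) / py i)
      = - (2 * F / of_nat m) * (\<Sum>i\<le>2. of_int (n i) * ((v i)\<^sup>2 * \<delta> (py i) / ((v i) ^ m)\<^sup>2))"
    unfolding sum_distrib_left
  proof (rule sum.cong[OF refl])
    fix i :: nat assume "i \<in> {..2}"
    then show "of_int (n i) * (\<mu> * px i - \<delta> (px i)) / py i
        = - (2 * F / of_nat m) * (of_int (n i) * ((v i)\<^sup>2 * \<delta> (py i) / ((v i) ^ m)\<^sup>2))"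
      using differential[of i] unfolding times_divide_eq_right[symmetric] by (simp only: atMost_iff mult_ac)
  qed
  then have 0: "(\<Sum>i\<le>2. of_int (n i) * ((v i)\<^sup>2 * \<delta> (py i) / ((v i) ^ m)\<^sup>2)) = 0"
    using assms F m by auto
  have s: "(\<Sum>i\<le>2. f i) = f 0 + f 1 + f (2 :: nat)" for f :: "nat \<Rightarrow> 'k"
    by (simp add: numeral_2_eq_2)
  have "of_int (n 0) * (t\<^sup>2 * \<delta> (py 0) / w\<^sup>2) + of_int (n 1) * \<delta> (py 1) + of_int (n 2) * (4 * \<delta> (py 2) / b\<^sup>2) = 0"
    using 0 unfolding s v_power by (simp add: v_def)
  then have "2 * b\<^sup>2 * w\<^sup>2 * (of_int (n 0) * (t\<^sup>2 * \<delta> (py 0) / w\<^sup>2) + of_int (n 1) * \<delta> (py 1) + of_int (n 2) * (4 * \<delta> (py 2) / b\<^sup>2)) = 0"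
    by simp
  moreover have "2 * b\<^sup>2 * w\<^sup>2 * (of_int (n 0) * (t\<^sup>2 * \<delta> (py 0) / w\<^sup>2) + of_int (n 1) * \<delta> (py 1) + of_int (n 2) * (4 * \<delta> (py 2) / b\<^sup>2))
     = 2 * b * of_int (n 0) * t\<^sup>2 * (b * \<delta> (py 0)) + of_int (n 1) * b * (2 * b * w\<^sup>2 * \<delta> (py 1)) + 4 * of_int (n 2) * (2 * w\<^sup>2 * \<delta> (py 2))"
    using b_neq_0 w_neq_0 by (simp add: field_simps power2_eq_square)
  ultimately have "a * \<delta> w * (2 * b * of_int (n 0) * (t\<^sup>2 * w) - of_int (n 1) * b * (1 - b\<^sup>2 + w\<^sup>2) - 4 * of_int (n 2) * (b\<^sup>2 - 1 + w\<^sup>2)) = 0"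
    unfolding deriv_py by (simp add: algebra_simps)
  then have rel: "2 * b * of_int (n 0) * (t\<^sup>2 * w) - of_int (n 1) * b * (1 - b\<^sup>2 + w\<^sup>2) - 4 * of_int (n 2) * (b\<^sup>2 - 1 + w\<^sup>2) = 0"
    using a(2) deriv_w_neq_0 by simp
  define B :: int where "B = 2 ^ m"
  have bB: "b = of_int B" by (simp add: b_def B_def)
  \<comment> \<open>The relation \<open>rel\<close> as a polynomial in t, using w = t^m; the factor
    4 is the square of the third value of v.\<close>
  define p where "p = Polynomial.monom (2 * B * n 0) (m + 2) - Polynomial.monom (n 1 * B + 4 * n 2) (2 * m)
      - [:n 1 * B * (1 - B\<^sup>2) + 4 * n 2 * (B\<^sup>2 - 1):]"
  have "map_poly of_int p = Polynomial.monom (of_int (2 * B * n 0)) (m + 2) - Polynomial.monom (of_int (n 1 * B + 4 * n 2)) (2 * m)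
      - [:of_int (n 1 * B * (1 - B\<^sup>2) + 4 * n 2 * (B\<^sup>2 - 1)) :: 'k:]"
    by (rule poly_eqI) (simp add: p_def coeff_map_poly coeff_pCons split: nat.splits)
  then have "poly (map_poly of_int p) t = of_int (2 * B * n 0) * t ^ (m + 2) - of_int (n 1 * B + 4 * n 2) * t ^ (2 * m)
      - of_int (n 1 * B * (1 - B\<^sup>2) + 4 * n 2 * (B\<^sup>2 - 1))"
    by (simp add: poly_monom)
  also have "\<dots> = 2 * b * of_int (n 0) * (t\<^sup>2 * w) - of_int (n 1) * b * (1 - b\<^sup>2 + w\<^sup>2) - 4 * of_int (n 2) * (b\<^sup>2 - 1 + w\<^sup>2)"
  proof -
    have t1: "t ^ (m + 2) = t\<^sup>2 * w" by (simp only: w_def power_add mult.commute)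
    have t2: "t ^ (2 * m) = w\<^sup>2" by (simp add: w_def power_mult[symmetric] mult.commute)
    show ?thesis unfolding t1 t2 bB by (simp add: algebra_simps)
  qed
  finally have "p = 0" using rel transcendental_t by simp
  then have c: "Polynomial.coeff p (m + 2) = 0" "Polynomial.coeff p (2 * m) = 0" "Polynomial.coeff p 0 = 0" by simp_all
  have B1: "B > 1" using m by (simp add: B_def)
  \<comment> \<open>The three exponents are distinct because m is neither 2 nor 0, so the
    coefficients can be compared separately.\<close>
  have ne: "m + 2 \<noteq> 2 * m" "2 * m \<noteq> m + 2" "m \<noteq> 0" using m by auto
  have "2 * B * n 0 = 0" using c(1) ne by (simp add: p_def coeff_pCons split: nat.splits)
  then have n0: "n 0 = 0" using B1 by simp
  have e1: "n 1 * B + 4 * n 2 = 0" using c(2) ne by (simp add: p_def coeff_pCons split: nat.splits)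
  have "n 1 * B * (1 - B\<^sup>2) + 4 * n 2 * (B\<^sup>2 - 1) = 0" using c(3) ne by (simp add: p_def)
  then have "(n 1 * B - 4 * n 2) * (1 - B\<^sup>2) = 0" by (simp add: algebra_simps)
  moreover have "1 - B\<^sup>2 \<noteq> 0" using B1 by (simp add: power2_eq_1_iff)
  ultimately have "n 1 * B - 4 * n 2 = 0" by simp
  with e1 have "n 2 = 0" "n 1 * B = 0" by auto
  then have n12: "n 1 = 0" "n 2 = 0" using B1 by simp_all
  show ?thesis using n0 n12 by (auto simp: numeral_2_eq_2 le_Suc_eq)
qed

lemma monom_rank: "3 \<le> mordell_weil_rank 1 (Polynomial.monom D m + [:a\<^sup>2:])"
proof -
  let ?g = "Polynomial.monom D m + [:a\<^sup>2:]"
  interpret curve_over 1 ?g using monom_curve_over[OF D_neq_0 a(2) m(2)] .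
  note pCons_pderiv_monom[of D m "a\<^sup>2"]
  moreover have "map_poly \<delta> ?g = Polynomial.monom (\<delta> D) m"
    by (rule poly_eqI) (simp add: coeff_map_poly coeff_pCons deriv_add deriv_mult a power2_eq_square split: nat.splits)
  moreover have "\<delta> D + \<mu> * (of_nat m * D) = 0" using D_neq_0 m by (simp add: \<mu>_def)
  ultimately have dg: "poly_deriv \<mu> ?g = 0"
    by (simp add: poly_deriv_def smult_monom add_monom)
  have inj: "inj_on px {..2}"
  proof -
    have "(v i)\<^sup>2 \<noteq> (v j)\<^sup>2" if "i < j" "j \<le> 2" for i j
      using that power_t_neq[of 2 1] power_t_neq[of 2 4] by (auto simp: v_def)
    then have "px i \<noteq> px j" if "i < j" "j \<le> 2" for i j
      using that F D\<^sub>0_neq_0 by (simp add: px_def)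
    then show ?thesis unfolding inj_on_def by (metis atMost_iff linorder_neqE_nat)
  qed
  have "enat (card {..2::nat}) \<le> mordell_weil_rank 1 ?g"
  proof (rule mordell_weil_rank_ge[OF poly_derivation[of \<mu>], where \<kappa> = 0 and x = px and y = py])
    show "poly_deriv \<mu> (Polynomial.smult (1 / 1) ?g) = Polynomial.smult (2 * 0) (Polynomial.smult (1 / 1) ?g)"
      using dg by simp
    show "1 * (py i)\<^sup>2 = poly ?g (px i)" if "i \<in> {..2}" for i
      using on_curve[of i] that by (simp add: poly_monom)
    show "\<forall>i\<in>{..2}. n i = 0"
      if "(\<Sum>i\<le>2. of_int (n i) * poly (poly_deriv \<mu> [:- px i, 1:]) (px i) / py i) = 0" for n :: "nat \<Rightarrow> int"
      using independent[of n] that unfolding poly_deriv_linear by simp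
  qed (use inj py_neq_0 in auto)
  then show ?thesis by (simp add: numeral_eq_enat)
qed

text \<open>As g has constant coefficients, \<mu> = 0 fits and \<kappa> accounts for D alone. The
  single term is then -\<delta>t / y = -1 / y, which is not zero.\<close>

lemma twist_rank:
  assumes sep: "u * g + w' * pderiv g = 1" and deg: "Polynomial.degree g \<ge> 3"
    and const: "map_poly \<delta> g = 0" and val: "poly g t = F"
  shows "1 \<le> mordell_weil_rank D g"
proof -
  interpret curve_over D g using D_neq_0 sep deg by unfold_locales auto
  obtain k where k: "m = 2 * k + 1" using m(1) by (elim oddE)
  \<comment> \<open>A square root of F / D = F^(m+1) D_0^(m-1); both exponents are even for odd
    m.\<close>
  define y where "y = F ^ (k + 1) * D\<^sub>0 ^ k"
  have y0: "y \<noteq> 0" using F D\<^sub>0_neq_0 by (simp add: y_def)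
  have "y\<^sup>2 = F * F ^ m * D\<^sub>0 ^ (m - 1)"
    by (simp add: y_def k power2_eq_square power_add power_mult mult_ac)
  then have on: "D * y\<^sup>2 = poly g t" using F D\<^sub>0_neq_0 by (simp add: D_def val)
  define \<kappa> where "\<kappa> = - \<delta> D / (2 * D)"
  have "D * \<delta> (1 / D) + \<delta> D * (1 / D) = 0" using deriv_mult[of D "1 / D"] D_neq_0 by (simp add: add.commute)
  then have d: "\<delta> (1 / D) = 2 * \<kappa> * (1 / D)"
    using D_neq_0 by (simp add: \<kappa>_def field_simps eq_neg_iff_add_eq_0)
  have c0: "\<delta> (Polynomial.coeff g i) = 0" for i
    using arg_cong[OF const, of "\<lambda>p. Polynomial.coeff p i"] by (simp add: coeff_map_poly)
  have "poly_deriv 0 (Polynomial.smult r g) = Polynomial.smult (2 * \<kappa>) (Polynomial.smult r g)"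
    if "\<delta> r = 2 * \<kappa> * r" for r
    unfolding poly_deriv_def by (rule poly_eqI) (simp add: coeff_map_poly deriv_mult c0 that)
  note dg = this[OF d]
  have "enat (card {0::nat}) \<le> mordell_weil_rank D g"
  proof (rule mordell_weil_rank_ge[OF poly_derivation[of 0] dg, where x = "\<lambda>_. t" and y = "\<lambda>_. y"])
    show "\<forall>i\<in>{0}. n i = 0"
      if "(\<Sum>i\<in>{0}. of_int (n i) * poly (poly_deriv 0 [:- t, 1:]) t / y) = 0" for n :: "nat \<Rightarrow> int"
      using that y0 unfolding poly_deriv_linear by (simp add: t)
  qed (use on y0 in auto)
  then show ?thesis by (simp add: one_enat_def)
qed

end

section \<open>The field of rational functions in four variables\<close>

lemma ratfun4_const_hom:
  "ratfun4_const (x + y) = ratfun4_const x + ratfun4_const y"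
  "ratfun4_const (x * y) = ratfun4_const x * ratfun4_const y"
  "ratfun4_const 0 = 0" "ratfun4_const 1 = 1" "ratfun4_const x = 0 \<longleftrightarrow> x = 0"
  unfolding ratfun4_const_def
  by (simp_all flip: to_fract_add to_fract_mult one_pCons)

lemma ratfun4_const_of_nat: "ratfun4_const (of_nat n) = of_nat n"
  by (induction n) (simp_all add: ratfun4_const_hom)

theorem theorem2p3:
  fixes f :: "rat poly" and m :: nat and a :: rat
  assumes "squarefree f" and "Polynomial.degree f \<ge> 3"
    and "odd m" and "m \<ge> 3"
    and "a \<noteq> 0"
  shows "\<exists>D :: ratfun4. D \<noteq> 0 \<and>
           mordell_weil_rank D (map_poly ratfun4_const f) > 0 \<and>
           mordell_weil_rank 1 (Polynomial.monom D m + [:ratfun4_const a ^ 2:]) \<ge> 3"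
proof -
  \<comment> \<open>The outermost variable, in which \<open>fract_deriv\<close> differentiates; the
    coefficients of f and the number a lie among its constants.\<close>
  define t :: ratfun4 where "t = to_fract [:0, 1:]"
  define g where "g = map_poly ratfun4_const f"
  define F where "F = poly g t"
  have f0: "f \<noteq> 0" using assms(2) by auto
  have const: "fract_deriv (ratfun4_const c) = 0" for c
    unfolding ratfun4_const_def by (rule fract_deriv_const)
  have "F = to_fract (map_poly (\<lambda>c. [:[:[:c:]:]:]) f)"
    unfolding F_def g_def t_def ratfun4_const_def by (rule poly_fract_X) simp
  moreover have "map_poly (\<lambda>c. [:[:[:c:]:]:]) f \<noteq> 0"
    using f0 by (subst map_poly_eq_0_iff) auto
  ultimately have F0: "F \<noteq> 0" by simp
  have trans: "p = 0" if "poly (map_poly of_int p) t = 0" for p :: "int poly"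
  proof -
    have "poly (map_poly of_int p) t = to_fract (map_poly of_int p)"
      unfolding t_def of_int_to_fract by (rule poly_fract_X) simp
    with that have "map_poly of_int p = (0 :: rat poly poly poly poly)" by simp
    then show ?thesis by (subst (asm) map_poly_eq_0_iff) auto
  qed
  interpret twist_setup fract_deriv t "ratfun4_const a" F m
    using fract_deriv_field_derivation const assms trans F0
    by (auto simp: twist_setup_def twist_setup_axioms_def ratfun4_const_hom t_def fract_deriv_X)
  obtain u w' where uw: "u * f + w' * pderiv f = 1" using separable_if_squarefree[OF assms(1) f0] .
  have mult: "map_poly ratfun4_const (p * q) = map_poly ratfun4_const p * map_poly ratfun4_const q" for p q
    by (rule map_poly_mult_hom) (auto simp: ratfun4_const_hom)
  have pd: "map_poly ratfun4_const (pderiv f) = pderiv g"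
    unfolding g_def
    by (rule poly_eqI) (simp add: coeff_map_poly coeff_pderiv ratfun4_const_hom ratfun4_const_of_nat)
  have "map_poly ratfun4_const (u * f + w' * pderiv f) = map_poly ratfun4_const 1" using uw by simp
  then have sep: "map_poly ratfun4_const u * g + map_poly ratfun4_const w' * pderiv g = 1"
    by (simp add: map_poly_add_hom ratfun4_const_hom mult pd flip: g_def)
  have "Polynomial.degree g = Polynomial.degree f"
    unfolding g_def by (rule degree_map_poly) (auto simp: ratfun4_const_hom)
  then have deg: "Polynomial.degree g \<ge> 3" using assms(2) by simp
  have "map_poly fract_deriv g = 0"
    unfolding g_def by (rule poly_eqI) (simp add: coeff_map_poly ratfun4_const_hom const)
  from twist_rank[OF sep deg this] have "1 \<le> mordell_weil_rank D g" by (simp add: F_def)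
  then have "mordell_weil_rank D g > 0" by (metis less_le_trans zero_less_one)
  then show ?thesis using monom_rank D_neq_0 unfolding g_def by blast
qed

end
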